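(* Let $\alpha_1,\alpha_2\in(0,1)$, $c>0$, $n\ge1$, $p>1$, and assume that $s\mapsto\Psi(s)^{-1}=s^{(\alpha_2c+\alpha_1s)/(c+s)}$ is a Bernstein function on $(0,\infty)$. Let $X=L^1(\mathbb R^n)\cap L^\infty(\mathbb R^n)$, $0\le\varphi\in X$, $\varphi\not\equiv0$, and for $A>0$ let $T_A\in(0,\infty]$ be the maximal existence time of the nonnegative maximal mild solution with initial datum $u_0=A\varphi$. There is $c_0>0$, depending only on $p$ and $\|\varphi\|_X=\|\varphi\|_1+\|\varphi\|_\infty$, such that $$T_A\ge K^{-1}(c_0A^{1-p})\qquad\text{for all }A>0.$$ Consequently, $$T_A\gtrsim A^{-(p-1)/\alpha_1}\quad(A\to\infty),\qquad T_A\gtrsim A^{-(p-1)/\alpha_2}\quad(A\downarrow0).$$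
   Context: $f\gtrsim g$ in a limit means that $f\ge Cg$ for some constant $C>0$ independent of $A$, for all $A$ close enough to the limit. A Bernstein function is a $C^\infty$ function $F:(0,\infty)\to[0,\infty)$ with $(-1)^{m-1}F^{(m)}\ge0$ for all $m\ge1$. $\Psi(z)=z^{-B(z)}$ with $B(z)=\frac{\alpha_2c+\alpha_1z}{c+z}$ (principal branch), $\psi\in L^1_{\rm loc}(0,\infty)$ is the continuous function on $(0,\infty)$ of exponential order whose Laplace transform is $\Psi$, and $K(t)=\int_0^t\psi(s)\,ds$, which under the Bernstein condition is a strictly increasing continuous bijection of $[0,\infty)$ with inverse $K^{-1}$. The families are $S_{\mathcal A}(t)g=Z(t)*g$, $P_{\mathcal A}(t)g=Y(t)*g$, where, under the Bernstein condition, $Z(t)$ ($t>0$, weakly continuous in $t$) are probability measures and $Y(t)$ (a.e. $t>0$, measurable in $t$) are finite positive measures on $\mathbb R^n$ determined by $$\int_0^\infty e^{-zt}\int_{\mathbb R^n}e^{-ix\cdot\xi}Z(t,dx)\,dt=\frac{\Psi(z)^{-1}}{z(\Psi(z)^{-1}+|\xi|^2)},\qquad\int_0^\infty e^{-zt}\int_{\mathbb R^n}e^{-ix\cdot\xi}Y(t,dx)\,dt=\frac1{\Psi(z)^{-1}+|\xi|^2}\quad(z>0);$$ $S_{\mathcal A}(0)=I$. A mild solution on $[0,T]$ is a function in $C([0,T];L^1(\mathbb R^n))\cap L^\infty((0,T);L^\infty(\mathbb R^n))$ satisfying $$u(t)=S_{\mathcal A}(t)u_0+\int_0^tP_{\mathcal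 A}(t-s)(u(s)_+)^p\,ds$$ in $L^1$ for every $t\in[0,T]$ and in $L^\infty$ for a.e. $t>0$. For each $0\le u_0\in X$ there is a unique nonnegative maximal mild solution $u$ on $[0,T_{\max})$, $0<T_{\max}\le\infty$, i.e. one that is a mild solution on $[0,T]$ for all $T<T_{\max}$ and cannot be extended to a mild solution on a strictly larger interval. *)

theory Defs
  imports "HOL-Probability.Probability"
begin

section \<open>Bernstein functions and the kernel\<close>

definition bernstein :: "(real \<Rightarrow> real) \<Rightarrow> bool" where
  "bernstein F \<longleftrightarrow>
     (\<forall>m. (deriv ^^ m) F differentiable_on {0<..}) \<and>
     (\<forall>s>0. 0 \<le> F s) \<and>
     (\<forall>m\<ge>1. \<forall>s>0. 0 \<le> (-1) ^ (m - 1) * (deriv ^^ m) F s)"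

text \<open>The symbol is used both at complex arguments (where \<^term>\<open>(powr)\<close> is the principal
  branch) and at positive real ones.\<close>

definition B_order :: "real \<Rightarrow> real \<Rightarrow> real \<Rightarrow> 'a \<Rightarrow> 'a::real_normed_field" where
  "B_order \<alpha>1 \<alpha>2 c z = (of_real (\<alpha>2 * c) + of_real \<alpha>1 * z) / (of_real c + z)"

definition Psi :: "real \<Rightarrow> real \<Rightarrow> real \<Rightarrow> 'a \<Rightarrow> 'a::{real_normed_field,ln}" where
  "Psi \<alpha>1 \<alpha>2 c z = z powr (- B_order \<alpha>1 \<alpha>2 c z)"

text \<open>By injectivity of the Laplace transform, at most one function on \<open>(0,\<infinity>)\<close> has this property;
  its values on \<open>(-\<infinity>,0]\<close> are irrelevant.\<close>

definition psi_kernel :: "real \<Rightarrow> real \<Rightarrow> real \<Rightarrow> (real \<Rightarrow> real) \<Rightarrow> bool" where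
  "psi_kernel \<alpha>1 \<alpha>2 c \<psi> \<longleftrightarrow>
     continuous_on {0<..} \<psi> \<and>
     (\<forall>t>0. set_integrable lborel {0<..t} \<psi>) \<and>
     (\<exists>C a. \<forall>\<^sub>F t in at_top. \<bar>\<psi> t\<bar> \<le> C * exp (a * t)) \<and>
     (\<exists>\<sigma>\<ge>0. \<forall>z::complex. Re z > \<sigma> \<longrightarrow>
        has_bochner_integral lborel
          (\<lambda>t. indicator {0<..} t *\<^sub>R (exp (- z * of_real t) * of_real (\<psi> t)))
          (Psi \<alpha>1 \<alpha>2 c z))"

definition K_int :: "(real \<Rightarrow> real) \<Rightarrow> real \<Rightarrow> real" where
  "K_int \<psi> t = (LBINT s:{0<..t}. \<psi> s)"

definition K_inv :: "(real \<Rightarrow> real) \<Rightarrow> real \<Rightarrow> real" where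
  "K_inv \<psi> = inv_into {0..} (K_int \<psi>)"


section \<open>Function spaces on n-dimensional space\<close>

text \<open>Points of \<open>\<real>\<^sup>n\<close> are the functions on \<open>nat\<close> that are \<open>undefined\<close> outside \<open>{..<n}\<close>, so that the
  dimension is an ordinary variable and a constant can be required not to depend on it.
  Elements of the Lebesgue spaces are represented by functions, equality being equality a.e.\<close>

definition leb :: "nat \<Rightarrow> (nat \<Rightarrow> real) measure" where
  "leb n = PiM {..<n} (\<lambda>_. lborel)"

definition L1_norm :: "nat \<Rightarrow> ((nat \<Rightarrow> real) \<Rightarrow> real) \<Rightarrow> real" where
  "L1_norm n g = (LINT x|leb n. \<bar>g x\<bar>)"

definition Linf_norm :: "nat \<Rightarrow> ((nat \<Rightarrow> real) \<Rightarrow> real) \<Rightarrow> ereal" where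
  "Linf_norm n g = esssup (leb n) (\<lambda>x. ereal \<bar>g x\<bar>)"

definition X_space :: "nat \<Rightarrow> ((nat \<Rightarrow> real) \<Rightarrow> real) set" where
  "X_space n = {g. integrable (leb n) g \<and> Linf_norm n g < \<infinity>}"

definition X_norm :: "nat \<Rightarrow> ((nat \<Rightarrow> real) \<Rightarrow> real) \<Rightarrow> real" where
  "X_norm n g = L1_norm n g + real_of_ereal (Linf_norm n g)"


section \<open>The solution families\<close>

definition fourier_measure ::
    "nat \<Rightarrow> (nat \<Rightarrow> real) measure \<Rightarrow> (nat \<Rightarrow> real) \<Rightarrow> complex" where
  "fourier_measure n \<mu> \<xi> = (LINT x|\<mu>. exp (- \<i> * of_real (\<Sum>i<n. x i * \<xi> i)))"

text \<open>Continuity on \<^term>\<open>space (leb n)\<close> is with respect to the product topology on functions,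
  i.e. the usual topology of \<open>\<real>\<^sup>n\<close>.\<close>

definition Z_family ::
    "real \<Rightarrow> real \<Rightarrow> real \<Rightarrow> nat \<Rightarrow> (real \<Rightarrow> (nat \<Rightarrow> real) measure) \<Rightarrow> bool" where
  "Z_family \<alpha>1 \<alpha>2 c n Z \<longleftrightarrow>
     (\<forall>t>0. prob_space (Z t) \<and> sets (Z t) = sets (leb n)) \<and>
     (\<forall>f :: (nat \<Rightarrow> real) \<Rightarrow> real.
        continuous_on (space (leb n)) f \<and> bounded (f ` space (leb n)) \<longrightarrow>
        continuous_on {0<..} (\<lambda>t. LINT x|Z t. f x)) \<and>
     (\<forall>z>0. \<forall>\<xi>. has_bochner_integral lborel
        (\<lambda>t. indicator {0<..} t *\<^sub>R (of_real (exp (- z * t)) * fourier_measure n (Z t) \<xi>))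
        (of_real (inverse (Psi \<alpha>1 \<alpha>2 c z) /
                  (z * (inverse (Psi \<alpha>1 \<alpha>2 c z) + (\<Sum>i<n. (\<xi> i)\<^sup>2))))))"

text \<open>The measures \<open>Y t\<close> are determined for a.e. \<open>t > 0\<close> only; \<open>Y\<close> is any representative of the
  family consisting of finite measures for all \<open>t > 0\<close> and depending measurably on \<open>t\<close>.\<close>

definition Y_family ::
    "real \<Rightarrow> real \<Rightarrow> real \<Rightarrow> nat \<Rightarrow> (real \<Rightarrow> (nat \<Rightarrow> real) measure) \<Rightarrow> bool" where
  "Y_family \<alpha>1 \<alpha>2 c n Y \<longleftrightarrow>
     (\<forall>t>0. finite_measure (Y t) \<and> sets (Y t) = sets (leb n)) \<and>
     (\<forall>E\<in>sets (leb n). (\<lambda>t. measure (Y t) E) \<in> borel_measurable (restrict_space borel {0<..})) \<and>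
     (\<forall>z>0. \<forall>\<xi>. has_bochner_integral lborel
        (\<lambda>t. indicator {0<..} t *\<^sub>R (of_real (exp (- z * t)) * fourier_measure n (Y t) \<xi>))
        (of_real (1 / (inverse (Psi \<alpha>1 \<alpha>2 c z) + (\<Sum>i<n. (\<xi> i)\<^sup>2)))))"

definition conv ::
    "nat \<Rightarrow> (nat \<Rightarrow> real) measure \<Rightarrow> ((nat \<Rightarrow> real) \<Rightarrow> real) \<Rightarrow> (nat \<Rightarrow> real) \<Rightarrow> real" where
  "conv n \<mu> g x = (LINT y|\<mu>. g (restrict (\<lambda>i. x i - y i) {..<n}))"

definition S_op ::
    "nat \<Rightarrow> (real \<Rightarrow> (nat \<Rightarrow> real) measure) \<Rightarrow> real \<Rightarrow>
     ((nat \<Rightarrow> real) \<Rightarrow> real) \<Rightarrow> (nat \<Rightarrow> real) \<Rightarrow> real" where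
  "S_op n Z t g = (if t = 0 then g else conv n (Z t) g)"

definition P_op ::
    "nat \<Rightarrow> (real \<Rightarrow> (nat \<Rightarrow> real) measure) \<Rightarrow> real \<Rightarrow>
     ((nat \<Rightarrow> real) \<Rightarrow> real) \<Rightarrow> (nat \<Rightarrow> real) \<Rightarrow> real" where
  "P_op n Y t g = conv n (Y t) g"


section \<open>Mild solutions\<close>

text \<open>A curve in \<open>L\<^sup>1(\<real>\<^sup>n)\<close> is given by a jointly measurable representative \<open>u t x\<close>; every element of
  \<open>C([0,T];L\<^sup>1)\<close> has one. Since \<open>L\<^sup>1((0,t);L\<^sup>1(\<real>\<^sup>n)) = L\<^sup>1((0,t)\<times>\<real>\<^sup>n)\<close>, Bochner integrability of the
  Duhamel integrand in \<open>L\<^sup>1(\<real>\<^sup>n)\<close> is integrability on the product, and the Bochner integral is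
  represented by the pointwise integral. The space \<open>L\<^sup>\<infinity>((0,T);L\<^sup>\<infinity>(\<real>\<^sup>n))\<close> is read as
  \<open>L\<^sup>\<infinity>((0,T)\<times>\<real>\<^sup>n)\<close>. The equation holds a.e. in \<open>x\<close> for every \<open>t\<close>; as \<open>u t\<close> lies in \<open>L\<^sup>\<infinity>\<close>
  for a.e. \<open>t\<close>, this is the identity in \<open>L\<^sup>1\<close> for every \<open>t\<close> and in \<open>L\<^sup>\<infinity>\<close> for a.e. \<open>t\<close>.\<close>

definition mild_solution ::
    "nat \<Rightarrow> (real \<Rightarrow> (nat \<Rightarrow> real) measure) \<Rightarrow> (real \<Rightarrow> (nat \<Rightarrow> real) measure) \<Rightarrow> real \<Rightarrow>
     ((nat \<Rightarrow> real) \<Rightarrow> real) \<Rightarrow> real \<Rightarrow> (real \<Rightarrow> (nat \<Rightarrow> real) \<Rightarrow> real) \<Rightarrow> bool" where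
  "mild_solution n Z Y p u0 T u \<longleftrightarrow>
     (\<lambda>(t, x). u t x) \<in> borel_measurable (restrict_space borel {0..T} \<Otimes>\<^sub>M leb n) \<and>
     (\<forall>t\<in>{0..T}. integrable (leb n) (u t)) \<and>
     (\<forall>t\<in>{0..T}. ((\<lambda>s. L1_norm n (\<lambda>x. u s x - u t x)) \<longlongrightarrow> 0) (at t within {0..T})) \<and>
     (\<exists>R::real. AE t in lborel. t \<in> {0<..<T} \<longrightarrow> Linf_norm n (u t) \<le> ereal R) \<and>
     (\<forall>t\<in>{0..T}.
        integrable (restrict_space lborel {0<..<t} \<Otimes>\<^sub>M leb n)
          (\<lambda>(s, x). P_op n Y (t - s) (\<lambda>y. max 0 (u s y) powr p) x) \<and>
        (AE x in leb n. u t x = S_op n Z t u0 x +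
           (LBINT s:{0<..<t}. P_op n Y (t - s) (\<lambda>y. max 0 (u s y) powr p) x)))"

text \<open>An interval strictly larger than \<open>[0,T)\<close> contains \<open>[0,\<tau>]\<close> for some \<open>\<tau> \<ge> T\<close>.\<close>

definition nonneg_maximal_mild_solution ::
    "nat \<Rightarrow> (real \<Rightarrow> (nat \<Rightarrow> real) measure) \<Rightarrow> (real \<Rightarrow> (nat \<Rightarrow> real) measure) \<Rightarrow> real \<Rightarrow>
     ((nat \<Rightarrow> real) \<Rightarrow> real) \<Rightarrow> ereal \<Rightarrow> (real \<Rightarrow> (nat \<Rightarrow> real) \<Rightarrow> real) \<Rightarrow> bool" where
  "nonneg_maximal_mild_solution n Z Y p u0 T u \<longleftrightarrow>
     0 < T \<and>
     (\<forall>t\<ge>0. ereal t < T \<longrightarrow> (AE x in leb n. 0 \<le> u t x)) \<and>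
     (\<forall>\<tau>>0. ereal \<tau> < T \<longrightarrow> mild_solution n Z Y p u0 \<tau> u) \<and>
     \<not> (\<exists>\<tau> v. T \<le> ereal \<tau> \<and> mild_solution n Z Y p u0 \<tau> v \<and>
          (\<forall>t\<ge>0. ereal t < T \<longrightarrow> (AE x in leb n. v t x = u t x)))"

end

(* Suppose T = T_A is smaller than K^{-1}(c0 A^{1-p}) and put a = A * M, so that K(T) (2a)^p < a. The
   Duhamel formula, used on short time steps, shows that the solution stays below 2a on [0,T), and
   then that its L^1 norm stays below twice that of the datum. Hence the right-hand side of the
   formula still makes sense at t = T and is the L^1 limit of u(t): the solution extends to [0,T],
   against maximality. No existence or uniqueness theory is needed, since maximality is only
   contradicted by extending u itself.

   The total mass of Y(t) has Laplace transform Psi, hence equals psi(t) for a.e. t by uniqueness of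
   Laplace transforms. This makes K monotone, and K(t) <= e Psi(1/t) gives the two asymptotic
   bounds. *)
theory Submission
  imports Defs "HOL-Real_Asymp.Real_Asymp"
begin

section \<open>Convolution of functions with measures\<close>

text \<open>It is replaced by the fact that K(h) -> 0 as h -> 0: over a short enough step even a
  crude bound R contributes less than the slack a - K(T) (2a)^p. The measures Y(t) are known only
  through their transforms and may be singular, so a relation holding for a.e. x transfers to x - y
  only for a.e. x and Y(t)-a.e. y. The Duhamel integral is therefore handled as an ennreal-valued
  integral \<open>duh\<close>, to which Tonelli always applies, and is turned into a Bochner
  integral once it is known to be finite. The limit at T has two parts. For Z(t) * u0, weak
  continuity of Z is upgraded to convergence in L^1. For the Duhamel part, Y being only measurable
  in t, the kernel stays fixed and the solution is shifted in time.\<close>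

definition vsub :: "nat \<Rightarrow> (nat \<Rightarrow> real) \<Rightarrow> (nat \<Rightarrow> real) \<Rightarrow> nat \<Rightarrow> real" where
  "vsub n x y = restrict (\<lambda>i. x i - y i) {..<n}"

lemma space_leb: "space (leb n) = {..<n} \<rightarrow>\<^sub>E UNIV"
  by (simp add: leb_def space_PiM)

lemma vsub_in_space [simp]: "vsub n x y \<in> space (leb n)"
  by (simp add: space_leb vsub_def)

lemma product_sigma_finite_lborel: "product_sigma_finite (\<lambda>_::nat. lborel :: real measure)"
  by standard

lemma sigma_finite_leb: "sigma_finite_measure (leb n)"
  unfolding leb_def
  by (rule product_sigma_finite.sigma_finite[OF product_sigma_finite_lborel]) simp

lemma measurable_leb_component:
  assumes "i < n" shows "(\<lambda>x. x i) \<in> borel_measurable (leb n)"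
  unfolding leb_def using assms by (intro measurable_component_singleton[THEN measurable_compose, where g = "\<lambda>x. x"]) auto

lemma measurable_vsub [measurable]:
  assumes [measurable]: "f \<in> M \<rightarrow>\<^sub>M leb n" "g \<in> M \<rightarrow>\<^sub>M leb n"
  shows "(\<lambda>w. vsub n (f w) (g w)) \<in> M \<rightarrow>\<^sub>M leb n"
proof -
  have "(\<lambda>w. f w i - g w i) \<in> borel_measurable M" if "i < n" for i
    using measurable_compose[OF assms(1) measurable_leb_component[OF that]]
      measurable_compose[OF assms(2) measurable_leb_component[OF that]] by simp
  then show ?thesis
    unfolding vsub_def leb_def by (intro measurable_restrict) auto
qed

lemma measurable_vsub_right [measurable]: "vsub n x \<in> leb n \<rightarrow>\<^sub>M leb n"
proof -
  have "(\<lambda>y. x i - y i) \<in> borel_measurable (leb n)" if "i < n" for i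
    using measurable_leb_component[OF that] by simp
  then show ?thesis
    unfolding vsub_def leb_def by (intro measurable_restrict) auto
qed

text \<open>Product measures are determined by boxes, and on a box the claim is the translation
  invariance of one-dimensional Lebesgue measure in each factor.\<close>

lemma leb_translate:
  assumes y: "y \<in> space (leb n)"
  shows "distr (leb n) (leb n) (\<lambda>x. vsub n x y) = leb n"
proof -
  interpret product_sigma_finite "\<lambda>_::nat. lborel :: real measure"
    by (rule product_sigma_finite_lborel)
  have m [measurable]: "(\<lambda>x. vsub n x y) \<in> leb n \<rightarrow>\<^sub>M leb n"
    using y by simp
  have "distr (leb n) (leb n) (\<lambda>x. vsub n x y) = PiM {..<n} (\<lambda>_. lborel)"
  proof (rule PiM_eqI)
    fix A :: "nat \<Rightarrow> real set"
    assume A: "\<And>i. i \<in> {..<n} \<Longrightarrow> A i \<in> sets lborel"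
    have "Pi\<^sub>E {..<n} A \<in> sets (leb n)"
      unfolding leb_def using A by (intro sets_PiM_I_finite) auto
    then have "emeasure (distr (leb n) (leb n) (\<lambda>x. vsub n x y)) (Pi\<^sub>E {..<n} A)
        = emeasure (leb n) ((\<lambda>x. vsub n x y) -` Pi\<^sub>E {..<n} A \<inter> space (leb n))"
      by (simp add: emeasure_distr)
    also have "(\<lambda>x. vsub n x y) -` Pi\<^sub>E {..<n} A \<inter> space (leb n)
        = Pi\<^sub>E {..<n} (\<lambda>i. (\<lambda>t. t - y i) -` A i)"
      by (auto simp: vsub_def space_leb PiE_def Pi_def extensional_def)
    also have "emeasure (leb n) \<dots> = (\<Prod>i<n. emeasure lborel ((\<lambda>t. t - y i) -` A i))"
      unfolding leb_def
    proof (rule emeasure_PiM)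
      fix i assume "i \<in> {..<n}"
      then have [measurable]: "A i \<in> sets borel" using A by simp
      have "(\<lambda>t. t - y i) -` A i \<inter> space borel \<in> sets borel" by measurable
      then show "(\<lambda>t. t - y i) -` A i \<in> sets lborel" by simp
    qed simp
    also have "\<dots> = (\<Prod>i<n. emeasure lborel (A i))"
    proof (rule prod.cong)
      fix i assume "i \<in> {..<n}"
      then have [measurable]: "A i \<in> sets borel" using A by simp
      have shift: "(\<lambda>t. t - y i) = (+) (- y i)" by auto
      have "emeasure lborel (A i) = emeasure (distr lborel borel ((+) (- y i))) (A i)"
        by (simp add: lborel_distr_plus)
      also have "\<dots> = emeasure lborel ((\<lambda>t. t - y i) -` A i)"
        by (simp add: emeasure_distr shift)
      finally show "emeasure lborel ((\<lambda>t. t - y i) -` A i) = emeasure lborel (A i)" ..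
    qed simp
    finally show "emeasure (distr (leb n) (leb n) (\<lambda>x. vsub n x y)) (Pi\<^sub>E {..<n} A)
        = (\<Prod>i\<in>{..<n}. emeasure lborel (A i))" .
  qed (auto simp: leb_def)
  then show ?thesis by (simp add: leb_def)
qed

lemma nn_integral_leb_translate:
  assumes [measurable]: "g \<in> borel_measurable (leb n)" and y: "y \<in> space (leb n)"
  shows "(\<integral>\<^sup>+x. g (vsub n x y) \<partial>leb n) = (\<integral>\<^sup>+x. g x \<partial>leb n)"
proof -
  have "(\<integral>\<^sup>+x. g x \<partial>leb n) = (\<integral>\<^sup>+x. g x \<partial>distr (leb n) (leb n) (\<lambda>x. vsub n x y))"
    by (simp add: leb_translate[OF y])
  also have "\<dots> = (\<integral>\<^sup>+x. g (vsub n x y) \<partial>leb n)"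
    using y by (intro nn_integral_distr) auto
  finally show ?thesis ..
qed

lemma emeasure_leb_space: "emeasure (leb n) (space (leb n)) \<noteq> 0"
proof -
  interpret product_sigma_finite "\<lambda>_::nat. lborel :: real measure"
    by (rule product_sigma_finite_lborel)
  have "emeasure (leb n) (Pi\<^sub>E {..<n} (\<lambda>_. {0<..<1})) = (\<Prod>i<n. emeasure lborel {0<..<1::real})"
    unfolding leb_def by (intro emeasure_PiM) auto
  also have "\<dots> = 1" by simp
  finally have "emeasure (leb n) (Pi\<^sub>E {..<n} (\<lambda>_. {0<..<1})) = 1" .
  moreover have "emeasure (leb n) (Pi\<^sub>E {..<n} (\<lambda>_. {0<..<1})) \<le> emeasure (leb n) (space (leb n))"
    by (intro emeasure_mono sets.top) (auto simp: space_leb)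
  ultimately show ?thesis by (metis not_one_le_zero)
qed

text \<open>The ennreal-valued counterpart of \<open>conv\<close>: Tonelli can be applied to it
  first and finiteness checked afterwards.\<close>

definition econv ::
    "nat \<Rightarrow> (nat \<Rightarrow> real) measure \<Rightarrow> ((nat \<Rightarrow> real) \<Rightarrow> ennreal) \<Rightarrow> (nat \<Rightarrow> real) \<Rightarrow> ennreal" where
  "econv n \<mu> g x = (\<integral>\<^sup>+y. g (vsub n x y) \<partial>\<mu>)"

section \<open>Convolution with a finite measure on the product space\<close>

locale leb_measure = finite_measure \<mu> for n and \<mu> :: "(nat \<Rightarrow> real) measure" +
  assumes sets_eq [measurable_cong]: "sets \<mu> = sets (leb n)"
begin

lemma space_eq: "space \<mu> = space (leb n)"
  using sets_eq by (rule sets_eq_imp_space_eq)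

sublocale pair: pair_sigma_finite "leb n" \<mu>
  using sigma_finite_leb sigma_finite_measure_axioms
  by (simp add: pair_sigma_finite_def)

lemma measurable_econv [measurable]:
  assumes [measurable]: "g \<in> borel_measurable (leb n)"
  shows "econv n \<mu> g \<in> borel_measurable (leb n)"
  unfolding econv_def by measurable

lemma nn_integral_econv:
  assumes [measurable]: "g \<in> borel_measurable (leb n)"
  shows "(\<integral>\<^sup>+x. econv n \<mu> g x \<partial>leb n) = emeasure \<mu> (space \<mu>) * (\<integral>\<^sup>+x. g x \<partial>leb n)"
proof -
  have "(\<integral>\<^sup>+x. econv n \<mu> g x \<partial>leb n) = (\<integral>\<^sup>+y. \<integral>\<^sup>+x. g (vsub n x y) \<partial>leb n \<partial>\<mu>)"
    unfolding econv_def by (intro pair.Fubini'[symmetric]) measurable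
  also have "\<dots> = (\<integral>\<^sup>+y. (\<integral>\<^sup>+x. g x \<partial>leb n) \<partial>\<mu>)"
    by (intro nn_integral_cong nn_integral_leb_translate) (auto simp: space_eq)
  finally show ?thesis by (simp add: mult.commute)
qed

text \<open>The convolution of \<open>\<mu>\<close> with the indicator of a null set N has L^1 mass
  \<open>\<mu>(space)\<close> times |N|, which is 0. As \<open>\<mu>\<close> may be singular,
  exceptional x cannot be excluded.\<close>

lemma AE_translate:
  assumes "AE x in leb n. P x"
  shows "AE x in leb n. AE y in \<mu>. P (vsub n x y)"
proof -
  obtain N where N: "{x \<in> space (leb n). \<not> P x} \<subseteq> N" "emeasure (leb n) N = 0"
      and Nm [measurable]: "N \<in> sets (leb n)"
    using AE_E[OF assms] by metis
  have "(\<integral>\<^sup>+x. econv n \<mu> (indicator N) x \<partial>leb n) = 0"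
    using N(2) by (simp add: nn_integral_econv)
  then have "AE x in leb n. econv n \<mu> (indicator N) x = 0"
    by (subst (asm) nn_integral_0_iff_AE) auto
  then show ?thesis
  proof eventually_elim
    case (elim x)
    have "AE y in \<mu>. indicator N (vsub n x y) = (0::ennreal)"
      using elim unfolding econv_def by (subst (asm) nn_integral_0_iff_AE) auto
    then show ?case
    proof eventually_elim
      case (elim y)
      then have "vsub n x y \<notin> N" by (auto simp: indicator_def split: if_splits)
      then show ?case using N(1) vsub_in_space[of n x y] by blast
    qed
  qed
qed

text \<open>Tonelli bounds the product integral by the mass of \<open>\<mu>\<close> times the L^1
  norm of g. Fubini then gives both the integrability of \<open>conv n \<mu> g\<close> and its
  absolute convergence at a.e. x.\<close>

lemma integrable_translate:
  fixes g :: "(nat \<Rightarrow> real) \<Rightarrow> real"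
  assumes "integrable (leb n) g"
  shows "integrable (leb n \<Otimes>\<^sub>M \<mu>) (\<lambda>(x, y). g (vsub n x y))"
proof -
  have [measurable]: "g \<in> borel_measurable (leb n)" using assms by auto
  have "(\<integral>\<^sup>+z. ennreal (norm (case z of (x, y) \<Rightarrow> g (vsub n x y))) \<partial>(leb n \<Otimes>\<^sub>M \<mu>))
      = (\<integral>\<^sup>+x. econv n \<mu> (\<lambda>x. ennreal \<bar>g x\<bar>) x \<partial>leb n)"
    unfolding econv_def by (subst nn_integral_fst[symmetric]) (auto simp: split_beta)
  also have "\<dots> = emeasure \<mu> (space \<mu>) * (\<integral>\<^sup>+x. ennreal \<bar>g x\<bar> \<partial>leb n)"
    by (rule nn_integral_econv) simp
  also have "\<dots> < \<infinity>"
    using assms emeasure_finite[of "space \<mu>"]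
    by (simp add: integrable_iff_bounded ennreal_mult_eq_top_iff less_top[symmetric])
  finally show ?thesis
    by (intro integrableI_bounded) auto
qed

lemma conv_vsub: "conv n \<mu> g x = (LINT y|\<mu>. g (vsub n x y))"
  by (simp add: conv_def vsub_def)

lemma integrable_conv:
  assumes "integrable (leb n) g"
  shows "integrable (leb n) (conv n \<mu> g)"
  using pair.integrable_fst[OF integrable_translate[OF assms]] by (simp add: conv_vsub[abs_def])

lemma AE_integrable_translate:
  fixes g :: "(nat \<Rightarrow> real) \<Rightarrow> real"
  assumes "integrable (leb n) g"
  shows "AE x in leb n. integrable \<mu> (\<lambda>y. g (vsub n x y))"
  using pair.AE_integrable_fst[OF integrable_translate[OF assms]] by simp

lemma AE_conv_diff:
  assumes "integrable (leb n) g" "integrable (leb n) h"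
  shows "AE x in leb n. conv n \<mu> (\<lambda>y. g y - h y) x = conv n \<mu> g x - conv n \<mu> h x"
  using AE_integrable_translate[OF assms(1)] AE_integrable_translate[OF assms(2)]
  by eventually_elim (simp add: conv_vsub)

lemma conv_L1_le:
  assumes "integrable (leb n) g"
  shows "(\<integral>\<^sup>+x. ennreal \<bar>conv n \<mu> g x\<bar> \<partial>leb n)
      \<le> emeasure \<mu> (space \<mu>) * (\<integral>\<^sup>+x. ennreal \<bar>g x\<bar> \<partial>leb n)"
proof -
  have [measurable]: "g \<in> borel_measurable (leb n)" using assms by auto
  have "(\<integral>\<^sup>+x. ennreal \<bar>conv n \<mu> g x\<bar> \<partial>leb n) \<le> (\<integral>\<^sup>+x. econv n \<mu> (\<lambda>x. ennreal \<bar>g x\<bar>) x \<partial>leb n)"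
  proof (intro nn_integral_mono_AE, use AE_integrable_translate[OF assms] in eventually_elim)
    case (elim x)
    then show ?case
      unfolding conv_vsub econv_def using integral_norm_bound_ennreal[OF elim] by simp
  qed
  also have "\<dots> = emeasure \<mu> (space \<mu>) * (\<integral>\<^sup>+x. ennreal \<bar>g x\<bar> \<partial>leb n)"
    by (rule nn_integral_econv) simp
  finally show ?thesis .
qed

text \<open>Where the integral diverges both sides are 0 by convention: the Bochner integral of a
  non-integrable function and \<open>enn2real \<top>\<close>.\<close>

lemma conv_eq_econv:
  assumes [measurable]: "g \<in> borel_measurable (leb n)" and "\<And>y. 0 \<le> g y" and x: "x \<in> space (leb n)"
  shows "conv n \<mu> g x = enn2real (econv n \<mu> (\<lambda>y. ennreal (g y)) x)"
  unfolding conv_vsub econv_def using assms(2) x by (intro integral_eq_nn_integral) auto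

end

section \<open>Density of products of tent functions in the integrable functions\<close>

definition obox :: "nat \<Rightarrow> (nat \<Rightarrow> real) \<Rightarrow> (nat \<Rightarrow> real) \<Rightarrow> (nat \<Rightarrow> real) set" where
  "obox n a b = Pi\<^sub>E {..<n} (\<lambda>i. {a i<..<b i})"

text \<open>A continuous approximation from below of the indicator of \<open>obox n a b\<close>:
  each factor is k times the distance to the complement of the interval, cut off at 1. Continuity
  makes tents admissible test functions for weak convergence of measures.\<close>

definition tent :: "nat \<Rightarrow> nat \<Rightarrow> (nat \<Rightarrow> real) \<Rightarrow> (nat \<Rightarrow> real) \<Rightarrow> (nat \<Rightarrow> real) \<Rightarrow> real" where
  "tent n k a b x = (\<Prod>i<n. min 1 (real k * max 0 (min (x i - a i) (b i - x i))))"

lemma sets_obox [measurable]: "obox n a b \<in> sets (leb n)"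
  unfolding obox_def leb_def by (intro sets_PiM_I_finite) auto

lemma emeasure_obox_finite: "emeasure (leb n) (obox n a b) < \<infinity>"
proof -
  interpret product_sigma_finite "\<lambda>_::nat. lborel :: real measure"
    by (rule product_sigma_finite_lborel)
  have "emeasure (leb n) (obox n a b) = (\<Prod>i<n. emeasure lborel {a i<..<b i})"
    unfolding leb_def obox_def by (intro emeasure_PiM) auto
  also have "\<dots> < \<infinity>"
  proof -
    have "emeasure lborel {a i<..<b i} \<noteq> \<top>" for i
      using emeasure_bounded_finite[OF bounded_box[of "a i" "b i"]] by (simp add: box_real)
    then show ?thesis by (simp add: less_top[symmetric] ennreal_prod_eq_top)
  qed
  finally show ?thesis .
qed

lemma obox_Int: "obox n a b \<inter> obox n a' b' = obox n (\<lambda>i. max (a i) (a' i)) (\<lambda>i. min (b i) (b' i))"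
  unfolding obox_def PiE_Int by (intro PiE_cong) auto

text \<open>Open intervals generate the Borel sets of each factor, and products of generators
  generate the product \<sigma>-algebra once each factor is a countable union of generators, which
  is the fact \<open>cover\<close>.\<close>

lemma sets_leb_obox:
  "sets (leb n) = sigma_sets (space (leb n)) {obox n a b | a b. True}"
proof -
  have borel: "(borel :: real measure) = sigma UNIV (range (\<lambda>(a, b). {a<..<b}))"
    by (subst borel_eq_box) (simp add: box_real(1)[abs_def])
  let ?E = "range (\<lambda>(a, b). {a<..<b::real})"
  have cover: "\<exists>S\<subseteq>?E. countable S \<and> UNIV = \<Union>S"
  proof (intro exI conjI)
    show "range (\<lambda>k. {- real k<..<real k}) \<subseteq> ?E" by auto
    show "UNIV = \<Union>(range (\<lambda>k. {- real k<..<real k}))"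
    proof (intro equalityI subsetI UNIV_I)
      fix x :: real
      obtain k where "\<bar>x\<bar> < real k" using reals_Archimedean2 by blast
      then show "x \<in> \<Union>(range (\<lambda>k. {- real k<..<real k}))" by (auto intro!: exI[of _ k])
    qed
  qed simp
  have "sets (leb n) = sets (PiM {..<n} (\<lambda>_. sigma UNIV ?E))"
    unfolding leb_def by (intro sets_PiM_cong) (simp_all add: borel[symmetric])
  \<comment> \<open>The family of index sets consists of \<open>{..<n}\<close> alone, so that the
    generators are boxes constraining all coordinates at once.\<close>
  also have "\<dots> = sets (sigma (Pi\<^sub>E {..<n} (\<lambda>_. UNIV))
      {{f \<in> Pi\<^sub>E {..<n} (\<lambda>_. UNIV). \<forall>i\<in>j. f i \<in> A i} | A j. j \<in> {{..<n}} \<and> A \<in> Pi j (\<lambda>_. ?E)})"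
    using cover by (intro sets_PiM_sigma) auto
  also have "{{f \<in> Pi\<^sub>E {..<n} (\<lambda>_. UNIV). \<forall>i\<in>j. f i \<in> A i} | A j. j \<in> {{..<n}} \<and> A \<in> Pi j (\<lambda>_. ?E)}
      = {obox n a b | a b. True}"
  proof (intro equalityI subsetI)
    fix B assume "B \<in> {{f \<in> Pi\<^sub>E {..<n} (\<lambda>_. UNIV). \<forall>i\<in>j. f i \<in> A i} | A j. j \<in> {{..<n}} \<and> A \<in> Pi j (\<lambda>_. ?E)}"
    then obtain A where B: "B = {f \<in> Pi\<^sub>E {..<n} (\<lambda>_. UNIV). \<forall>i<n. f i \<in> A i}"
        and A: "\<And>i. i < n \<Longrightarrow> A i \<in> ?E"
      by (auto simp: Pi_def)
    have "\<exists>a b. i < n \<longrightarrow> A i = {a<..<b}" for i using A[of i] by (cases "i < n") auto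
    then obtain a b where "\<And>i. i < n \<Longrightarrow> A i = {a i<..<b i}" by metis
    then have "B = obox n a b" unfolding B obox_def by (auto simp: PiE_def Pi_def)
    then show "B \<in> {obox n a b | a b. True}" by auto
  next
    fix B assume "B \<in> {obox n a b | a b. True}"
    then obtain a b where B: "B = obox n a b" by auto
    show "B \<in> {{f \<in> Pi\<^sub>E {..<n} (\<lambda>_. UNIV). \<forall>i\<in>j. f i \<in> A i} | A j. j \<in> {{..<n}} \<and> A \<in> Pi j (\<lambda>_. ?E)}"
      unfolding mem_Collect_eq
      by (rule exI[of _ "\<lambda>i. {a i<..<b i}"], rule exI[of _ "{..<n}"])
         (auto simp: B obox_def PiE_def Pi_def)
  qed
  also have "sets (sigma (Pi\<^sub>E {..<n} (\<lambda>_. UNIV)) {obox n a b | a b. True})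
      = sigma_sets (space (leb n)) {obox n a b | a b. True}"
    by (subst sets_measure_of) (auto simp: space_leb obox_def PiE_def)
  finally show ?thesis .
qed

lemma measurable_tent [measurable]: "tent n k a b \<in> borel_measurable (leb n)"
proof -
  have [measurable]: "(\<lambda>x. min 1 (real k * max 0 (min (x i - a i) (b i - x i)))) \<in> borel_measurable (leb n)"
    if "i < n" for i
    using measurable_leb_component[OF that] by measurable
  show ?thesis unfolding tent_def[abs_def] by (intro borel_measurable_prod) auto
qed

lemma tent_bounds: "0 \<le> tent n k a b x" "tent n k a b x \<le> 1"
  unfolding tent_def by (auto intro!: prod_nonneg prod_le_1)

lemma tent_le_indicator:
  assumes "x \<in> space (leb n)" shows "tent n k a b x \<le> indicator (obox n a b) x"
proof (cases "x \<in> obox n a b")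
  case True then show ?thesis using tent_bounds by simp
next
  case False
  then obtain i where "i < n" "x i \<notin> {a i<..<b i}"
    using assms by (auto simp: obox_def space_leb PiE_def Pi_def)
  then have "\<exists>i\<in>{..<n}. min 1 (real k * max 0 (min (x i - a i) (b i - x i))) = 0"
    by (intro bexI[of _ i]) auto
  then have "tent n k a b x = 0" unfolding tent_def by (intro prod_zero) auto
  then show ?thesis by simp
qed

lemma tent_tendsto:
  assumes x: "x \<in> space (leb n)"
  shows "(\<lambda>k. tent n k a b x) \<longlonglongrightarrow> indicator (obox n a b) x"
proof (cases "x \<in> obox n a b")
  case True
  have "(\<lambda>k. min 1 (real k * max 0 (min (x i - a i) (b i - x i)))) \<longlonglongrightarrow> 1" if "i < n" for i
  proof (rule tendsto_eventually)
    have pos: "0 < min (x i - a i) (b i - x i)" using True that by (auto simp: obox_def PiE_def Pi_def)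
    show "\<forall>\<^sub>F k in sequentially. min 1 (real k * max 0 (min (x i - a i) (b i - x i))) = 1"
      using eventually_ge_at_top[of "nat \<lceil>1 / min (x i - a i) (b i - x i)\<rceil>"]
    proof eventually_elim
      case (elim k)
      then have "1 / min (x i - a i) (b i - x i) \<le> real k" by linarith
      then have "1 \<le> real k * min (x i - a i) (b i - x i)" using pos by (simp add: pos_divide_le_eq)
      then show ?case using pos by (simp add: max_def)
    qed
  qed
  then have "(\<lambda>k. tent n k a b x) \<longlonglongrightarrow> (\<Prod>i<n. 1)"
    unfolding tent_def by (intro tendsto_prod) auto
  then show ?thesis using True by simp
next
  case False
  then have "tent n k a b x = 0" for k
    using tent_le_indicator[OF x, of k a b] tent_bounds(1)[of n k a b x] by simp
  then show ?thesis using False by simp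
qed

lemma integrable_tent: "integrable (leb n) (tent n k a b)"
proof (rule Bochner_Integration.integrable_bound)
  show "integrable (leb n) (indicat_real (obox n a b))"
    using emeasure_obox_finite by (intro integrable_real_indicator) auto
  show "AE x in leb n. norm (tent n k a b x) \<le> norm (indicat_real (obox n a b) x)"
    using tent_le_indicator tent_bounds(1) by (intro AE_I2) auto
qed simp

lemma L1_dominated_convergence:
  fixes f w :: "'a \<Rightarrow> real"
  assumes [measurable]: "\<And>k. s k \<in> borel_measurable M" "f \<in> borel_measurable M"
    and w: "integrable M w"
    and bd: "\<And>k x. x \<in> space M \<Longrightarrow> \<bar>s k x\<bar> \<le> w x"
    and lim: "\<And>x. x \<in> space M \<Longrightarrow> (\<lambda>k. s k x) \<longlonglongrightarrow> f x"
  shows "(\<lambda>k. \<integral>\<^sup>+x. ennreal \<bar>f x - s k x\<bar> \<partial>M) \<longlonglongrightarrow> 0"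
proof -
  have [measurable]: "w \<in> borel_measurable M" using w by auto
  have "(\<integral>\<^sup>+x. ennreal (w x) \<partial>M) \<le> (\<integral>\<^sup>+x. ennreal (norm (w x)) \<partial>M)"
    by (intro nn_integral_mono) (auto intro: ennreal_leI)
  also have "\<dots> < \<infinity>" using w by (simp add: integrable_iff_bounded)
  finally have "(\<integral>\<^sup>+x. ennreal (w x) \<partial>M) < \<infinity>" .
  then have "(\<lambda>k. \<integral>\<^sup>+x. ennreal (norm (f x - s k x)) \<partial>M) \<longlonglongrightarrow> 0"
    using bd lim by (intro nn_integral_dominated_convergence_norm[where w = w]) auto
  then show ?thesis by simp
qed

text \<open>Density of the span of tents in L^1, in the form of an induction rule. Tents reach
  boxes, the \<pi>-\<lambda> argument reaches measurable sets inside a cube, exhaustion by cubes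
  reaches sets of finite measure, and simple functions do the rest. Every limit is taken in L^1 by
  dominated convergence.\<close>

lemma leb_L1_induct [consumes 1, case_names tent add scale lim]:
  fixes f :: "(nat \<Rightarrow> real) \<Rightarrow> real"
  assumes f: "integrable (leb n) f"
    and tent: "\<And>k a b. P (tent n k a b)"
    and add: "\<And>f g. integrable (leb n) f \<Longrightarrow> integrable (leb n) g \<Longrightarrow> P f \<Longrightarrow> P g
      \<Longrightarrow> P (\<lambda>x. f x + g x)"
    and scale: "\<And>c f. integrable (leb n) f \<Longrightarrow> P f \<Longrightarrow> P (\<lambda>x. c * f x)"
    and lim: "\<And>f s. integrable (leb n) f \<Longrightarrow> (\<And>k. integrable (leb n) (s k)) \<Longrightarrow> (\<And>k. P (s k)) \<Longrightarrow>
      (\<lambda>k. \<integral>\<^sup>+x. ennreal \<bar>f x - s k x\<bar> \<partial>leb n) \<longlonglongrightarrow> 0 \<Longrightarrow> P f"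
  shows "P f"
proof -
  define I where "I A = indicat_real A" for A :: "(nat \<Rightarrow> real) set"
  have integrable_I: "integrable (leb n) (I A)" if "A \<in> sets (leb n)" "emeasure (leb n) A < \<infinity>" for A
    unfolding I_def using that by (intro integrable_real_indicator) auto
  have zero: "P (\<lambda>x. 0)"
    using scale[OF integrable_tent tent, of 0 0 undefined undefined] by simp
  have P_obox: "P (I (obox n a b))" for a b
  proof (rule lim[OF integrable_I integrable_tent tent])
    show "(\<lambda>k. \<integral>\<^sup>+x. ennreal \<bar>I (obox n a b) x - tent n k a b x\<bar> \<partial>leb n) \<longlonglongrightarrow> 0"
      using tent_le_indicator tent_bounds(1) tent_tendsto emeasure_obox_finite
      by (intro L1_dominated_convergence[where w = "I (obox n a b)"] integrable_I) (auto simp: I_def)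
  qed (use emeasure_obox_finite in auto)
  \<comment> \<open>Cutting every set with a cube keeps complements and countable unions within
    finite measure.\<close>
  define Q where "Q m = obox n (\<lambda>_. - real m) (\<lambda>_. real m)" for m
  have Q [measurable]: "Q m \<in> sets (leb n)" "emeasure (leb n) (Q m) < \<infinity>" for m
    unfolding Q_def using emeasure_obox_finite by auto
  have fin: "emeasure (leb n) (A \<inter> Q m) < \<infinity>" if "A \<in> sets (leb n)" for A m
    using emeasure_mono[of "A \<inter> Q m" "Q m" "leb n"] Q[of m] by auto
  have P_Q: "P (I (A \<inter> Q m))" if "A \<in> sets (leb n)" for A m
  proof -
    have "Int_stable {obox n a b | a b. True}"
      unfolding Int_stable_def by (auto simp: obox_Int) blast
    moreover have "{obox n a b | a b. True} \<subseteq> Pow (space (leb n))"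
      by (auto simp: obox_def space_leb PiE_def)
    moreover have "A \<in> sigma_sets (space (leb n)) {obox n a b | a b. True}"
      using that by (simp add: sets_leb_obox)
    ultimately show ?thesis
    proof (induction rule: sigma_sets_induct_disjoint)
      case (basic A)
      then show ?case by (auto simp: Q_def obox_Int P_obox)
    next
      case empty
      then show ?case using zero by (simp add: I_def)
    next
      case (compl A)
      then have A: "A \<in> sets (leb n)" by (simp add: sets_leb_obox)
      have "P (\<lambda>x. I (Q m) x + (-1) * I (A \<inter> Q m) x)"
        using A Q fin[OF A] compl(2) P_obox[of "\<lambda>_. - real m" "\<lambda>_. real m"]
        by (intro add scale integrable_I integrable_mult_right) (auto simp: Q_def[symmetric])
      moreover have "(\<lambda>x. I (Q m) x + (-1) * I (A \<inter> Q m) x) = I ((space (leb n) - A) \<inter> Q m)"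
        using sets.sets_into_space[OF Q(1)[of m]] by (auto simp: I_def indicator_def fun_eq_iff)
      ultimately show ?case by simp
    next
      case (union A)
      then have A: "\<And>i. A i \<in> sets (leb n)" by (auto simp: sets_leb_obox)
      define s where "s k = I ((\<Union>i<k. A i) \<inter> Q m)" for k
      have int_s: "integrable (leb n) (s k)" for k
        unfolding s_def using A by (intro integrable_I fin) auto
      have "P (s k)" for k
      proof (induction k)
        case 0 then show ?case using zero by (simp add: s_def I_def)
      next
        case (Suc k)
        have "P (\<lambda>x. s k x + I (A k \<inter> Q m) x)"
          using union(3) A fin[OF A] Suc int_s by (intro add integrable_I) auto
        moreover have "s (Suc k) = (\<lambda>x. s k x + I (A k \<inter> Q m) x)"
        proof
          fix x
          have "\<not> (x \<in> A k \<and> x \<in> A i)" if "i < k" for i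
            using disjoint_family_onD[OF union(1), of k i] that by auto
          then show "s (Suc k) x = s k x + I (A k \<inter> Q m) x"
            by (auto simp: s_def I_def indicator_def less_Suc_eq)
        qed
        ultimately show ?case by simp
      qed
      moreover have "(\<lambda>k. \<integral>\<^sup>+x. ennreal \<bar>I ((\<Union>i. A i) \<inter> Q m) x - s k x\<bar> \<partial>leb n) \<longlonglongrightarrow> 0"
      proof (rule L1_dominated_convergence[where w = "I (Q m)"])
        show "(\<lambda>k. s k x) \<longlonglongrightarrow> I ((\<Union>i. A i) \<inter> Q m) x" for x
        proof (cases "\<exists>i. x \<in> A i \<inter> Q m")
          case True
          then obtain i where i: "x \<in> A i \<inter> Q m" by auto
          then have "s k x = I ((\<Union>i. A i) \<inter> Q m) x" if "i < k" for k
            using that by (auto simp: s_def I_def indicator_def)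
          then show ?thesis
            by (intro tendsto_eventually eventually_mono[OF eventually_gt_at_top[of i]])
        next
          case False
          then show ?thesis by (intro tendsto_eventually) (auto simp: s_def I_def indicator_def)
        qed
        show "integrable (leb n) (I (Q m))" by (rule integrable_I[OF Q])
        show "\<bar>s k x\<bar> \<le> I (Q m) x" for k x
          by (simp add: s_def I_def indicator_def)
        show "s k \<in> borel_measurable (leb n)" for k
          by (rule borel_measurable_integrable[OF int_s])
        show "I ((\<Union>i. A i) \<inter> Q m) \<in> borel_measurable (leb n)"
          unfolding I_def using A by (intro borel_measurable_indicator sets.Int sets.countable_UN) auto
      qed
      ultimately show ?case
      proof (intro lim[where s = s and f = "I ((\<Union>i. A i) \<inter> Q m)"])
        have U: "(\<Union>i. A i) \<in> sets (leb n)" using A by auto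
        show "integrable (leb n) (I ((\<Union>i. A i) \<inter> Q m))"
          using U fin[OF U] Q(1) by (intro integrable_I sets.Int)
      qed (use int_s in auto)
    qed
  qed
  have P_I: "P (I A)" if A: "A \<in> sets (leb n)" "emeasure (leb n) A < \<infinity>" for A
  proof (rule lim[where s = "\<lambda>m. I (A \<inter> Q m)"])
    show "(\<lambda>m. \<integral>\<^sup>+x. ennreal \<bar>I A x - I (A \<inter> Q m) x\<bar> \<partial>leb n) \<longlonglongrightarrow> 0"
    proof (rule L1_dominated_convergence[where w = "I A"])
      fix x assume x: "x \<in> space (leb n)"
      \<comment> \<open>A bound on the sum of all \<open>\<bar>x i\<bar>\<close> bounds every
        coordinate at once.\<close>
      obtain m where m: "(\<Sum>i<n. \<bar>x i\<bar>) < real m" using reals_Archimedean2 by blast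
      have "x \<in> Q k" if "m \<le> k" for k
      proof -
        have "\<bar>x i\<bar> < real k" if i: "i < n" for i
        proof -
          have "\<bar>x i\<bar> \<le> (\<Sum>i<n. \<bar>x i\<bar>)" using i by (intro member_le_sum) auto
          also have "\<dots> < real k" using m \<open>m \<le> k\<close> by linarith
          finally show ?thesis .
        qed
        then have "- real k < x i \<and> x i < real k" if "i < n" for i
          using that by (force simp: abs_less_iff)
        then show ?thesis using x by (auto simp: Q_def obox_def space_leb PiE_def Pi_def)
      qed
      then have "I (A \<inter> Q k) x = I A x" if "m \<le> k" for k
        using that by (auto simp: I_def indicator_def)
      then show "(\<lambda>m. I (A \<inter> Q m) x) \<longlonglongrightarrow> I A x"
        by (intro tendsto_eventually eventually_mono[OF eventually_ge_at_top[of m]])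
      show "\<bar>I (A \<inter> Q k) x\<bar> \<le> I A x" for k
        by (simp add: I_def indicator_def)
    next
      show "integrable (leb n) (I A)" by (rule integrable_I[OF A])
      then show "I A \<in> borel_measurable (leb n)" by (rule borel_measurable_integrable)
      show "I (A \<inter> Q m) \<in> borel_measurable (leb n)" for m
        unfolding I_def using A(1) Q(1) by (intro borel_measurable_indicator sets.Int)
    qed
    show "integrable (leb n) (I (A \<inter> Q m))" for m
      using A(1) Q(1) by (intro integrable_I fin sets.Int)
  qed (rule integrable_I[OF A], rule P_Q[OF A(1)])
  from f show ?thesis
  proof (induction rule: integrable_induct)
    case (base A c)
    have "P (\<lambda>x. c * I A x)" using base by (intro scale integrable_I P_I)
    then show ?case by (simp add: I_def mult.commute)
  next
    case (add f g)
    show ?case by (rule assms(3)[OF add(1-4)])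
  next
    case (lim f s)
    have [measurable]: "f \<in> borel_measurable (leb n)" "s k \<in> borel_measurable (leb n)" for k
      using lim(1,4) by auto
    have "(\<lambda>k. \<integral>\<^sup>+x. ennreal \<bar>f x - s k x\<bar> \<partial>leb n) \<longlonglongrightarrow> 0"
      using lim(2,3,4) by (intro L1_dominated_convergence[where w = "\<lambda>x. 2 * \<bar>f x\<bar>"]) auto
    then show ?case by (rule assms(5)[OF lim(4) lim(1) lim(5)])
  qed
qed

section \<open>Weak convergence of measures and convolution\<close>

lemma nn_integral_abs_add_le:
  fixes f g h :: "'a \<Rightarrow> real"
  assumes [measurable]: "f \<in> borel_measurable M" "g \<in> borel_measurable M"
    and "AE x in M. \<bar>h x\<bar> \<le> \<bar>f x\<bar> + \<bar>g x\<bar>"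
  shows "(\<integral>\<^sup>+x. ennreal \<bar>h x\<bar> \<partial>M) \<le> (\<integral>\<^sup>+x. ennreal \<bar>f x\<bar> \<partial>M) + (\<integral>\<^sup>+x. ennreal \<bar>g x\<bar> \<partial>M)"
proof -
  have "(\<integral>\<^sup>+x. ennreal \<bar>h x\<bar> \<partial>M) \<le> (\<integral>\<^sup>+x. ennreal \<bar>f x\<bar> + ennreal \<bar>g x\<bar> \<partial>M)"
    using assms(3)
    by (intro nn_integral_mono_AE) (auto elim!: eventually_mono simp: ennreal_plus[symmetric] intro!: ennreal_leI
        simp del: ennreal_plus)
  then show ?thesis by (simp add: nn_integral_add)
qed

lemma continuous_on_tent: "continuous_on S (\<lambda>y. tent n k a b (vsub n x y))"
proof -
  have "continuous_on S (\<lambda>y. vsub n x y i)" if "i < n" for i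
    using that continuous_on_subset[OF continuous_on_product_coordinates, of S i]
    by (auto simp: vsub_def intro!: continuous_intros)
  then show ?thesis
    unfolding tent_def
    by (intro continuous_on_prod continuous_on_min continuous_on_max continuous_on_mult
        continuous_on_diff continuous_on_const) auto
qed

text \<open>For a tent, weak convergence gives pointwise convergence of the convolutions, and
  Scheffe's lemma upgrades it to L^1 because no mass is lost among probability measures. Density
  extends this to all g, since convolution with a probability measure is an L^1 contraction.\<close>

lemma conv_weak_L1:
  fixes \<mu> :: "nat \<Rightarrow> (nat \<Rightarrow> real) measure"
  assumes prob: "prob_space \<nu>" "\<And>j. prob_space (\<mu> j)"
    and sets: "sets \<nu> = sets (leb n)" "\<And>j. sets (\<mu> j) = sets (leb n)"
    and weak: "\<And>f :: (nat \<Rightarrow> real) \<Rightarrow> real. continuous_on (space (leb n)) f \<Longrightarrow>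
      bounded (f ` space (leb n)) \<Longrightarrow> (\<lambda>j. LINT x|\<mu> j. f x) \<longlonglongrightarrow> (LINT x|\<nu>. f x)"
    and g: "integrable (leb n) g"
  shows "(\<lambda>j. \<integral>\<^sup>+x. ennreal \<bar>conv n (\<mu> j) g x - conv n \<nu> g x\<bar> \<partial>leb n) \<longlonglongrightarrow> 0"
proof -
  interpret \<nu>: leb_measure n \<nu>
    using prob(1) sets(1)
    by (simp add: leb_measure_def leb_measure_axioms_def prob_space.finite_measure)
  interpret \<mu>: leb_measure n "\<mu> j" for j
    using prob(2)[of j] sets(2)[of j]
    by (simp add: leb_measure_def leb_measure_axioms_def prob_space.finite_measure)
  have mass [simp]: "emeasure \<nu> (space \<nu>) = 1" "emeasure (\<mu> j) (space (\<mu> j)) = 1" for j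
    using prob by (auto intro: prob_space.emeasure_space_1)
  note [measurable] = borel_measurable_integrable[OF \<nu>.integrable_conv]
    borel_measurable_integrable[OF \<mu>.integrable_conv]
  from g show ?thesis
  proof (induction rule: leb_L1_induct)
    case (tent k a b)
    let ?t = "tent n k a b"
    have pointwise: "(\<lambda>j. conv n (\<mu> j) ?t x) \<longlonglongrightarrow> conv n \<nu> ?t x" for x
      unfolding \<nu>.conv_vsub \<mu>.conv_vsub
    proof (rule weak[OF continuous_on_tent])
      show "bounded ((\<lambda>y. ?t (vsub n x y)) ` space (leb n))"
        using tent_bounds by (intro boundedI[of _ 1]) auto
    qed
    \<comment> \<open>The hypothesis of Scheffe's lemma: \<open>conv n (\<mu> j) ?t\<close> has at
      most the norm of the tent, while convolving the nonnegative tent with the probability measure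
      \<open>\<nu>\<close> preserves its norm exactly.\<close>
    have "(\<integral>\<^sup>+x. ennreal (norm (conv n (\<mu> j) ?t x)) \<partial>leb n)
        \<le> (\<integral>\<^sup>+x. ennreal (norm (conv n \<nu> ?t x)) \<partial>leb n)" for j
    proof -
      have "(\<integral>\<^sup>+x. ennreal (norm (conv n (\<mu> j) ?t x)) \<partial>leb n) \<le> (\<integral>\<^sup>+x. ennreal (?t x) \<partial>leb n)"
        using \<mu>.conv_L1_le[OF integrable_tent[of n k a b], of j] by (simp add: tent_bounds)
      also have "\<dots> = (\<integral>\<^sup>+x. econv n \<nu> (\<lambda>x. ennreal (?t x)) x \<partial>leb n)"
        by (simp add: \<nu>.nn_integral_econv)
      also have "\<dots> = (\<integral>\<^sup>+x. ennreal (norm (conv n \<nu> ?t x)) \<partial>leb n)"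
      proof (intro nn_integral_cong_AE, use \<nu>.AE_integrable_translate[OF integrable_tent[of n k a b]] in eventually_elim)
        case (elim x)
        then show ?case
          by (simp add: econv_def \<nu>.conv_vsub nn_integral_eq_integral tent_bounds)
      qed
      finally show ?thesis .
    qed
    then have "(\<lambda>j. \<integral>\<^sup>+x. ennreal (norm (conv n (\<mu> j) ?t x - conv n \<nu> ?t x)) \<partial>leb n) \<longlonglongrightarrow> 0"
      using pointwise integrable_tent by (intro Scheffe_lemma2 \<nu>.integrable_conv) auto
    then show ?case by simp
  next
    case (add f h)
    let ?d = "\<lambda>g j. \<integral>\<^sup>+x. ennreal \<bar>conv n (\<mu> j) g x - conv n \<nu> g x\<bar> \<partial>leb n"
    have "?d (\<lambda>x. f x + h x) j \<le> ?d f j + ?d h j" for j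
    proof (intro nn_integral_abs_add_le)
      show "AE x in leb n. \<bar>conv n (\<mu> j) (\<lambda>x. f x + h x) x - conv n \<nu> (\<lambda>x. f x + h x) x\<bar>
          \<le> \<bar>conv n (\<mu> j) f x - conv n \<nu> f x\<bar> + \<bar>conv n (\<mu> j) h x - conv n \<nu> h x\<bar>"
        using \<nu>.AE_integrable_translate[OF add(1)] \<nu>.AE_integrable_translate[OF add(2)]
          \<mu>.AE_integrable_translate[OF add(1), of j] \<mu>.AE_integrable_translate[OF add(2), of j]
        by eventually_elim (auto simp: \<nu>.conv_vsub \<mu>.conv_vsub)
    qed (use add(1,2) in measurable)
    moreover have "(\<lambda>j. ?d f j + ?d h j) \<longlonglongrightarrow> 0"
      using tendsto_add[OF add(3,4)] by simp
    ultimately show ?case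
      by (intro tendsto_sandwich[OF _ _ tendsto_const[of 0] \<open>(\<lambda>j. ?d f j + ?d h j) \<longlonglongrightarrow> 0\<close>]) auto
  next
    case (scale c f)
    note [measurable] = borel_measurable_integrable[OF scale(1)]
    have "(\<integral>\<^sup>+x. ennreal \<bar>conv n (\<mu> j) (\<lambda>x. c * f x) x - conv n \<nu> (\<lambda>x. c * f x) x\<bar> \<partial>leb n)
        = ennreal \<bar>c\<bar> * (\<integral>\<^sup>+x. ennreal \<bar>conv n (\<mu> j) f x - conv n \<nu> f x\<bar> \<partial>leb n)" for j
      using scale(1)
      by (subst nn_integral_cmult[symmetric])
         (auto simp: \<nu>.conv_vsub \<mu>.conv_vsub right_diff_distrib[symmetric] abs_mult ennreal_mult)
    then show ?case
      using ennreal_tendsto_cmult[OF _ scale(2), of "ennreal \<bar>c\<bar>"] by simp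
  next
    case (lim f s)
    show ?case
    proof (rule tendsto_zero_ennreal)
      \<comment> \<open>One third of r pays for replacing f by \<open>s m\<close> under
        \<open>\<mu> j\<close>, one for the same under \<open>\<nu>\<close>, and one for the
        convergence at \<open>s m\<close>. The first two are uniform in j by contraction.\<close>
      fix r :: real assume "0 < r"
      have "\<forall>\<^sub>F m in sequentially. (\<integral>\<^sup>+x. ennreal \<bar>f x - s m x\<bar> \<partial>leb n) < ennreal (r / 3)"
        using \<open>0 < r\<close> by (intro order_tendstoD(2)[OF lim(3)]) auto
      then obtain m where m: "(\<integral>\<^sup>+x. ennreal \<bar>f x - s m x\<bar> \<partial>leb n) < ennreal (r / 3)"
        by (auto dest: eventually_happens)
      have int_d: "integrable (leb n) (\<lambda>x. f x - s m x)" using lim(1,2) by auto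
      have "\<forall>\<^sub>F j in sequentially.
          (\<integral>\<^sup>+x. ennreal \<bar>conv n (\<mu> j) (s m) x - conv n \<nu> (s m) x\<bar> \<partial>leb n) < ennreal (r / 3)"
        using \<open>0 < r\<close> by (intro order_tendstoD(2)[OF lim(4)]) auto
      then show "\<forall>\<^sub>F j in sequentially.
          (\<integral>\<^sup>+x. ennreal \<bar>conv n (\<mu> j) f x - conv n \<nu> f x\<bar> \<partial>leb n) < ennreal r"
      proof eventually_elim
        case (elim j)
        note ms = borel_measurable_integrable[OF \<nu>.integrable_conv[OF lim(1)]]
          borel_measurable_integrable[OF \<nu>.integrable_conv[OF lim(2)[of m]]]
          borel_measurable_integrable[OF \<nu>.integrable_conv[OF int_d]]
          borel_measurable_integrable[OF \<mu>.integrable_conv[OF lim(1), of j]]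
          borel_measurable_integrable[OF \<mu>.integrable_conv[OF lim(2)[of m], of j]]
          borel_measurable_integrable[OF \<mu>.integrable_conv[OF int_d, of j]]
        note [measurable] = ms
        let ?a = "\<integral>\<^sup>+x. ennreal \<bar>conv n (\<mu> j) (\<lambda>x. f x - s m x) x\<bar> \<partial>leb n"
        let ?b = "\<integral>\<^sup>+x. ennreal \<bar>conv n \<nu> (\<lambda>x. f x - s m x) x\<bar> \<partial>leb n"
        let ?c = "\<integral>\<^sup>+x. ennreal \<bar>conv n (\<mu> j) (s m) x - conv n \<nu> (s m) x\<bar> \<partial>leb n"
        let ?e = "\<integral>\<^sup>+x. ennreal \<bar>conv n (\<mu> j) (\<lambda>x. f x - s m x) x - conv n \<nu> (\<lambda>x. f x - s m x) x\<bar> \<partial>leb n"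
        have ab: "?a < ennreal (r / 3)" "?b < ennreal (r / 3)"
          using \<mu>.conv_L1_le[OF int_d, of j] \<nu>.conv_L1_le[OF int_d] m by auto
        have "(\<integral>\<^sup>+x. ennreal \<bar>conv n (\<mu> j) f x - conv n \<nu> f x\<bar> \<partial>leb n) \<le> ?e + ?c"
        proof (intro nn_integral_abs_add_le)
          show "AE x in leb n. \<bar>conv n (\<mu> j) f x - conv n \<nu> f x\<bar>
              \<le> \<bar>conv n (\<mu> j) (\<lambda>x. f x - s m x) x - conv n \<nu> (\<lambda>x. f x - s m x) x\<bar>
                + \<bar>conv n (\<mu> j) (s m) x - conv n \<nu> (s m) x\<bar>"
            using \<mu>.AE_conv_diff[OF lim(1) lim(2)[of m], of j] \<nu>.AE_conv_diff[OF lim(1) lim(2)[of m]]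
            by eventually_elim auto
        qed auto
        also have "?e \<le> ?a + ?b"
          by (intro nn_integral_abs_add_le) auto
        also have "?a + ?b + ?c < ennreal (r / 3) + ennreal (r / 3) + ennreal (r / 3)"
          using ab elim by (intro add_strict_mono)
        also have "\<dots> = ennreal r" using \<open>0 < r\<close> by (simp add: ennreal_plus[symmetric] del: ennreal_plus)
        finally show ?case by (simp add: add_right_mono)
      qed
    qed
  qed
qed

section \<open>Uniqueness of Laplace transforms and the symbol\<close>

text \<open>With x = exp(-t), the transforms at \<sigma>, \<sigma> + 1, \<sigma> + 2, ... are the
  moments of the signed density h. Weierstrass approximation makes h orthogonal to continuous
  functions of x, hence to indicators of rays, hence to those of all Borel sets.\<close>

lemma laplace_unique_zero:
  fixes f :: "real \<Rightarrow> real"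
  assumes zero: "\<And>j::nat. has_bochner_integral lborel
      (\<lambda>t. indicator {0<..} t * (exp (- (\<sigma> + real j) * t) * f t)) 0"
  shows "AE t in lborel. 0 < t \<longrightarrow> f t = 0"
proof -
  define h where "h t = indicator {0<..} t * (exp (- \<sigma> * t) * f t)" for t
  have h_int: "integrable lborel h"
    using zero[of 0] by (auto simp: h_def[abs_def] has_bochner_integral_iff)
  note [measurable] = borel_measurable_integrable[OF h_int]
  have mono: "has_bochner_integral lborel (\<lambda>t. h t * exp (- t) ^ j) 0" for j
  proof -
    have "(\<lambda>t. h t * exp (- t) ^ j) = (\<lambda>t. indicator {0<..} t * (exp (- (\<sigma> + real j) * t) * f t))"
    proof
      fix t
      have "exp (- (\<sigma> + real j) * t) = exp (- \<sigma> * t) * exp (- t) ^ j"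
        by (simp add: exp_of_nat_mult[symmetric] exp_add[symmetric] algebra_simps)
      then show "h t * exp (- t) ^ j = indicator {0<..} t * (exp (- (\<sigma> + real j) * t) * f t)"
        by (simp add: h_def)
    qed
    then show ?thesis using zero by simp
  qed
  \<comment> \<open>A bound for q on [0,1] suffices: h vanishes for t <= 0, and exp(-t) lies in
    [0,1] for all other t.\<close>
  have bounded_int: "integrable lborel (\<lambda>t. h t * q (exp (- t)))"
    if q: "continuous_on UNIV q" "\<And>x. x \<in> {0..1} \<Longrightarrow> \<bar>q x\<bar> \<le> B" for q :: "real \<Rightarrow> real" and B
  proof (rule Bochner_Integration.integrable_bound[OF integrable_mult_left[OF h_int, of B]])
    have [measurable]: "q \<in> borel_measurable borel" using q(1) by (rule borel_measurable_continuous_onI)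
    show "(\<lambda>t. h t * q (exp (- t))) \<in> borel_measurable lborel" by measurable
    show "AE t in lborel. norm (h t * q (exp (- t))) \<le> norm (h t * B)"
    proof (intro AE_I2)
      fix t :: real
      show "norm (h t * q (exp (- t))) \<le> norm (h t * B)"
      proof (cases "t > 0")
        case True
        then have "\<bar>q (exp (- t))\<bar> \<le> \<bar>B\<bar>" using q(2)[of "exp (- t)"] by auto
        then show ?thesis by (simp add: abs_mult mult_left_mono)
      qed (simp add: h_def)
    qed
  qed
  have poly: "(LINT t|lborel. h t * q (exp (- t))) = 0" if "real_polynomial_function q" for q :: "real \<Rightarrow> real"
  proof -
    obtain a N where q: "q = (\<lambda>x. \<Sum>i\<le>N. a i * x ^ i)"
      using \<open>real_polynomial_function q\<close> unfolding real_polynomial_function_iff_sum by auto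
    have "has_bochner_integral lborel (\<lambda>t. \<Sum>i\<le>N. a i * (h t * exp (- t) ^ i)) (\<Sum>i\<le>N. a i * 0)"
      using mono by (intro has_bochner_integral_sum has_bochner_integral_mult_right)
    then show ?thesis
      by (simp add: q has_bochner_integral_iff sum_distrib_left algebra_simps)
  qed
  have cont: "(LINT t|lborel. h t * q (exp (- t))) = 0"
    if q: "continuous_on UNIV q" "\<And>x. x \<in> {0..1} \<Longrightarrow> \<bar>q x\<bar> \<le> 1" for q :: "real \<Rightarrow> real"
  proof -
    have le: "\<bar>LINT t|lborel. h t * q (exp (- t))\<bar> \<le> e * (LINT t|lborel. \<bar>h t\<bar>)" if "0 < e" for e
    proof -
      obtain g where g: "real_polynomial_function g" "\<And>x. x \<in> {0..1} \<Longrightarrow> \<bar>q x - g x\<bar> < e"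
        using Stone_Weierstrass_real_polynomial_function[OF compact_Icc continuous_on_subset[OF q(1)] \<open>0 < e\<close>, of 0 1]
        by auto
      have gc: "continuous_on UNIV g"
        using continuous_real_polymonial_function[OF g(1)] by (simp add: continuous_at_imp_continuous_on)
      have gb: "\<bar>g x\<bar> \<le> 1 + e" if "x \<in> {0..1}" for x
        using q(2)[OF that] g(2)[OF that] by linarith
      note int = bounded_int[OF q] bounded_int[OF gc gb]
      have "(LINT t|lborel. h t * q (exp (- t)))
          = (LINT t|lborel. h t * q (exp (- t)) - h t * g (exp (- t)))"
        using int poly[OF g(1)] by simp
      also have "\<bar>\<dots>\<bar> \<le> (LINT t|lborel. e * \<bar>h t\<bar>)"
      proof (rule integral_abs_bound[THEN order_trans], rule integral_mono)
        show "integrable lborel (\<lambda>t. \<bar>h t * q (exp (- t)) - h t * g (exp (- t))\<bar>)"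
          using int by auto
        show "integrable lborel (\<lambda>t. e * \<bar>h t\<bar>)" using h_int by auto
        show "\<bar>h t * q (exp (- t)) - h t * g (exp (- t))\<bar> \<le> e * \<bar>h t\<bar>" for t
        proof (cases "t > 0")
          case True
          then have "\<bar>q (exp (- t)) - g (exp (- t))\<bar> \<le> e" using g(2)[of "exp (- t)"] by auto
          then show ?thesis
            by (simp add: right_diff_distrib[symmetric] abs_mult mult.commute[of e] mult_left_mono)
        qed (simp add: h_def)
      qed
      finally show ?thesis by simp
    qed
    have "\<bar>LINT t|lborel. h t * q (exp (- t))\<bar> \<le> 0"
    proof (rule field_le_epsilon)
      fix e :: real assume "0 < e"
      \<comment> \<open>Dividing by 1 + H instead of H covers the case H = 0.\<close>
      define H where "H = (LINT t|lborel. \<bar>h t\<bar>)"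
      have "H \<ge> 0" by (simp add: H_def)
      then have "e / (1 + H) * H \<le> e" "e / (1 + H) > 0"
        using \<open>0 < e\<close> by (auto simp: pos_divide_le_eq)
      then show "\<bar>LINT t|lborel. h t * q (exp (- t))\<bar> \<le> 0 + e"
        using le[of "e / (1 + H)"] by (simp add: H_def)
    qed
    then show ?thesis by simp
  qed
  have ray: "(LINT t|lborel. indicator {s<..} t * h t) = 0" if "0 \<le> s" for s
  proof -
    \<comment> \<open>Continuous cutoffs in the variable x: \<open>q k\<close> tends to 1 where x <
      exp(-s), that is t > s, and vanishes where t <= s.\<close>
    define q where "q k x = min 1 (real k * max 0 (exp (- s) - x))" for k x
    have "(\<lambda>k. LINT t|lborel. h t * q k (exp (- t))) \<longlonglongrightarrow> (LINT t|lborel. indicator {s<..} t * h t)"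
    proof (rule integral_dominated_convergence[where w = "\<lambda>t. \<bar>h t\<bar>"])
      show "(\<lambda>t. h t * q k (exp (- t))) \<in> borel_measurable lborel" for k
        unfolding q_def by measurable
      show "AE t in lborel. (\<lambda>k. h t * q k (exp (- t))) \<longlonglongrightarrow> indicator {s<..} t * h t"
      proof (intro AE_I2)
        fix t :: real
        have "(\<lambda>k. q k (exp (- t))) \<longlonglongrightarrow> indicator {s<..} t"
        proof (cases "s < t")
          case True
          define d where "d = exp (- s) - exp (- t)"
          have "d > 0" using True by (simp add: d_def)
          have "q k (exp (- t)) = 1" if "nat \<lceil>1 / d\<rceil> \<le> k" for k
          proof -
            have "1 / d \<le> real k" using that by linarith
            then have "1 \<le> real k * d" using \<open>d > 0\<close> by (simp add: pos_divide_le_eq)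
            then show ?thesis using \<open>d > 0\<close> by (simp add: q_def d_def[symmetric])
          qed
          then show ?thesis
            using True by (intro tendsto_eventually
                eventually_mono[OF eventually_ge_at_top[of "nat \<lceil>1 / d\<rceil>"]]) simp
        next
          case False
          then show ?thesis by (simp add: q_def)
        qed
        from tendsto_mult_left[OF this, of "h t"]
        show "(\<lambda>k. h t * q k (exp (- t))) \<longlonglongrightarrow> indicator {s<..} t * h t"
          by (simp add: mult.commute)
      qed
      show "AE t in lborel. norm (h t * q k (exp (- t))) \<le> \<bar>h t\<bar>" for k
        by (intro AE_I2) (auto simp: abs_mult q_def intro!: mult_left_le)
    qed (use h_int in auto)
    moreover have "(LINT t|lborel. h t * q k (exp (- t))) = 0" for k
      unfolding q_def by (intro cont continuous_intros) auto
    ultimately show ?thesis by (simp add: LIMSEQ_const_iff)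
  qed
  have int_A: "integrable lborel (\<lambda>t. indicator A t * h t)" if "A \<in> sets borel" for A
    using integrable_mult_indicator[of A lborel h] that h_int by simp
  have sets_zero: "(LINT t|lborel. indicator A t * h t) = 0" if "A \<in> sets borel" for A
  proof -
    have "{a<..} \<inter> {b<..} = {max a b<..}" for a b :: real by auto
    then have "Int_stable (range (greaterThan :: real \<Rightarrow> _))"
      by (auto simp: Int_stable_def)
    moreover have "range greaterThan \<subseteq> Pow (UNIV :: real set)" by simp
    moreover have "A \<in> sigma_sets UNIV (range greaterThan)"
      using that by (simp add: borel_Ioi)
    ultimately show ?thesis
    proof (induction rule: sigma_sets_induct_disjoint)
      case (basic A)
      then obtain s where A: "A = {s<..}" by auto
      \<comment> \<open>A ray starting below 0 may be replaced by the ray from 0, since h vanishes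
        in between.\<close>
      have "(\<lambda>t. indicator A t * h t) = (\<lambda>t. indicator {max s 0<..} t * h t)"
        by (auto simp: A h_def indicator_def fun_eq_iff)
      then show ?case using ray[of "max s 0"] by simp
    next
      case (compl A)
      then have A: "A \<in> sets borel" by (simp add: borel_Ioi)
      have "(\<lambda>t. indicator (UNIV - A) t * h t) = (\<lambda>t. indicator {0<..} t * h t - indicator A t * h t)"
        by (auto simp: h_def indicator_def fun_eq_iff)
      then show ?case using ray[of 0] compl(2) int_A[OF A] int_A[of "{0<..}"] by simp
    next
      case (union A)
      have A: "A i \<in> sets lborel" for i using union(2) by (auto simp: borel_Ioi)
      have "set_integrable lborel (\<Union>i. A i) h"
        using int_A[of "\<Union>i. A i"] A by (auto simp: set_integrable_def)
      from lebesgue_integral_countable_add[OF A _ this] union(1,3)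
      show ?case by (auto simp: set_lebesgue_integral_def disjoint_family_on_def)
    qed simp
  qed
  have "AE t in lborel. h t = 0"
    using h_int sets_zero by (intro density_unique_real) (auto simp: set_lebesgue_integral_def)
  then show ?thesis by eventually_elim (auto simp: h_def)
qed

section \<open>The symbol on the positive axis and its asymptotics\<close>

lemma Psi_real: "z > 0 \<Longrightarrow> Psi \<alpha>1 \<alpha>2 c z = z powr (- ((\<alpha>2 * c + \<alpha>1 * z) / (c + z)))" for z :: real
  by (simp add: Psi_def B_order_def)

lemma Psi_complex_of_real:
  assumes "z > 0" shows "Psi \<alpha>1 \<alpha>2 c (complex_of_real z) = complex_of_real (Psi \<alpha>1 \<alpha>2 c z)"
proof -
  have "B_order \<alpha>1 \<alpha>2 c (complex_of_real z) = complex_of_real (B_order \<alpha>1 \<alpha>2 c z)"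
    by (simp add: B_order_def)
  then show ?thesis using assms by (simp add: Psi_def powr_of_real flip: of_real_minus)
qed

text \<open>The exponent tends to \<open>-\<alpha>2\<close> at 0. Through the Laplace transform this
  blow-up makes the primitive of the kernel unbounded, so that \<open>K_inv\<close> is meaningful at
  every nonnegative argument.\<close>

lemma Psi_at_0:
  assumes "\<alpha>2 > 0" "c > 0"
  shows "filterlim (\<lambda>z::real. Psi \<alpha>1 \<alpha>2 c z) at_top (at_right 0)"
proof -
  have "filterlim (\<lambda>z::real. z powr (- ((\<alpha>2 * c + \<alpha>1 * z) / (c + z)))) at_top (at_right 0)"
    using assms by real_asymp
  then show ?thesis
    by (rule filterlim_mono_eventually) (auto simp: Psi_real eventually_at_filter)
qed

text \<open>With z = 1/t, the order B(z) differs from \<open>\<alpha>1\<close> by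
  \<open>(\<alpha>2 - \<alpha>1) * c / (c + z)\<close>, whose product with log z tends to 0 as z
  grows. The quotient thus tends to 1, and 2 is one convenient constant above 1.\<close>

lemma Psi_inverse_small:
  assumes "\<alpha>1 > 0" "c > 0"
  shows "\<forall>\<^sub>F t::real in at_right 0. Psi \<alpha>1 \<alpha>2 c (1 / t) \<le> 2 * t powr \<alpha>1"
proof -
  have "((\<lambda>t::real. (1 / t) powr (- ((\<alpha>2 * c + \<alpha>1 * (1 / t)) / (c + 1 / t))) / t powr \<alpha>1) \<longlongrightarrow> 1) (at_right 0)"
    using assms by real_asymp
  from order_tendstoD(2)[OF this, of 2] have
    "\<forall>\<^sub>F t::real in at_right 0. (1 / t) powr (- ((\<alpha>2 * c + \<alpha>1 * (1 / t)) / (c + 1 / t))) / t powr \<alpha>1 < 2"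
    by simp
  moreover have "\<forall>\<^sub>F t::real in at_right 0. t > 0" by (simp add: eventually_at_filter)
  ultimately show ?thesis
    by eventually_elim (simp add: Psi_real field_simps)
qed

text \<open>Here z = 1/t tends to 0, B(z) differs from \<open>\<alpha>2\<close> by
  \<open>(\<alpha>1 - \<alpha>2) * z / (c + z)\<close>, and z log z tends to 0.\<close>

lemma Psi_inverse_large:
  assumes "\<alpha>2 > 0" "c > 0"
  shows "\<forall>\<^sub>F t::real in at_top. Psi \<alpha>1 \<alpha>2 c (1 / t) \<le> 2 * t powr \<alpha>2"
proof -
  have "((\<lambda>t::real. (1 / t) powr (- ((\<alpha>2 * c + \<alpha>1 * (1 / t)) / (c + 1 / t))) / t powr \<alpha>2) \<longlongrightarrow> 1) at_top"
    using assms by real_asymp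
  from order_tendstoD(2)[OF this, of 2] have
    "\<forall>\<^sub>F t::real in at_top. (1 / t) powr (- ((\<alpha>2 * c + \<alpha>1 * (1 / t)) / (c + 1 / t))) / t powr \<alpha>2 < 2"
    by simp
  moreover have "\<forall>\<^sub>F t::real in at_top. t > 0" by (rule eventually_gt_at_top)
  ultimately show ?thesis
    by eventually_elim (simp add: Psi_real field_simps)
qed

section \<open>The primitive of a nonnegative kernel\<close>

text \<open>An abstraction of the total mass of \<open>Y t\<close>. The mass, unlike
  \<open>\<psi>\<close>, is nonnegative at every t by construction and has its transform at all z >
  0, whereas \<open>psi_kernel\<close> only supplies some abscissa \<open>\<sigma>\<close>.\<close>

locale laplace_kernel =
  fixes \<kappa> F :: "real \<Rightarrow> real"
  assumes nonneg: "0 \<le> \<kappa> t"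
    and laplace: "0 < z \<Longrightarrow>
      has_bochner_integral lborel (\<lambda>t. indicator {0<..} t * (exp (- z * t) * \<kappa> t)) (F z)"
begin

lemma measurable_kernel [measurable]: "(\<lambda>t. indicator {0<..} t * \<kappa> t) \<in> borel_measurable borel"
proof -
  \<comment> \<open>Measurability is read off from the Laplace integrand at z = 1 by undoing the
    exponential weight.\<close>
  have "(\<lambda>t. exp t * (indicator {0<..} t * (exp (- 1 * t) * \<kappa> t))) \<in> borel_measurable borel"
    using borel_measurable_has_bochner_integral[OF laplace[of 1]] by measurable
  moreover have "exp t * (indicator {0<..} t * (exp (- 1 * t) * \<kappa> t)) = indicator {0<..} t * \<kappa> t" for t
    by (simp add: exp_minus)
  ultimately show ?thesis by (simp only:)
qed

lemma nn_integral_laplace: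
  assumes "0 < z"
  shows "(\<integral>\<^sup>+t. ennreal (indicator {0<..} t * (exp (- z * t) * \<kappa> t)) \<partial>lborel) = ennreal (F z)"
  using laplace[OF assms] nonneg by (intro nn_integral_eq_integral[THEN trans]) (auto simp: has_bochner_integral_iff)

text \<open>On (0,t] the weight exp(-z s) is at least exp(-z t). Taken with z = 1 this gives local
  integrability, with z = 1/t the estimate \<open>primitive_le_laplace\<close>.\<close>

lemma kernel_le: "indicator {0<..t} s * \<kappa> s \<le> exp (z * t) * (indicator {0<..} s * (exp (- z * s) * \<kappa> s))"
  if "0 \<le> z" for t s z
proof (cases "s \<in> {0<..t}")
  case True
  then have "1 \<le> exp (z * t) * exp (- z * s)"
    using that by (simp add: exp_add[symmetric] mult_left_mono)
  then have "1 * \<kappa> s \<le> (exp (z * t) * exp (- z * s)) * \<kappa> s"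
    using nonneg by (intro mult_right_mono)
  then show ?thesis using True by (simp add: mult.assoc)
qed (use nonneg in simp)

lemma measurable_kernel_Ioc [measurable]: "(\<lambda>s. indicator {0<..t} s * \<kappa> s) \<in> borel_measurable borel"
proof -
  have "(\<lambda>s. indicator {0<..t} s * \<kappa> s) = (\<lambda>s. indicator {..t} s * (indicator {0<..} s * \<kappa> s))"
    by (auto simp: indicator_def fun_eq_iff)
  then show ?thesis by simp
qed

lemma integrable_kernel: "set_integrable lborel {0<..t} \<kappa>"
  unfolding set_integrable_def
proof (rule Bochner_Integration.integrable_bound)
  show "integrable lborel (\<lambda>s. exp (1 * t) * (indicator {0<..} s * (exp (- 1 * s) * \<kappa> s)))"
    using laplace[of 1] by (intro integrable_mult_right) (simp add: has_bochner_integral_iff)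
  show "AE s in lborel. norm (indicator {0<..t} s *\<^sub>R \<kappa> s)
      \<le> norm (exp (1 * t) * (indicator {0<..} s * (exp (- 1 * s) * \<kappa> s)))"
    using kernel_le[of 1 t] nonneg by (intro AE_I2) (simp add: abs_mult)
qed simp

definition primitive :: "real \<Rightarrow> real" where
  "primitive t = (LBINT s:{0<..t}. \<kappa> s)"

lemma nn_integral_kernel: "(\<integral>\<^sup>+s. ennreal (indicator {0<..t} s * \<kappa> s) \<partial>lborel) = ennreal (primitive t)"
  unfolding primitive_def set_lebesgue_integral_def
  using integrable_kernel[of t] nonneg
  by (subst nn_integral_eq_integral) (auto simp: set_integrable_def)

lemma primitive_nonneg: "0 \<le> primitive t"
  unfolding primitive_def set_lebesgue_integral_def using nonneg by (intro integral_nonneg_AE) auto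

lemma primitive_0: "primitive 0 = 0"
  by (simp add: primitive_def set_lebesgue_integral_def)

lemma primitive_mono: "s \<le> t \<Longrightarrow> primitive s \<le> primitive t"
  unfolding primitive_def set_lebesgue_integral_def
  using integrable_kernel[of t] integrable_kernel[of s] nonneg
  by (intro integral_mono) (auto simp: set_integrable_def indicator_def)

text \<open>The choice z = 1/t makes the weight exp(-z s) at least 1/e on all of (0,t].\<close>

lemma primitive_le_laplace:
  assumes "0 < t" shows "primitive t \<le> exp 1 * F (1 / t)"
proof -
  have "primitive t \<le> (LINT s|lborel. exp (1 / t * t) * (indicator {0<..} s * (exp (- (1 / t) * s) * \<kappa> s)))"
    unfolding primitive_def set_lebesgue_integral_def
  proof (rule integral_mono)
    show "integrable lborel (\<lambda>s. indicator {0<..t} s *\<^sub>R \<kappa> s)"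
      using integrable_kernel[of t] by (simp add: set_integrable_def)
    show "integrable lborel (\<lambda>s. exp (1 / t * t) * (indicator {0<..} s * (exp (- (1 / t) * s) * \<kappa> s)))"
      using laplace[of "1 / t"] assms by (intro integrable_mult_right) (simp add: has_bochner_integral_iff)
    show "indicator {0<..t} s *\<^sub>R \<kappa> s \<le> exp (1 / t * t) * (indicator {0<..} s * (exp (- (1 / t) * s) * \<kappa> s))" for s
      using kernel_le[of "1 / t" t s] assms by simp
  qed
  also have "\<dots> = exp 1 * F (1 / t)"
    using laplace[of "1 / t"] assms by (simp add: has_bochner_integral_iff)
  finally show ?thesis .
qed

text \<open>The kernel may be singular at 0, so continuity rests on its integrability over each
  [0,b] and not on a bound for it.\<close>

lemma continuous_primitive: "continuous_on {0..} primitive"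
proof -
  have "continuous_on {0..b} primitive" for b
  proof -
    have "set_integrable lborel {0<..b} (\<lambda>s. indicator {0<..} s * \<kappa> s)"
      using integrable_kernel[of b] unfolding set_integrable_def
      by (rule Bochner_Integration.integrable_cong[THEN iffD1, rotated -1]) (auto simp: indicator_def)
    then have int: "set_integrable lborel {0..b} (\<lambda>s. indicator {0<..} s * \<kappa> s)"
      unfolding set_integrable_def
      by (rule Bochner_Integration.integrable_cong[THEN iffD1, rotated -1]) (auto simp: indicator_def)
    have eq: "primitive t = integral {0..t} (\<lambda>s. indicator {0<..} s * \<kappa> s)" if "t \<le> b" for t
    proof -
      have "set_integrable lborel {0..t} (\<lambda>s. indicator {0<..} s * \<kappa> s)"
        using that by (intro set_integrable_subset[OF int]) auto
      then have "integral {0..t} (\<lambda>s. indicator {0<..} s * \<kappa> s)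
          = (LBINT s:{0..t}. indicator {0<..} s * \<kappa> s)"
        by (rule set_borel_integral_eq_integral(2)[symmetric])
      also have "\<dots> = primitive t"
        unfolding primitive_def set_lebesgue_integral_def
        by (intro Bochner_Integration.integral_cong) (auto simp: indicator_def)
      finally show ?thesis ..
    qed
    have "continuous_on {0..b} (\<lambda>t. integral {0..t} (\<lambda>s. indicator {0<..} s * \<kappa> s))"
      using set_borel_integral_eq_integral(1)[OF int] by (rule indefinite_integral_continuous_1)
    then show ?thesis by (rule continuous_on_eq) (simp add: eq)
  qed
  then have c: "continuous (at x within {0..x + 1}) primitive" if "x \<ge> 0" for x
    using that by (auto simp: continuous_on_eq_continuous_within)
  show ?thesis
    unfolding continuous_on_eq_continuous_within
  proof
    fix x :: real assume "x \<in> {0..}"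
    moreover have "at x within {0..x + 1} = at x within {0..}"
      by (rule at_within_nhd[of _ "{..<x + 1}"]) (auto simp: \<open>x \<in> {0..}\<close>)
    ultimately show "continuous (at x within {0..}) primitive" using c[of x] by simp
  qed
qed

lemma primitive_small:
  assumes "0 < e" obtains h where "0 < h" "primitive h < e"
proof -
  have "continuous (at 0 within {0..}) primitive"
    using continuous_primitive by (simp add: continuous_on_eq_continuous_within)
  then obtain d where d: "0 < d" "\<And>x. x \<in> {0..} \<Longrightarrow> dist x 0 < d \<Longrightarrow> dist (primitive x) (primitive 0) < e"
    using assms unfolding continuous_within_eps_delta by blast
  have "dist (primitive (d / 2)) (primitive 0) < e" using d by (intro d(2)) (auto simp: dist_real_def)
  then show thesis using d(1) that[of "d / 2"] by (simp add: dist_real_def primitive_0)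
qed

text \<open>If the primitive stayed below y, monotone convergence would bound the whole integral of
  the kernel, and with it \<open>F z\<close> for every z > 0, by y, against the blow-up of F at 0.
  The intermediate value theorem does the rest.\<close>

lemma primitive_surj:
  assumes F: "filterlim F at_top (at_right 0)" and y: "0 \<le> y"
  shows "\<exists>t\<ge>0. primitive t = y"
proof -
  have "\<exists>t\<ge>0. y \<le> primitive t"
  proof (rule ccontr)
    assume neg: "\<not> (\<exists>t\<ge>0. y \<le> primitive t)"
    have bd: "primitive t \<le> y" if "t \<ge> 0" for t using that neg by (meson linear)
    have F_le: "F z \<le> y" if "0 < z" for z
    proof -
      have "ennreal (F z) \<le> (\<integral>\<^sup>+s. ennreal (indicator {0<..} s * \<kappa> s) \<partial>lborel)"
        unfolding nn_integral_laplace[OF that, symmetric]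
      proof (intro nn_integral_mono ennreal_leI)
        fix s
        show "indicator {0<..} s * (exp (- z * s) * \<kappa> s) \<le> indicator {0<..} s * \<kappa> s"
          using that nonneg[of s] by (auto simp: indicator_def intro!: mult_left_le_one_le)
      qed
      also have "\<dots> = (\<integral>\<^sup>+s. (SUP k. ennreal (indicator {0<..real k} s * \<kappa> s)) \<partial>lborel)"
      proof (intro nn_integral_cong)
        fix s :: real
        obtain k where k: "s \<le> real k" using real_arch_simple by blast
        show "ennreal (indicator {0<..} s * \<kappa> s) = (SUP k. ennreal (indicator {0<..real k} s * \<kappa> s))"
        proof (rule antisym)
          have "ennreal (indicator {0<..} s * \<kappa> s) = ennreal (indicator {0<..real k} s * \<kappa> s)"
            using k by (simp add: indicator_def)
          then show "ennreal (indicator {0<..} s * \<kappa> s) \<le> (SUP k. ennreal (indicator {0<..real k} s * \<kappa> s))"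
            by (simp only:) (rule SUP_upper, simp)
          show "(SUP k. ennreal (indicator {0<..real k} s * \<kappa> s)) \<le> ennreal (indicator {0<..} s * \<kappa> s)"
            using nonneg by (intro SUP_least ennreal_leI) (auto simp: indicator_def)
        qed
      qed
      also have "\<dots> = (SUP k. \<integral>\<^sup>+s. ennreal (indicator {0<..real k} s * \<kappa> s) \<partial>lborel)"
      proof (rule nn_integral_monotone_convergence_SUP)
        show "incseq (\<lambda>k s. ennreal (indicator {0<..real k} s * \<kappa> s))"
          using nonneg by (auto simp: incseq_def le_fun_def indicator_def intro!: ennreal_leI)
      qed measurable
      also have "\<dots> \<le> ennreal y"
        using bd by (intro SUP_least) (simp add: nn_integral_kernel ennreal_leI)
      finally show ?thesis using y by simp
    qed
    have "\<forall>\<^sub>F z in at_right 0. y < F z" using F by (simp add: filterlim_at_top_dense)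
    moreover have "\<forall>\<^sub>F z::real in at_right 0. 0 < z" by (simp add: eventually_at_filter)
    ultimately have "\<forall>\<^sub>F z::real in at_right 0. False"
      by eventually_elim (use F_le in force)
    then show False by simp
  qed
  then obtain t where t: "t \<ge> 0" "y \<le> primitive t" by auto
  have "\<exists>x\<ge>0. x \<le> t \<and> primitive x = y"
    using t y continuous_on_subset[OF continuous_primitive, of "{0..t}"]
    by (intro IVT') (auto simp: primitive_0)
  then show ?thesis by auto
qed

end

section \<open>The total mass of \<open>Y t\<close> as the density of \<open>K_int\<close>\<close>

lemma Y_family_laplace_kernel:
  assumes Y: "Y_family \<alpha>1 \<alpha>2 c n Y"
  shows "laplace_kernel (\<lambda>t. measure (Y t) (space (Y t))) (Psi \<alpha>1 \<alpha>2 c)"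
proof
  fix z :: real assume z: "0 < z"
  \<comment> \<open>At frequency 0 the Fourier transform is the total mass, and the prescribed
    transform reduces to the inverse of the inverse of \<open>Psi\<close>.\<close>
  have "has_bochner_integral lborel
      (\<lambda>t. indicator {0<..} t *\<^sub>R (complex_of_real (exp (- z * t)) * fourier_measure n (Y t) (\<lambda>_. 0)))
      (of_real (1 / (inverse (Psi \<alpha>1 \<alpha>2 c z) + (\<Sum>i<n. ((\<lambda>_. 0) i)\<^sup>2))))"
    using Y z unfolding Y_family_def by blast
  moreover have "fourier_measure n (Y t) (\<lambda>_. 0) = complex_of_real (measure (Y t) (space (Y t)))" for t
    by (simp add: fourier_measure_def scaleR_conv_of_real)
  ultimately have "has_bochner_integral lborel
      (\<lambda>t. complex_of_real (indicator {0<..} t * (exp (- z * t) * measure (Y t) (space (Y t)))))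
      (complex_of_real (Psi \<alpha>1 \<alpha>2 c z))"
    by (simp add: scaleR_conv_of_real mult.assoc divide_inverse)
  then have "has_bochner_integral lborel
      (\<lambda>t. Re (complex_of_real (indicator {0<..} t * (exp (- z * t) * measure (Y t) (space (Y t))))))
      (Re (complex_of_real (Psi \<alpha>1 \<alpha>2 c z)))"
    by (rule has_bochner_integral_bounded_linear[OF bounded_linear_Re])
  then show "has_bochner_integral lborel
      (\<lambda>t. indicator {0<..} t * (exp (- z * t) * measure (Y t) (space (Y t)))) (Psi \<alpha>1 \<alpha>2 c z)"
    by (simp only: Re_complex_of_real)
qed simp

lemma psi_eq_Y_mass:
  assumes \<psi>: "psi_kernel \<alpha>1 \<alpha>2 c \<psi>" and Y: "Y_family \<alpha>1 \<alpha>2 c n Y"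
  shows "AE t in lborel. 0 < t \<longrightarrow> \<psi> t = measure (Y t) (space (Y t))"
proof -
  interpret laplace_kernel "\<lambda>t. measure (Y t) (space (Y t))" "Psi \<alpha>1 \<alpha>2 c"
    by (rule Y_family_laplace_kernel[OF Y])
  obtain \<sigma> where \<sigma>: "0 \<le> \<sigma>" "\<And>z::complex. Re z > \<sigma> \<Longrightarrow> has_bochner_integral lborel
      (\<lambda>t. indicator {0<..} t *\<^sub>R (exp (- z * of_real t) * of_real (\<psi> t))) (Psi \<alpha>1 \<alpha>2 c z)"
    using \<psi> unfolding psi_kernel_def by blast
  have "has_bochner_integral lborel
      (\<lambda>t. indicator {0<..} t * (exp (- (\<sigma> + 1 + real j) * t) * (\<psi> t - measure (Y t) (space (Y t))))) 0" for j
  proof -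
    \<comment> \<open>The shift by 1 puts all sample points beyond the abscissa
      \<open>\<sigma>\<close> and on the positive axis, where both transforms converge.\<close>
    define z where "z = \<sigma> + 1 + real j"
    have z: "z > \<sigma>" "z > 0" using \<sigma>(1) by (auto simp: z_def)
    have "has_bochner_integral lborel
        (\<lambda>t. Re (indicator {0<..} t *\<^sub>R (exp (- complex_of_real z * of_real t) * of_real (\<psi> t))))
        (Re (Psi \<alpha>1 \<alpha>2 c (complex_of_real z)))"
      using \<sigma>(2)[of "complex_of_real z"] z
      by (intro has_bochner_integral_bounded_linear[OF bounded_linear_Re]) auto
    moreover have "Re (indicator {0<..} t *\<^sub>R (exp (- complex_of_real z * of_real t) * of_real (\<psi> t)))
        = indicator {0<..} t * (exp (- z * t) * \<psi> t)" for t
    proof -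
      have "exp (- complex_of_real z * of_real t) = complex_of_real (exp (- z * t))"
        by (simp add: exp_of_real[symmetric])
      then show ?thesis by simp
    qed
    ultimately have "has_bochner_integral lborel
        (\<lambda>t. indicator {0<..} t * (exp (- z * t) * \<psi> t)) (Psi \<alpha>1 \<alpha>2 c z)"
      by (simp only: Psi_complex_of_real[OF z(2)] Re_complex_of_real)
    from has_bochner_integral_diff[OF this laplace[OF z(2)]]
    show ?thesis by (simp add: z_def right_diff_distrib)
  qed
  from laplace_unique_zero[OF this] show ?thesis by simp
qed

lemma K_int_eq_primitive:
  assumes \<psi>: "psi_kernel \<alpha>1 \<alpha>2 c \<psi>" and Y: "Y_family \<alpha>1 \<alpha>2 c n Y"
  shows "K_int \<psi> = laplace_kernel.primitive (\<lambda>t. measure (Y t) (space (Y t)))"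
proof
  fix t
  interpret laplace_kernel "\<lambda>t. measure (Y t) (space (Y t))" "Psi \<alpha>1 \<alpha>2 c"
    by (rule Y_family_laplace_kernel[OF Y])
  have "(\<lambda>s. indicator {0<..t} s *\<^sub>R \<psi> s) \<in> borel_measurable lborel"
  proof (cases "t > 0")
    case True
    then have "set_integrable lborel {0<..t} \<psi>" using \<psi> unfolding psi_kernel_def by blast
    then show ?thesis unfolding set_integrable_def by (rule borel_measurable_integrable)
  qed simp
  then show "K_int \<psi> t = primitive t"
    unfolding K_int_def primitive_def set_lebesgue_integral_def
  proof (intro integral_cong_AE)
    show "AE s in lborel. indicator {0<..t} s *\<^sub>R \<psi> s
        = indicator {0<..t} s *\<^sub>R measure (Y s) (space (Y s))"
      using psi_eq_Y_mass[OF assms] by eventually_elim (auto simp: indicator_def)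
  qed (use measurable_kernel_Ioc[of t] in simp_all)
qed

section \<open>The Duhamel operator\<close>

locale duhamel = laplace_kernel "\<lambda>t. measure (Y t) (space (Y t))" F
  for Y :: "real \<Rightarrow> (nat \<Rightarrow> real) measure" and F +
  fixes n :: nat
  assumes finite_Y: "0 < t \<Longrightarrow> finite_measure (Y t)"
    and sets_Y: "0 < t \<Longrightarrow> sets (Y t) = sets (leb n)"
    and measurable_Y: "E \<in> sets (leb n) \<Longrightarrow>
      (\<lambda>t. measure (Y t) E) \<in> borel_measurable (restrict_space borel {0<..})"
begin

abbreviation \<kappa> :: "real \<Rightarrow> real" where "\<kappa> t \<equiv> measure (Y t) (space (Y t))"

lemma leb_measure_Y: "0 < t \<Longrightarrow> leb_measure n (Y t)"
  using finite_Y sets_Y by (simp add: leb_measure_def leb_measure_axioms_def)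

lemma space_Y: "0 < t \<Longrightarrow> space (Y t) = space (leb n)"
  using sets_Y by (metis sets_eq_imp_space_eq)

lemma measurable_Y_global:
  assumes "E \<in> sets (leb n)"
  shows "(\<lambda>t. if 0 < t then measure (Y t) E else 0) \<in> borel_measurable borel"
proof -
  have "(\<lambda>t. if t \<in> {0<..} then measure (Y t) E else 0) \<in> borel_measurable borel"
    using measurable_Y[OF assms] by (subst measurable_If_restrict_space_iff) (auto simp: greaterThan_def)
  then show ?thesis by simp
qed

lemma measurable_mass [measurable]: "(\<lambda>t. if 0 < t then \<kappa> t else 0) \<in> borel_measurable borel"
proof -
  have "(\<lambda>t. if 0 < t then \<kappa> t else 0) = (\<lambda>t. if 0 < t then measure (Y t) (space (leb n)) else 0)"
    by (auto simp: space_Y)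
  then show ?thesis using measurable_Y_global[OF sets.top] by simp
qed

text \<open>Normalising \<open>Y r\<close> by \<open>1 + \<kappa> r\<close> gives a subprobability kernel, for which joint measurability is
  in the library.\<close>

lemma measurable_econv_joint:
  assumes \<rho> [measurable]: "\<rho> \<in> borel_measurable M"
    and W [measurable]: "(\<lambda>(m, x). W m x) \<in> borel_measurable (M \<Otimes>\<^sub>M leb n)"
  shows "(\<lambda>(m, x). if 0 < \<rho> m then econv n (Y (\<rho> m)) (W m) x else 0) \<in> borel_measurable (M \<Otimes>\<^sub>M leb n)"
proof -
  \<comment> \<open>The null measure at r <= 0 makes \<open>L\<close> a subprobability kernel on the
    whole real line.\<close>
  define L where "L r = (if 0 < r then scale_measure (ennreal (1 / (1 + \<kappa> r))) (Y r) else null_measure (leb n))" for r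
  have sets_L: "sets (L r) = sets (leb n)" for r by (simp add: L_def sets_Y)
  have emeasure_L: "emeasure (L r) E = ennreal ((if 0 < r then measure (Y r) E else 0) / (1 + (if 0 < r then \<kappa> r else 0)))"
    if "E \<in> sets (leb n)" for r E
  proof (cases "0 < r")
    case True
    then interpret finite_measure "Y r" by (rule finite_Y)
    show ?thesis
      using True by (simp add: L_def emeasure_eq_measure ennreal_mult[symmetric])
  qed (simp add: L_def)
  have "L \<in> borel \<rightarrow>\<^sub>M subprob_algebra (leb n)"
  proof (rule measurable_subprob_algebra)
    fix r :: real
    have "emeasure (L r) (space (L r)) \<le> 1"
    proof (subst emeasure_L)
      show "ennreal ((if 0 < r then measure (Y r) (space (L r)) else 0) / (1 + (if 0 < r then \<kappa> r else 0))) \<le> 1"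
        by (cases "0 < r") (auto simp: L_def space_scale_measure field_simps add_pos_nonneg intro!: ennreal_le_1[THEN iffD2])
      show "space (L r) \<in> sets (leb n)" using sets_L by (metis sets.top)
    qed
    moreover have "space (L r) \<noteq> {}"
      using sets_eq_imp_space_eq[OF sets_L] by (auto simp: space_leb PiE_eq_empty_iff)
    ultimately show "subprob_space (L r)" by (intro subprob_spaceI)
    show "sets (L r) = sets (leb n)" by (rule sets_L)
  next
    fix E assume E: "E \<in> sets (leb n)"
    note [measurable] = measurable_Y_global[OF E]
    show "(\<lambda>r. emeasure (L r) E) \<in> borel_measurable borel"
      unfolding emeasure_L[OF E] by measurable
  qed
  then have L [measurable]: "(\<lambda>z. L (\<rho> (fst z))) \<in> M \<Otimes>\<^sub>M leb n \<rightarrow>\<^sub>M subprob_algebra (leb n)"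
    by measurable
  have [measurable]: "(\<lambda>(z, y). W (fst z) (vsub n (snd z) y)) \<in> borel_measurable ((M \<Otimes>\<^sub>M leb n) \<Otimes>\<^sub>M leb n)"
  proof -
    have "(\<lambda>w. (fst (fst w), vsub n (snd (fst w)) (snd w)))
        \<in> (M \<Otimes>\<^sub>M leb n) \<Otimes>\<^sub>M leb n \<rightarrow>\<^sub>M M \<Otimes>\<^sub>M leb n" by measurable
    from measurable_compose[OF this W] show ?thesis by (simp add: split_beta')
  qed
  have "(\<lambda>z. \<integral>\<^sup>+y. W (fst z) (vsub n (snd z) y) \<partial>L (\<rho> (fst z))) \<in> borel_measurable (M \<Otimes>\<^sub>M leb n)"
    by (rule nn_integral_measurable_subprob_algebra2[OF _ L]) measurable
  then have "(\<lambda>z. ennreal (1 + (if 0 < \<rho> (fst z) then \<kappa> (\<rho> (fst z)) else 0)) *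
      (\<integral>\<^sup>+y. W (fst z) (vsub n (snd z) y) \<partial>L (\<rho> (fst z)))) \<in> borel_measurable (M \<Otimes>\<^sub>M leb n)"
    by measurable
  also have "?this \<longleftrightarrow> ?thesis"
  proof (rule measurable_cong)
    fix z assume z: "z \<in> space (M \<Otimes>\<^sub>M leb n)"
    obtain m x where mx: "z = (m, x)" "m \<in> space M" "x \<in> space (leb n)"
      using z by (auto simp: space_pair_measure)
    have Wm: "W m \<in> borel_measurable (leb n)" using mx(2) by measurable
    show "ennreal (1 + (if 0 < \<rho> (fst z) then \<kappa> (\<rho> (fst z)) else 0)) *
        (\<integral>\<^sup>+y. W (fst z) (vsub n (snd z) y) \<partial>L (\<rho> (fst z)))
        = (case z of (m, x) \<Rightarrow> if 0 < \<rho> m then econv n (Y (\<rho> m)) (W m) x else 0)"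
    proof (cases "0 < \<rho> m")
      case True
      then interpret leb_measure n "Y (\<rho> m)" by (rule leb_measure_Y)
      have "(\<lambda>y. W m (vsub n x y)) \<in> borel_measurable (Y (\<rho> m))"
        using Wm mx(3) by measurable
      then have "ennreal (1 + \<kappa> (\<rho> m)) * (\<integral>\<^sup>+y. W m (vsub n x y) \<partial>L (\<rho> m))
          = (ennreal (1 + \<kappa> (\<rho> m)) * ennreal (1 / (1 + \<kappa> (\<rho> m)))) * econv n (Y (\<rho> m)) (W m) x"
        using True by (simp add: L_def nn_integral_scale_measure econv_def mult.assoc)
      also have "ennreal (1 + \<kappa> (\<rho> m)) * ennreal (1 / (1 + \<kappa> (\<rho> m))) = 1"
        by (subst ennreal_mult[symmetric]) (auto simp: add_pos_nonneg less_imp_neq[symmetric])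
      finally show ?thesis using True by (simp add: mx(1))
    qed (simp add: mx(1) L_def)
  qed
  finally show ?thesis .
qed

text \<open>The argument \<open>W\<close> lives on the whole time axis and is extended by zero, so that the time
  integral needs no upper limit.\<close>

definition duh :: "(real \<Rightarrow> (nat \<Rightarrow> real) \<Rightarrow> ennreal) \<Rightarrow> real \<Rightarrow> (nat \<Rightarrow> real) \<Rightarrow> ennreal" where
  "duh W t x = (\<integral>\<^sup>+r. (if 0 < r then econv n (Y r) (W (t - r)) x else 0) \<partial>lborel)"

context
  fixes W :: "real \<Rightarrow> (nat \<Rightarrow> real) \<Rightarrow> ennreal"
  assumes W [measurable]: "(\<lambda>(s, x). W s x) \<in> borel_measurable (borel \<Otimes>\<^sub>M leb n)"
begin

lemma measurable_section: "W s \<in> borel_measurable (leb n)"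
  using measurable_compose[OF _ W, of "\<lambda>x. (s, x)" "leb n"] by simp

lemma measurable_section_lborel:
  "(\<lambda>(s, x). W (\<rho> s) x) \<in> borel_measurable (lborel \<Otimes>\<^sub>M leb n)" if [measurable]: "\<rho> \<in> borel_measurable borel"
proof -
  have "(\<lambda>z. (\<rho> (fst z), snd z)) \<in> lborel \<Otimes>\<^sub>M leb n \<rightarrow>\<^sub>M borel \<Otimes>\<^sub>M leb n" by measurable
  from measurable_compose[OF this W] show ?thesis by (simp add: split_beta')
qed

lemma measurable_duh_integrand:
  "(\<lambda>(r, x). if 0 < r then econv n (Y r) (W (t - r)) x else 0) \<in> borel_measurable (lborel \<Otimes>\<^sub>M leb n)"
  using measurable_section_lborel[of "\<lambda>r. t - r"]
  by (intro measurable_econv_joint[where \<rho> = "\<lambda>r. r" and W = "\<lambda>r. W (t - r)"]) auto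

lemma measurable_mass_L1: "(\<lambda>r. \<integral>\<^sup>+x. W r x \<partial>leb n) \<in> borel_measurable borel"
  using sigma_finite_measure.borel_measurable_nn_integral[OF sigma_finite_leb W] by simp

lemma measurable_duh [measurable]: "duh W t \<in> borel_measurable (leb n)"
proof -
  have "(\<lambda>z. (snd z, fst z)) \<in> leb n \<Otimes>\<^sub>M lborel \<rightarrow>\<^sub>M lborel \<Otimes>\<^sub>M leb n" by measurable
  from measurable_compose[OF this measurable_duh_integrand[of t]]
  have "(\<lambda>(x, r). if 0 < r then econv n (Y r) (W (t - r)) x else 0) \<in> borel_measurable (leb n \<Otimes>\<^sub>M lborel)"
    by (simp add: split_beta' cong: if_cong)
  then show ?thesis
    unfolding duh_def[abs_def] by (rule lborel.borel_measurable_nn_integral)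
qed

text \<open>Tonelli in (r, x), and \<open>nn_integral_econv\<close> at each r: translations preserve
  mass, so the L^1 mass of the Duhamel integral is the scalar convolution of \<open>\<kappa>\<close>
  with the L^1 mass of W.\<close>

lemma nn_integral_duh:
  "(\<integral>\<^sup>+x. duh W t x \<partial>leb n)
    = (\<integral>\<^sup>+r. ennreal (indicator {0<..} r * \<kappa> r) * (\<integral>\<^sup>+x. W (t - r) x \<partial>leb n) \<partial>lborel)"
proof -
  interpret L: pair_sigma_finite lborel "leb n"
    using sigma_finite_leb by (simp add: pair_sigma_finite_def lborel.sigma_finite_measure_axioms)
  have "(\<integral>\<^sup>+x. duh W t x \<partial>leb n)
      = (\<integral>\<^sup>+r. \<integral>\<^sup>+x. (if 0 < r then econv n (Y r) (W (t - r)) x else 0) \<partial>leb n \<partial>lborel)"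
    unfolding duh_def by (intro L.Fubini' measurable_duh_integrand)
  also have "\<dots> = (\<integral>\<^sup>+r. ennreal (indicator {0<..} r * \<kappa> r) * (\<integral>\<^sup>+x. W (t - r) x \<partial>leb n) \<partial>lborel)"
  proof (intro nn_integral_cong)
    fix r :: real
    show "(\<integral>\<^sup>+x. (if 0 < r then econv n (Y r) (W (t - r)) x else 0) \<partial>leb n)
        = ennreal (indicator {0<..} r * \<kappa> r) * (\<integral>\<^sup>+x. W (t - r) x \<partial>leb n)"
    proof (cases "0 < r")
      case True
      then interpret leb_measure n "Y r" by (rule leb_measure_Y)
      show ?thesis using True measurable_section by (simp add: nn_integral_econv emeasure_eq_measure)
    qed simp
  qed
  finally show ?thesis .
qed

end

lemma duh_add:
  assumes V [measurable]: "(\<lambda>(s, x). V s x) \<in> borel_measurable (borel \<Otimes>\<^sub>M leb n)"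
    and W [measurable]: "(\<lambda>(s, x). W s x) \<in> borel_measurable (borel \<Otimes>\<^sub>M leb n)"
    and x: "x \<in> space (leb n)"
  shows "duh (\<lambda>s x. V s x + W s x) t x = duh V t x + duh W t x"
proof -
  note [measurable] = measurable_section[OF V] measurable_section[OF W]
  have *: "(\<lambda>r. if 0 < r then econv n (Y r) (V (t - r)) x else 0) \<in> borel_measurable lborel"
    if "(\<lambda>(s, x). V s x) \<in> borel_measurable (borel \<Otimes>\<^sub>M leb n)" for V
    using measurable_compose[OF _ measurable_duh_integrand[OF that, of t], of "\<lambda>r. (r, x)" lborel] x by simp
  have "duh (\<lambda>s x. V s x + W s x) t x = (\<integral>\<^sup>+r. (if 0 < r then econv n (Y r) (V (t - r)) x else 0)
      + (if 0 < r then econv n (Y r) (W (t - r)) x else 0) \<partial>lborel)"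
    unfolding duh_def
  proof (intro nn_integral_cong)
    fix r :: real
    show "(if 0 < r then econv n (Y r) (\<lambda>x. V (t - r) x + W (t - r) x) x else 0)
        = (if 0 < r then econv n (Y r) (V (t - r)) x else 0) + (if 0 < r then econv n (Y r) (W (t - r)) x else 0)"
    proof (cases "0 < r")
      case True
      then interpret leb_measure n "Y r" by (rule leb_measure_Y)
      show ?thesis using True by (simp add: econv_def nn_integral_add)
    qed simp
  qed
  also have "\<dots> = duh V t x + duh W t x"
    unfolding duh_def by (intro nn_integral_add * V W)
  finally show ?thesis .
qed

lemma duh_mono:
  assumes "\<And>s y. y \<in> space (leb n) \<Longrightarrow> V s y \<le> W s y"
  shows "duh V t x \<le> duh W t x"
  unfolding duh_def econv_def using assms by (intro nn_integral_mono) (auto intro!: nn_integral_mono)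

text \<open>The part of \<open>W\<close> exceeding \<open>b\<close> has mass zero, hence so does its image under \<^const>\<open>duh\<close>. This avoids
  exchanging a.e. quantifiers.\<close>

lemma duh_AE_le:
  assumes W [measurable]: "(\<lambda>(s, x). W s x) \<in> borel_measurable (borel \<Otimes>\<^sub>M leb n)"
    and b [measurable]: "b \<in> borel_measurable borel"
    and le: "AE s in lborel. AE x in leb n. W s x \<le> b s"
  shows "AE x in leb n. duh W t x \<le> (\<integral>\<^sup>+r. ennreal (indicator {0<..} r * \<kappa> r) * b (t - r) \<partial>lborel)"
proof -
  define V where "V s x = (if W s x \<le> b s then 0 else W s x)" for s x
  have V [measurable]: "(\<lambda>(s, x). V s x) \<in> borel_measurable (borel \<Otimes>\<^sub>M leb n)"
    unfolding V_def split_beta' using W by (simp add: split_beta') measurable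
  have "AE s in lborel. (\<integral>\<^sup>+x. V s x \<partial>leb n) = 0"
    using le
  proof eventually_elim
    case (elim s)
    have "AE x in leb n. V s x = 0" using elim by eventually_elim (simp add: V_def)
    then show ?case using measurable_section[OF V, of s] by (simp add: nn_integral_0_iff_AE)
  qed
  \<comment> \<open>The reflection from r to t - r, written in affine form, preserves null
    sets.\<close>
  then have "AE r in lborel. (\<integral>\<^sup>+x. V (t + (- 1) * r) x \<partial>leb n) = 0"
    by (intro AE_borel_affine) (use measurable_mass_L1[OF V] in \<open>auto simp: pred_def\<close>)
  then have "(\<integral>\<^sup>+x. duh V t x \<partial>leb n) = (\<integral>\<^sup>+r. 0 \<partial>(lborel :: real measure))"
    unfolding nn_integral_duh[OF V] by (intro nn_integral_cong_AE) (auto elim!: eventually_mono)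
  then have "AE x in leb n. duh V t x = 0"
    using measurable_duh[OF V, of t] by (simp add: nn_integral_0_iff_AE)
  with AE_space show ?thesis
  proof eventually_elim
    case (elim x)
    have "duh W t x \<le> duh (\<lambda>s x. b s + V s x) t x"
      by (intro duh_mono) (auto simp: V_def)
    also have "\<dots> = duh (\<lambda>s x. b s) t x"
      using elim by (subst duh_add) auto
    also have "\<dots> = (\<integral>\<^sup>+r. ennreal (indicator {0<..} r * \<kappa> r) * b (t - r) \<partial>lborel)"
      unfolding duh_def
    proof (intro nn_integral_cong)
      fix r :: real
      show "(if 0 < r then econv n (Y r) (\<lambda>x. b (t - r)) x else 0) = ennreal (indicator {0<..} r * \<kappa> r) * b (t - r)"
      proof (cases "0 < r")
        case True
        then interpret leb_measure n "Y r" by (rule leb_measure_Y)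
        show ?thesis using True by (simp add: econv_def emeasure_eq_measure mult.commute)
      qed simp
    qed
    finally show ?case .
  qed
qed

end

section \<open>Duhamel bounds from past times, and the passage to Bochner integrals\<close>

context duhamel
begin

text \<open>Times s >= t carry no assumption and receive the bound \<open>\<top>\<close>. They
  correspond to r <= 0, where the kernel factor is 0 and its product with \<open>\<top>\<close> is
  0.\<close>

lemma duh_AE_le_past:
  assumes W: "(\<lambda>(s, x). W s x) \<in> borel_measurable (borel \<Otimes>\<^sub>M leb n)"
    and b [measurable]: "b \<in> borel_measurable borel"
    and le: "AE s in lborel. s < t \<longrightarrow> (AE x in leb n. W s x \<le> b s)"
  shows "AE x in leb n. duh W t x \<le> (\<integral>\<^sup>+r. ennreal (indicator {0<..} r * \<kappa> r) * b (t - r) \<partial>lborel)"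
proof -
  have "AE x in leb n. duh W t x
      \<le> (\<integral>\<^sup>+r. ennreal (indicator {0<..} r * \<kappa> r) * (if t - r < t then b (t - r) else \<top>) \<partial>lborel)"
    by (rule duh_AE_le[OF W, of "\<lambda>s. if s < t then b s else \<top>"])
       (measurable, use le in \<open>auto elim!: eventually_mono\<close>)
  also have "(\<integral>\<^sup>+r. ennreal (indicator {0<..} r * \<kappa> r) * (if t - r < t then b (t - r) else \<top>) \<partial>lborel)
      = (\<integral>\<^sup>+r. ennreal (indicator {0<..} r * \<kappa> r) * b (t - r) \<partial>lborel)"
    by (intro nn_integral_cong) (auto simp: indicator_def)
  finally show ?thesis .
qed

lemma nn_integral_duh_le_past:
  assumes W: "(\<lambda>(s, x). W s x) \<in> borel_measurable (borel \<Otimes>\<^sub>M leb n)"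
    and b [measurable]: "b \<in> borel_measurable borel"
    and le: "AE s in lborel. s < t \<longrightarrow> (\<integral>\<^sup>+x. W s x \<partial>leb n) \<le> b s"
  shows "(\<integral>\<^sup>+x. duh W t x \<partial>leb n) \<le> (\<integral>\<^sup>+r. ennreal (indicator {0<..} r * \<kappa> r) * b (t - r) \<partial>lborel)"
  unfolding nn_integral_duh[OF W]
proof (intro nn_integral_mono_AE)
  note [measurable] = measurable_mass_L1[OF W]
  have "AE r in lborel. t + (- 1) * r < t \<longrightarrow> (\<integral>\<^sup>+x. W (t + (- 1) * r) x \<partial>leb n) \<le> b (t + (- 1) * r)"
    using le by (intro AE_borel_affine) auto
  then show "AE r in lborel. ennreal (indicator {0<..} r * \<kappa> r) * (\<integral>\<^sup>+x. W (t - r) x \<partial>leb n)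
      \<le> ennreal (indicator {0<..} r * \<kappa> r) * b (t - r)"
    by eventually_elim (auto simp: indicator_def intro!: mult_left_mono)
qed

text \<open>A bound B in force only after time s costs no more than the kernel mass of the elapsed
  time t - s. This is what makes short steps cheap.\<close>

lemma nn_integral_kernel_step:
  "(\<integral>\<^sup>+r. ennreal (indicator {0<..} r * \<kappa> r) * (if s < t - r then B else 0) \<partial>lborel)
    \<le> B * ennreal (primitive (t - s))"
proof -
  have "(\<integral>\<^sup>+r. ennreal (indicator {0<..} r * \<kappa> r) * (if s < t - r then B else 0) \<partial>lborel)
      \<le> (\<integral>\<^sup>+r. B * ennreal (indicator {0<..t - s} r * \<kappa> r) \<partial>lborel)"
    by (intro nn_integral_mono) (auto simp: indicator_def mult.commute)
  also have "\<dots> = B * ennreal (primitive (t - s))"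
    by (simp add: nn_integral_cmult nn_integral_kernel del: indicator_simps)
  finally show ?thesis .
qed

lemma measurable_duh_shift_integrand:
  assumes W: "(\<lambda>(s, x). W s x) \<in> borel_measurable (borel \<Otimes>\<^sub>M leb n)"
  shows "(\<lambda>(s, x). if 0 < t - s then econv n (Y (t - s)) (W s) x else 0) \<in> borel_measurable (lborel \<Otimes>\<^sub>M leb n)"
  using measurable_section_lborel[OF W, of "\<lambda>s. s"]
  by (intro measurable_econv_joint[where \<rho> = "\<lambda>s. t - s"]) auto

lemma duh_shift:
  assumes W: "(\<lambda>(s, x). W s x) \<in> borel_measurable (borel \<Otimes>\<^sub>M leb n)" and x: "x \<in> space (leb n)"
  shows "duh W t x = (\<integral>\<^sup>+s. (if 0 < t - s then econv n (Y (t - s)) (W s) x else 0) \<partial>lborel)"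
proof -
  let ?f = "\<lambda>s. if 0 < t - s then econv n (Y (t - s)) (W s) x else 0"
  have "?f \<in> borel_measurable borel"
    using measurable_compose[OF _ measurable_duh_shift_integrand[OF W, of t], of "\<lambda>s. (s, x)" borel] x
    by simp
  from nn_integral_real_affine[OF this, of "- 1" t]
  have "(\<integral>\<^sup>+s. ?f s \<partial>lborel) = (\<integral>\<^sup>+r. ?f (t + (- 1) * r) \<partial>lborel)" by simp
  also have "\<dots> = duh W t x" unfolding duh_def by (intro nn_integral_cong) auto
  finally show ?thesis ..
qed

context
  fixes w :: "real \<Rightarrow> (nat \<Rightarrow> real) \<Rightarrow> real" and T :: real
    and W :: "real \<Rightarrow> (nat \<Rightarrow> real) \<Rightarrow> ennreal"
  assumes w_nonneg: "0 \<le> w s y"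
    and W_eq: "W s y = (if 0 < s \<and> s < T then ennreal (w s y) else 0)"
    and W_meas: "(\<lambda>(s, x). W s x) \<in> borel_measurable (borel \<Otimes>\<^sub>M leb n)"
begin

lemma P_op_eq_econv:
  assumes "0 < s" "s < T" "s < t" and x: "x \<in> space (leb n)"
  shows "P_op n Y (t - s) (w s) x = enn2real (if 0 < t - s then econv n (Y (t - s)) (W s) x else 0)"
proof -
  have "0 < t - s" using assms by simp
  then interpret leb_measure n "Y (t - s)" by (rule leb_measure_Y)
  have "(\<lambda>y. enn2real (W s y)) \<in> borel_measurable (leb n)"
    using measurable_section[OF W_meas, of s] by measurable
  moreover have eq: "W s = (\<lambda>y. ennreal (w s y))" using assms by (auto simp: W_eq fun_eq_iff)
  ultimately have "w s \<in> borel_measurable (leb n)" by (simp add: w_nonneg)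
  then show ?thesis
    unfolding P_op_def eq using w_nonneg x assms by (subst conv_eq_econv) auto
qed

text \<open>Finiteness of \<open>duh W t x\<close> makes the inner convolution finite for a.e. s, so
  that passing through \<open>enn2real\<close> under the time integral loses nothing.\<close>

lemma Duhamel_eq_duh:
  assumes t: "t \<le> T" and x: "x \<in> space (leb n)" and fin: "duh W t x < \<infinity>"
  shows "(LBINT s:{0<..<t}. P_op n Y (t - s) (w s) x) = enn2real (duh W t x)"
proof -
  define e where "e s = (if 0 < t - s then econv n (Y (t - s)) (W s) x else 0)" for s
  have e_meas [measurable]: "e \<in> borel_measurable borel"
    unfolding e_def
    using measurable_compose[OF _ measurable_duh_shift_integrand[OF W_meas, of t], of "\<lambda>s. (s, x)" borel] x
    by simp
  have zero: "e s = 0" if "s \<notin> {0<..<t}" for s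
    using that by (auto simp: econv_def W_eq e_def)
  have "(LBINT s:{0<..<t}. P_op n Y (t - s) (w s) x) = (LINT s|lborel. enn2real (e s))"
    unfolding set_lebesgue_integral_def
  proof (intro Bochner_Integration.integral_cong refl)
    fix s
    show "indicator {0<..<t} s *\<^sub>R P_op n Y (t - s) (w s) x = enn2real (e s)"
    proof (cases "s \<in> {0<..<t}")
      case True
      then show ?thesis using P_op_eq_econv[of s t x] t x by (simp add: e_def)
    next
      case False
      show ?thesis unfolding zero[OF False] using False by simp
    qed
  qed
  also have "\<dots> = enn2real (\<integral>\<^sup>+s. ennreal (enn2real (e s)) \<partial>lborel)"
    by (intro integral_eq_nn_integral) auto
  also have "(\<integral>\<^sup>+s. ennreal (enn2real (e s)) \<partial>lborel) = (\<integral>\<^sup>+s. e s \<partial>lborel)"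
  proof (intro nn_integral_cong_AE)
    have "AE s in lborel. e s \<noteq> \<infinity>"
      using fin duh_shift[OF W_meas x, of t, folded e_def] by (intro nn_integral_noteq_infinite) auto
    then show "AE s in lborel. ennreal (enn2real (e s)) = e s"
      by eventually_elim (auto simp: less_top)
  qed
  also have "\<dots> = duh W t x" unfolding e_def by (rule duh_shift[OF W_meas x, symmetric])
  finally show ?thesis .
qed

text \<open>Tonelli dominates the integral over (s, x) by the L^1 mass of \<open>duh W T\<close>.
  This provides the integrability clause of a mild solution at the final time.\<close>

lemma integrable_Duhamel:
  assumes fin: "(\<integral>\<^sup>+x. duh W T x \<partial>leb n) < \<infinity>"
  shows "integrable (restrict_space lborel {0<..<T} \<Otimes>\<^sub>M leb n) (\<lambda>(s, x). P_op n Y (T - s) (w s) x)"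
proof (rule integrableI_bounded)
  define e where "e s x = (if 0 < T - s then econv n (Y (T - s)) (W s) x else 0)" for s x
  note shift_meas = measurable_duh_shift_integrand[OF W_meas, of T, folded e_def]
  let ?M = "restrict_space lborel {0<..<T}"
  have "(\<lambda>z. (fst z, snd z)) \<in> ?M \<Otimes>\<^sub>M leb n \<rightarrow>\<^sub>M lborel \<Otimes>\<^sub>M leb n"
    by (intro measurable_Pair measurable_compose[OF measurable_fst] measurable_snd) (auto intro: measurable_restrict_space1)
  from measurable_compose[OF this shift_meas]
  have e_meas [measurable]: "(\<lambda>(s, x). e s x) \<in> borel_measurable (?M \<Otimes>\<^sub>M leb n)"
    by simp
  have eq: "P_op n Y (T - s) (w s) x = enn2real (e s x)" if "(s, x) \<in> space (?M \<Otimes>\<^sub>M leb n)" for s x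
    using that P_op_eq_econv[of s T x] by (auto simp: space_pair_measure space_restrict_space e_def)
  have "(\<lambda>(s, x). enn2real (e s x)) \<in> borel_measurable (?M \<Otimes>\<^sub>M leb n)"
    using e_meas by (simp add: split_beta')
  then show "(\<lambda>(s, x). P_op n Y (T - s) (w s) x) \<in> borel_measurable (?M \<Otimes>\<^sub>M leb n)"
    by (rule measurable_cong[THEN iffD1, rotated]) (auto simp: eq[symmetric])
  have "(\<integral>\<^sup>+z. ennreal (norm (case z of (s, x) \<Rightarrow> P_op n Y (T - s) (w s) x)) \<partial>(?M \<Otimes>\<^sub>M leb n))
      \<le> (\<integral>\<^sup>+z. (case z of (s, x) \<Rightarrow> e s x) \<partial>(?M \<Otimes>\<^sub>M leb n))"
  proof (intro nn_integral_mono)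
    fix z assume "z \<in> space (?M \<Otimes>\<^sub>M leb n)"
    moreover have "ennreal (enn2real b) \<le> b" for b by (cases b) auto
    ultimately show "ennreal (norm (case z of (s, x) \<Rightarrow> P_op n Y (T - s) (w s) x)) \<le> (case z of (s, x) \<Rightarrow> e s x)"
      using eq by (cases z) simp
  qed
  also have "\<dots> = (\<integral>\<^sup>+s. \<integral>\<^sup>+x. e s x \<partial>leb n \<partial>?M)"
    by (subst sigma_finite_measure.nn_integral_fst[OF sigma_finite_leb e_meas, symmetric]) simp
  also have "\<dots> \<le> (\<integral>\<^sup>+s. \<integral>\<^sup>+x. e s x \<partial>leb n \<partial>lborel)"
    by (subst nn_integral_restrict_space) (auto intro!: nn_integral_mono simp: indicator_def)
  also have "\<dots> = (\<integral>\<^sup>+x. \<integral>\<^sup>+s. e s x \<partial>lborel \<partial>leb n)"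
  proof -
    interpret L: pair_sigma_finite lborel "leb n"
      using sigma_finite_leb by (simp add: pair_sigma_finite_def lborel.sigma_finite_measure_axioms)
    show ?thesis by (rule L.Fubini'[symmetric, OF shift_meas])
  qed
  also have "\<dots> = (\<integral>\<^sup>+x. duh W T x \<partial>leb n)"
    unfolding e_def by (intro nn_integral_cong duh_shift[OF W_meas, symmetric])
  finally show "(\<integral>\<^sup>+z. ennreal (norm (case z of (s, x) \<Rightarrow> P_op n Y (T - s) (w s) x)) \<partial>(?M \<Otimes>\<^sub>M leb n)) < \<infinity>"
    using fin by simp
qed

end

end

lemma Linf_norm_le_iff:
  assumes [measurable]: "g \<in> borel_measurable (leb n)"
  shows "Linf_norm n g \<le> ereal R \<longleftrightarrow> (AE x in leb n. \<bar>g x\<bar> \<le> R)"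
proof
  assume "Linf_norm n g \<le> ereal R"
  then show "AE x in leb n. \<bar>g x\<bar> \<le> R"
    unfolding Linf_norm_def using esssup_AE[of "\<lambda>x. ereal \<bar>g x\<bar>" "leb n"]
    by (auto elim!: eventually_mono dest: order_trans simp flip: ereal_less_eq(3))
next
  assume "AE x in leb n. \<bar>g x\<bar> \<le> R"
  then show "Linf_norm n g \<le> ereal R"
    unfolding Linf_norm_def by (intro esssup_I) auto
qed

lemma L1_norm_eq_nn_integral:
  assumes "integrable (leb n) g"
  shows "ennreal (L1_norm n g) = (\<integral>\<^sup>+x. ennreal \<bar>g x\<bar> \<partial>leb n)"
  unfolding L1_norm_def using assms by (intro nn_integral_eq_integral[symmetric]) auto

section \<open>A priori bounds\<close>

lemma powr_eq_powr_diff_one_mult: "0 \<le> x \<Longrightarrow> x powr p = x powr (p - 1) * x" for x p :: real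
  using powr_mult_base[of x "p - 1"] by (simp add: mult.commute)

lemma mild_solution_eq:
  "mild_solution n Z Y p u0 \<tau> u \<Longrightarrow> 0 \<le> t \<Longrightarrow> t \<le> \<tau> \<Longrightarrow> AE x in leb n. u t x = S_op n Z t u0 x +
      (LBINT s:{0<..<t}. P_op n Y (t - s) (\<lambda>y. max 0 (u s y) powr p) x)"
  by (simp add: mild_solution_def)

text \<open>The setting of the contradiction argument before maximality enters: a solution on [0,T),
  known on each [0,\<tau>] separately with bounds that may depend on \<tau>. The condition
  \<open>small\<close> makes 2a a self-improving bound: past values below 2a give u(t) <= a + K(T)
  (2a)^p < 2a.\<close>

locale subcritical = duhamel Y F n for Y F n +
  fixes Z :: "real \<Rightarrow> (nat \<Rightarrow> real) measure" and p a T :: real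
    and u0 :: "(nat \<Rightarrow> real) \<Rightarrow> real" and u :: "real \<Rightarrow> (nat \<Rightarrow> real) \<Rightarrow> real"
  assumes p: "1 < p" and a: "0 < a" and T: "0 < T"
    and Z_prob: "0 < t \<Longrightarrow> prob_space (Z t)"
    and Z_sets: "0 < t \<Longrightarrow> sets (Z t) = sets (leb n)"
    and Z_weak: "continuous_on (space (leb n)) f \<Longrightarrow> bounded (f ` space (leb n)) \<Longrightarrow>
      continuous_on {0<..} (\<lambda>t. LINT x|Z t. (f x :: real))"
    and u0_int: "integrable (leb n) u0"
    and u0_bounds: "AE x in leb n. 0 \<le> u0 x \<and> u0 x \<le> a"
    and small: "primitive T * (2 * a) powr p < a"
    and nonneg_u: "0 \<le> t \<Longrightarrow> t < T \<Longrightarrow> AE x in leb n. 0 \<le> u t x"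
    and mild: "0 < \<tau> \<Longrightarrow> \<tau> < T \<Longrightarrow> mild_solution n Z Y p u0 \<tau> u"
begin

lemma leb_measure_Z: "0 < t \<Longrightarrow> leb_measure n (Z t)"
  using Z_prob[of t] Z_sets[of t] by (simp add: leb_measure_def leb_measure_axioms_def prob_space.finite_measure)

lemma conv_Z_bounds:
  assumes "0 < t"
  shows "AE x in leb n. 0 \<le> conv n (Z t) u0 x \<and> conv n (Z t) u0 x \<le> a"
proof -
  interpret leb_measure n "Z t" by (rule leb_measure_Z[OF assms])
  interpret prob_space "Z t" by (rule Z_prob[OF assms])
  show ?thesis
    using AE_translate[OF u0_bounds] AE_integrable_translate[OF u0_int]
  proof eventually_elim
    case (elim x)
    then show ?case
      unfolding conv_vsub by (auto intro!: integral_nonneg_AE integral_le_const elim: eventually_mono)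
  qed
qed

lemma nn_integral_conv_Z_le:
  assumes "0 < t"
  shows "(\<integral>\<^sup>+x. ennreal \<bar>conv n (Z t) u0 x\<bar> \<partial>leb n) \<le> (\<integral>\<^sup>+x. ennreal \<bar>u0 x\<bar> \<partial>leb n)"
proof -
  interpret leb_measure n "Z t" by (rule leb_measure_Z[OF assms])
  show ?thesis
    using conv_L1_le[OF u0_int] prob_space.emeasure_space_1[OF Z_prob[OF assms]] by simp
qed

lemma integrable_u: "0 \<le> t \<Longrightarrow> t < T \<Longrightarrow> integrable (leb n) (u t)"
  using mild[of "(t + T) / 2"] T unfolding mild_solution_def by auto

lemma u_0: "AE x in leb n. u 0 x = u0 x"
proof -
  have "AE x in leb n. u 0 x = S_op n Z 0 u0 x +
      (LBINT s:{0<..<0}. P_op n Y (0 - s) (\<lambda>y. max 0 (u s y) powr p) x)"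
    using mild[of "T / 2"] T by (intro mild_solution_eq[of n Z Y p u0 "T / 2"]) auto
  then show ?thesis by (simp add: S_op_def set_lebesgue_integral_def)
qed

lemma u_L1_continuous:
  assumes t: "0 \<le> t" "t < T"
  shows "((\<lambda>s. L1_norm n (\<lambda>x. u s x - u t x)) \<longlongrightarrow> 0) (at t within {0..<T})"
proof -
  define \<tau> where "\<tau> = (t + T) / 2"
  have \<tau>: "0 < \<tau>" "\<tau> < T" "t < \<tau>" using t by (auto simp: \<tau>_def)
  have "((\<lambda>s. L1_norm n (\<lambda>x. u s x - u t x)) \<longlongrightarrow> 0) (at t within {0..\<tau>})"
    using mild[OF \<tau>(1,2)] t \<tau> unfolding mild_solution_def by auto
  moreover have "at t within {0..\<tau>} = at t within {0..<T}"
    using \<tau> by (intro at_within_nhd[of _ "{..<\<tau>}"]) auto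
  ultimately show ?thesis by simp
qed

text \<open>Extension by zero puts all times on one measurable product space. Time 0 is kept,
  because the measurability of the extended solution on \<open>{0..T}\<close> is deduced from
  \<open>U\<close>.\<close>

definition U :: "real \<Rightarrow> (nat \<Rightarrow> real) \<Rightarrow> real" where
  "U s x = (if 0 \<le> s \<and> s < T then u s x else 0)"

definition W :: "real \<Rightarrow> (nat \<Rightarrow> real) \<Rightarrow> ennreal" where
  "W s x = (if 0 < s \<and> s < T then ennreal (max 0 (u s x) powr p) else 0)"

lemma measurable_U: "(\<lambda>(s, x). U s x) \<in> borel_measurable (borel \<Otimes>\<^sub>M leb n)"
proof -
  \<comment> \<open>The 2 in \<open>k + 2\<close> keeps \<open>\<tau> 0\<close> positive.\<close>
  define \<tau> where "\<tau> k = T * (1 - 1 / real (k + 2))" for k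
  have \<tau>: "0 < \<tau> k" "\<tau> k < T" for k using T by (auto simp: \<tau>_def field_simps add_pos_nonneg)
  \<comment> \<open>Clamping the time keeps the argument of u inside [0,\<tau> k], where the mild
    solution property provides joint measurability.\<close>
  define V where "V k = (\<lambda>(s, x). if 0 \<le> s \<and> s \<le> \<tau> k then u (max 0 (min s (\<tau> k))) x else 0)" for k
  have meas: "V k \<in> borel_measurable (borel \<Otimes>\<^sub>M leb n)" for k
  proof -
    have "(\<lambda>z. max 0 (min (fst z) (\<tau> k))) \<in> borel \<Otimes>\<^sub>M leb n \<rightarrow>\<^sub>M restrict_space borel {0..\<tau> k}"
      using \<tau>(1)[of k] by (intro measurable_restrict_space2) (auto simp: less_imp_le)
    then have "(\<lambda>z. (max 0 (min (fst z) (\<tau> k)), snd z))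
        \<in> borel \<Otimes>\<^sub>M leb n \<rightarrow>\<^sub>M restrict_space borel {0..\<tau> k} \<Otimes>\<^sub>M leb n"
      by (intro measurable_Pair) auto
    moreover have "(\<lambda>(t, x). u t x) \<in> borel_measurable (restrict_space borel {0..\<tau> k} \<Otimes>\<^sub>M leb n)"
      using mild[OF \<tau>] unfolding mild_solution_def by blast
    ultimately have [measurable]:
        "(\<lambda>z. u (max 0 (min (fst z) (\<tau> k))) (snd z)) \<in> borel_measurable (borel \<Otimes>\<^sub>M leb n)"
      using measurable_compose by fastforce
    show ?thesis unfolding V_def split_beta' by measurable
  qed
  have "(\<lambda>k. V k z) \<longlonglongrightarrow> (case z of (s, x) \<Rightarrow> U s x)" for z
  proof (cases z)
    case (Pair s x)
    show ?thesis
    proof (cases "0 \<le> s \<and> s < T")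
      case True
      have "\<tau> \<longlonglongrightarrow> T" unfolding \<tau>_def using T by real_asymp
      then have "\<forall>\<^sub>F k in sequentially. s < \<tau> k" using True by (intro order_tendstoD) auto
      moreover have "V k (s, x) = U s x" if "s < \<tau> k" for k
        using that True by (simp add: V_def U_def)
      ultimately show ?thesis
        unfolding Pair prod.case by (intro tendsto_eventually) (auto elim!: eventually_mono)
    next
      case False
      have "V k z = 0" for k using False \<tau>(2)[of k] by (auto simp: V_def Pair)
      then show ?thesis using False by (auto simp: Pair U_def)
    qed
  qed
  then show ?thesis by (rule borel_measurable_LIMSEQ_real[OF _ meas])
qed

lemma measurable_W: "(\<lambda>(s, x). W s x) \<in> borel_measurable (borel \<Otimes>\<^sub>M leb n)"
proof -
  note [measurable] = measurable_U[unfolded split_beta']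
  have "(\<lambda>z. if 0 < fst z \<and> fst z < T then ennreal (max 0 (U (fst z) (snd z)) powr p) else 0)
      \<in> borel_measurable (borel \<Otimes>\<^sub>M leb n)"
    by measurable
  moreover have "(\<lambda>(s, x). W s x)
      = (\<lambda>z. if 0 < fst z \<and> fst z < T then ennreal (max 0 (U (fst z) (snd z)) powr p) else 0)"
    by (auto simp: W_def U_def fun_eq_iff)
  ultimately show ?thesis by simp
qed

lemma W_le:
  assumes "0 < s \<longrightarrow> s < T \<longrightarrow> (AE x in leb n. u s x \<le> R)" "0 \<le> R"
  shows "AE x in leb n. W s x \<le> (if 0 < s then ennreal (R powr p) else 0)"
proof (cases "0 < s \<and> s < T")
  case True
  then have "AE x in leb n. u s x \<le> R" using assms(1) by blast
  then show ?thesis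
    by eventually_elim (use True assms(2) p in \<open>auto simp: W_def intro!: ennreal_leI powr_mono2\<close>)
next
  case False
  then have "W s x = 0" for x by (auto simp: W_def)
  then show ?thesis by simp
qed

text \<open>Splitting u^p as u^(p-1) u spends the sup bound on the first factor and leaves the L^1
  norm of the second.\<close>

lemma nn_integral_W_le:
  assumes "0 < s" "s < T" and le: "AE x in leb n. u s x \<le> R" and "0 \<le> R"
  shows "(\<integral>\<^sup>+x. W s x \<partial>leb n) \<le> ennreal (R powr (p - 1)) * (\<integral>\<^sup>+x. ennreal \<bar>u s x\<bar> \<partial>leb n)"
proof -
  have [measurable]: "u s \<in> borel_measurable (leb n)"
    using integrable_u[of s] assms by auto
  have "(\<integral>\<^sup>+x. W s x \<partial>leb n) \<le> (\<integral>\<^sup>+x. ennreal (R powr (p - 1)) * ennreal \<bar>u s x\<bar> \<partial>leb n)"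
  proof (intro nn_integral_mono_AE, use le in eventually_elim)
    case (elim x)
    have "max 0 (u s x) powr p \<le> R powr (p - 1) * \<bar>u s x\<bar>"
    proof (cases "u s x > 0")
      case True
      then have "u s x powr p = u s x powr (p - 1) * u s x"
        by (intro powr_eq_powr_diff_one_mult) simp
      also have "\<dots> \<le> R powr (p - 1) * u s x"
        using True elim p by (intro mult_right_mono powr_mono2) auto
      finally show ?thesis using True by simp
    next
      case False
      then have "max 0 (u s x) powr p = 0" by simp
      moreover have "0 \<le> R powr (p - 1) * \<bar>u s x\<bar>" by (intro mult_nonneg_nonneg) auto
      ultimately show ?thesis by linarith
    qed
    then show ?case using assms by (simp add: W_def ennreal_mult[symmetric] ennreal_leI)
  qed
  also have "\<dots> = ennreal (R powr (p - 1)) * (\<integral>\<^sup>+x. ennreal \<bar>u s x\<bar> \<partial>leb n)"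
    by (simp add: nn_integral_cmult)
  finally show ?thesis .
qed

lemma essentially_bounded:
  assumes "0 < \<tau>" "\<tau> < T"
  obtains R where "0 \<le> R" "AE s in lborel. 0 < s \<longrightarrow> s < \<tau> \<longrightarrow> (AE x in leb n. u s x \<le> R)"
proof -
  obtain R where R: "AE t in lborel. t \<in> {0<..<\<tau>} \<longrightarrow> Linf_norm n (u t) \<le> ereal R"
    using mild[OF assms] unfolding mild_solution_def by blast
  have "AE s in lborel. 0 < s \<longrightarrow> s < \<tau> \<longrightarrow> (AE x in leb n. u s x \<le> max 0 R)"
    using R
  proof eventually_elim
    case (elim s)
    show ?case
    proof (intro impI)
      assume s: "0 < s" "s < \<tau>"
      then have "u s \<in> borel_measurable (leb n)" using integrable_u[of s] assms by auto
      then have "AE x in leb n. \<bar>u s x\<bar> \<le> R" using elim s by (simp add: Linf_norm_le_iff)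
      then show "AE x in leb n. u s x \<le> max 0 R" by eventually_elim auto
    qed
  qed
  then show thesis using that[of "max 0 R"] by simp
qed

text \<open>The reverse triangle inequality turns continuity of the curve in L^1 into continuity of
  its norm, which is bounded on the compact interval.\<close>

lemma L1_bounded:
  assumes "0 < \<tau>" "\<tau> < T"
  obtains G where "0 \<le> G" "\<And>s. 0 \<le> s \<Longrightarrow> s \<le> \<tau> \<Longrightarrow> (\<integral>\<^sup>+x. ennreal \<bar>u s x\<bar> \<partial>leb n) \<le> ennreal G"
proof -
  have "continuous_on {0..\<tau>} (\<lambda>s. L1_norm n (u s))"
    unfolding continuous_on_def
  proof
    fix t assume t: "t \<in> {0..\<tau>}"
    have lim: "((\<lambda>s. L1_norm n (\<lambda>x. u s x - u t x)) \<longlongrightarrow> 0) (at t within {0..\<tau>})"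
      using mild[OF assms] t unfolding mild_solution_def by auto
    show "((\<lambda>s. L1_norm n (u s)) \<longlongrightarrow> L1_norm n (u t)) (at t within {0..\<tau>})"
    proof (rule LIM_zero_cancel, rule Lim_null_comparison[OF _ lim])
      show "\<forall>\<^sub>F s in at t within {0..\<tau>}. norm (L1_norm n (u s) - L1_norm n (u t)) \<le> L1_norm n (\<lambda>x. u s x - u t x)"
        unfolding eventually_at_filter
      proof (intro always_eventually allI impI)
        fix s assume s: "s \<in> {0..\<tau>}"
        have int: "integrable (leb n) (u s)" "integrable (leb n) (u t)"
          using s t assms by (auto intro: integrable_u)
        have "L1_norm n (u s) - L1_norm n (u t) = (LINT x|leb n. \<bar>u s x\<bar> - \<bar>u t x\<bar>)"
          unfolding L1_norm_def using int by simp
        also have "\<bar>\<dots>\<bar> \<le> (LINT x|leb n. \<bar>\<bar>u s x\<bar> - \<bar>u t x\<bar>\<bar>)" by (rule integral_abs_bound)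
        also have "\<dots> \<le> L1_norm n (\<lambda>x. u s x - u t x)"
          unfolding L1_norm_def using int by (intro integral_mono) auto
        finally show "norm (L1_norm n (u s) - L1_norm n (u t)) \<le> L1_norm n (\<lambda>x. u s x - u t x)" by simp
      qed
    qed
  qed
  then have "compact ((\<lambda>s. L1_norm n (u s)) ` {0..\<tau>})" by (intro compact_continuous_image) auto
  then have "bounded ((\<lambda>s. L1_norm n (u s)) ` {0..\<tau>})" by (rule compact_imp_bounded)
  then obtain G where "\<forall>x\<in>(\<lambda>s. L1_norm n (u s)) ` {0..\<tau>}. norm x \<le> G"
    unfolding bounded_iff by blast
  then have G: "\<bar>L1_norm n (u s)\<bar> \<le> G" if "s \<in> {0..\<tau>}" for s
    using that by auto
  have "(\<integral>\<^sup>+x. ennreal \<bar>u s x\<bar> \<partial>leb n) \<le> ennreal (max 0 G)" if "0 \<le> s" "s \<le> \<tau>" for s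
    using G[of s] that assms integrable_u[of s] by (simp add: L1_norm_eq_nn_integral[symmetric] ennreal_leI)
  then show thesis using that[of "max 0 G"] by simp
qed

text \<open>The crude constants R and G may depend on t. Mere finiteness is the aim, since it allows
  the Bochner integral in the mild formulation to be replaced by \<open>duh\<close>.\<close>

lemma duh_finite:
  assumes t: "0 < t" "t < T"
  shows "(\<integral>\<^sup>+x. duh W t x \<partial>leb n) < \<infinity>"
proof -
  obtain R where R: "0 \<le> R" "AE s in lborel. 0 < s \<longrightarrow> s < t \<longrightarrow> (AE x in leb n. u s x \<le> R)"
    using essentially_bounded[OF t] by blast
  obtain G where G: "0 \<le> G" "\<And>s. 0 \<le> s \<Longrightarrow> s \<le> t \<Longrightarrow> (\<integral>\<^sup>+x. ennreal \<bar>u s x\<bar> \<partial>leb n) \<le> ennreal G"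
    using L1_bounded[OF t] by blast
  have "(\<integral>\<^sup>+x. duh W t x \<partial>leb n) \<le> (\<integral>\<^sup>+r. ennreal (indicator {0<..} r * \<kappa> r)
      * (if 0 < t - r then ennreal (R powr (p - 1) * G) else 0) \<partial>lborel)"
  proof (rule nn_integral_duh_le_past[OF measurable_W])
    show "AE s in lborel. s < t \<longrightarrow> (\<integral>\<^sup>+x. W s x \<partial>leb n) \<le> (if 0 < s then ennreal (R powr (p - 1) * G) else 0)"
      using R(2)
    proof eventually_elim
      case (elim s)
      show ?case
      proof (intro impI)
        assume "s < t"
        show "(\<integral>\<^sup>+x. W s x \<partial>leb n) \<le> (if 0 < s then ennreal (R powr (p - 1) * G) else 0)"
        proof (cases "0 < s")
          case True
          have "(\<integral>\<^sup>+x. W s x \<partial>leb n) \<le> ennreal (R powr (p - 1)) * (\<integral>\<^sup>+x. ennreal \<bar>u s x\<bar> \<partial>leb n)"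
            using True \<open>s < t\<close> t elim R(1) by (intro nn_integral_W_le) auto
          also have "\<dots> \<le> ennreal (R powr (p - 1)) * ennreal G"
            using True \<open>s < t\<close> by (intro mult_left_mono G) auto
          finally show ?thesis using True G(1) by (simp add: ennreal_mult)
        qed (simp add: W_def)
      qed
    qed
  qed measurable
  also have "\<dots> \<le> ennreal (R powr (p - 1) * G) * ennreal (primitive (t - 0))"
    by (rule nn_integral_kernel_step)
  also have "\<dots> < \<infinity>" by (simp add: ennreal_mult_less_top)
  finally show ?thesis .
qed

lemma W_eq: "W s y = (if 0 < s \<and> s < T then ennreal (max 0 (u s y) powr p) else 0)"
  by (simp add: W_def)

lemma duh_AE_finite:
  assumes "(\<integral>\<^sup>+x. duh W t x \<partial>leb n) < \<infinity>"
  shows "AE x in leb n. duh W t x < \<infinity>"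
  using nn_integral_noteq_infinite[OF measurable_duh[OF measurable_W, of t]] assms
  by (auto simp: less_top)

lemma Duhamel_term:
  assumes "(\<integral>\<^sup>+x. duh W t x \<partial>leb n) < \<infinity>" "t \<le> T"
  shows "AE x in leb n. (LBINT s:{0<..<t}. P_op n Y (t - s) (\<lambda>y. max 0 (u s y) powr p) x) = enn2real (duh W t x)"
  using duh_AE_finite[OF assms(1)] AE_space
  by eventually_elim (rule Duhamel_eq_duh[OF _ W_eq measurable_W assms(2)], auto)

lemma u_eq:
  assumes t: "0 < t" "t < T"
  shows "AE x in leb n. u t x = conv n (Z t) u0 x + enn2real (duh W t x)"
proof -
  have "AE x in leb n. u t x = S_op n Z t u0 x +
      (LBINT s:{0<..<t}. P_op n Y (t - s) (\<lambda>y. max 0 (u s y) powr p) x)"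
    using mild[OF t] t by (intro mild_solution_eq[of n Z Y p u0 t]) auto
  with Duhamel_term[OF duh_finite[OF t]] t show ?thesis
    by (auto elim: eventually_elim2 simp: S_op_def)
qed

text \<open>The crude bound \<open>R\<close> is paid only on a time interval of length at most \<open>h\<close>, where the kernel has
  little mass.\<close>

lemma u_bound_step:
  assumes \<tau>: "0 < \<tau>" "\<tau> < T"
    and R: "0 \<le> R" "AE s in lborel. 0 < s \<longrightarrow> s < \<tau> \<longrightarrow> (AE x in leb n. u s x \<le> R)"
    and \<sigma>: "0 \<le> \<sigma>" "\<And>s. 0 < s \<Longrightarrow> s \<le> \<sigma> \<Longrightarrow> s \<le> \<tau> \<Longrightarrow> AE x in leb n. u s x \<le> 2 * a"
    and h: "0 < h" "primitive T * (2 * a) powr p + primitive h * R powr p \<le> a"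
    and t: "0 < t" "t \<le> \<sigma> + h" "t \<le> \<tau>"
  shows "AE x in leb n. u t x \<le> 2 * a"
proof -
  define A where "A = ennreal ((2 * a) powr p)"
  define B where "B = ennreal (R powr p)"
  \<comment> \<open>After time \<open>\<sigma>\<close> the crude bound B is added to A instead of
    replacing it, so that each summand falls under \<open>nn_integral_kernel_step\<close>.\<close>
  have "AE x in leb n. duh W t x \<le> (\<integral>\<^sup>+r. ennreal (indicator {0<..} r * \<kappa> r)
      * ((if 0 < t - r then A else 0) + (if \<sigma> < t - r then B else 0)) \<partial>lborel)"
  proof (rule duh_AE_le_past[OF measurable_W])
    show "AE s in lborel. s < t \<longrightarrow>
        (AE x in leb n. W s x \<le> (if 0 < s then A else 0) + (if \<sigma> < s then B else 0))"
      using R(2)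
    proof eventually_elim
      case (elim s)
      show ?case
      proof (intro impI)
        assume s: "s < t"
        show "AE x in leb n. W s x \<le> (if 0 < s then A else 0) + (if \<sigma> < s then B else 0)"
        proof (cases "\<sigma> < s")
          case True
          have "AE x in leb n. W s x \<le> (if 0 < s then B else 0)"
            unfolding B_def using elim s t R(1) by (intro W_le) auto
          then show ?thesis
            by eventually_elim (use True \<sigma>(1) in \<open>auto simp: add_increasing\<close>)
        next
          case False
          have "AE x in leb n. W s x \<le> (if 0 < s then A else 0)"
            unfolding A_def using \<sigma>(2)[of s] False s t a by (intro W_le) auto
          then show ?thesis using False by simp
        qed
      qed
    qed
  qed measurable
  moreover have "(\<integral>\<^sup>+r. ennreal (indicator {0<..} r * \<kappa> r)
      * ((if 0 < t - r then A else 0) + (if \<sigma> < t - r then B else 0)) \<partial>lborel)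
      \<le> ennreal a"
  proof -
    have "(\<integral>\<^sup>+r. ennreal (indicator {0<..} r * \<kappa> r)
        * ((if 0 < t - r then A else 0) + (if \<sigma> < t - r then B else 0)) \<partial>lborel)
      = (\<integral>\<^sup>+r. ennreal (indicator {0<..} r * \<kappa> r) * (if 0 < t - r then A else 0) \<partial>lborel)
        + (\<integral>\<^sup>+r. ennreal (indicator {0<..} r * \<kappa> r) * (if \<sigma> < t - r then B else 0) \<partial>lborel)"
      by (simp only: distrib_left, rule nn_integral_add) measurable
    also have "\<dots> \<le> A * ennreal (primitive (t - 0)) + B * ennreal (primitive (t - \<sigma>))"
      by (intro add_mono nn_integral_kernel_step)
    also have "\<dots> \<le> A * ennreal (primitive T) + B * ennreal (primitive h)"
      using t \<tau> by (intro add_mono mult_left_mono ennreal_leI primitive_mono) auto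
    also have "\<dots> = ennreal (primitive T * (2 * a) powr p + primitive h * R powr p)"
      using primitive_nonneg by (simp add: A_def B_def ennreal_mult mult.commute ennreal_plus[symmetric] del: ennreal_plus flip: ennreal_mult)
    also have "\<dots> \<le> ennreal a" using h(2) by (rule ennreal_leI)
    finally show ?thesis .
  qed
  ultimately have "AE x in leb n. duh W t x \<le> ennreal a" by (auto elim!: eventually_mono intro: order_trans)
  moreover have "AE x in leb n. u t x = conv n (Z t) u0 x + enn2real (duh W t x)"
    using t \<tau> by (intro u_eq) auto
  ultimately show ?thesis
    using conv_Z_bounds[OF t(1)]
  proof eventually_elim
    case (elim x)
    have "enn2real (duh W t x) \<le> a" using elim(1) a by (intro enn2real_leI) auto
    then show ?case using elim by auto
  qed
qed

text \<open>R bounds u a.e. on the whole of (0,t), so a single step length h serves every step and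
  finitely many steps reach t.\<close>

lemma u_bound:
  assumes t: "0 < t" "t < T"
  shows "AE x in leb n. u t x \<le> 2 * a"
proof -
  obtain R where R: "0 \<le> R" "AE s in lborel. 0 < s \<longrightarrow> s < t \<longrightarrow> (AE x in leb n. u s x \<le> R)"
    using essentially_bounded[OF t] by blast
  \<comment> \<open>The slack left by the smallness condition. It is later divided by 1 + R^p, which
    is positive even if R = 0.\<close>
  define \<delta> where "\<delta> = a - primitive T * (2 * a) powr p"
  have "0 < \<delta> / (1 + R powr p)" using small by (simp add: \<delta>_def add_pos_nonneg)
  then obtain h where h: "0 < h" "primitive h < \<delta> / (1 + R powr p)" by (rule primitive_small)
  have "primitive h * R powr p \<le> primitive h * (1 + R powr p)"
    using primitive_nonneg by (intro mult_left_mono) auto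
  also have "\<dots> \<le> \<delta>" using h(2) by (simp add: pos_less_divide_eq add_pos_nonneg less_imp_le)
  finally have h': "primitive T * (2 * a) powr p + primitive h * R powr p \<le> a" by (simp add: \<delta>_def)
  have steps: "\<forall>s. 0 < s \<and> s \<le> real j * h \<and> s \<le> t \<longrightarrow> (AE x in leb n. u s x \<le> 2 * a)" for j
  proof (induction j)
    case (Suc j)
    show ?case
    proof (intro allI impI)
      fix s assume s: "0 < s \<and> s \<le> real (Suc j) * h \<and> s \<le> t"
      show "AE x in leb n. u s x \<le> 2 * a"
        by (rule u_bound_step[OF t R, of "real j * h" h s])
           (use s Suc h(1) h' in \<open>auto simp: algebra_simps\<close>)
    qed
  qed auto
  obtain j where "t \<le> real j * h"
    using reals_Archimedean3[OF h(1), rule_format, of t] less_imp_le by blast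
  then show ?thesis using steps[of j] t by auto
qed

lemma u_AE_bounds:
  assumes t: "0 \<le> t" "t < T"
  shows "AE x in leb n. 0 \<le> u t x \<and> u t x \<le> 2 * a"
proof (cases "t = 0")
  case True
  then show ?thesis using u_0 u0_bounds by (auto elim: eventually_elim2)
next
  case False
  then have "AE x in leb n. u t x \<le> 2 * a" using t by (intro u_bound) auto
  with nonneg_u[OF t] show ?thesis by eventually_elim auto
qed

section \<open>The uniform L^1 bound\<close>

definition N :: real where "N = L1_norm n u0"

lemma ennreal_N: "ennreal N = (\<integral>\<^sup>+x. ennreal \<bar>u0 x\<bar> \<partial>leb n)"
  unfolding N_def by (rule L1_norm_eq_nn_integral[OF u0_int])

lemma N_nonneg: "0 \<le> N" by (simp add: N_def L1_norm_def)

text \<open>Given the sup bound, the Duhamel term is controlled linearly by the L^1 norm of the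
  past, with factor K(T) (2a)^(p-1). Dividing the smallness condition by 2a shows that this factor
  is at most 1/2.\<close>

lemma u_L1_step:
  assumes t: "0 < t" "t \<le> \<tau>" "\<tau> < T" and "0 \<le> G"
    and G: "\<And>s. 0 < s \<Longrightarrow> s < t \<Longrightarrow> (\<integral>\<^sup>+x. ennreal \<bar>u s x\<bar> \<partial>leb n) \<le> ennreal G"
  shows "(\<integral>\<^sup>+x. ennreal \<bar>u t x\<bar> \<partial>leb n) \<le> ennreal (N + G / 2)"
proof -
  have tT: "t < T" using t by simp
  have half: "primitive T * (2 * a) powr (p - 1) \<le> 1 / 2"
  proof -
    have "primitive T * ((2 * a) powr (p - 1) * (2 * a)) < a"
      using small a powr_eq_powr_diff_one_mult[of "2 * a" p] by simp
    then have "(primitive T * (2 * a) powr (p - 1)) * (2 * a) < 1 / 2 * (2 * a)" by (simp add: mult.assoc)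
    then show ?thesis using a by (subst (asm) mult_less_cancel_right) auto
  qed
  have "(\<integral>\<^sup>+x. duh W t x \<partial>leb n) \<le> (\<integral>\<^sup>+r. ennreal (indicator {0<..} r * \<kappa> r)
      * (if 0 < t - r then ennreal ((2 * a) powr (p - 1) * G) else 0) \<partial>lborel)"
  proof (rule nn_integral_duh_le_past[OF measurable_W])
    show "AE s in lborel. s < t \<longrightarrow>
        (\<integral>\<^sup>+x. W s x \<partial>leb n) \<le> (if 0 < s then ennreal ((2 * a) powr (p - 1) * G) else 0)"
    proof (intro AE_I2 impI)
      fix s assume "s < t"
      show "(\<integral>\<^sup>+x. W s x \<partial>leb n) \<le> (if 0 < s then ennreal ((2 * a) powr (p - 1) * G) else 0)"
      proof (cases "0 < s")
        case True
        have "(\<integral>\<^sup>+x. W s x \<partial>leb n) \<le> ennreal ((2 * a) powr (p - 1)) * (\<integral>\<^sup>+x. ennreal \<bar>u s x\<bar> \<partial>leb n)"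
          using True \<open>s < t\<close> tT a u_bound[of s] by (intro nn_integral_W_le) auto
        also have "\<dots> \<le> ennreal ((2 * a) powr (p - 1)) * ennreal G"
          using True \<open>s < t\<close> by (intro mult_left_mono G) auto
        finally show ?thesis using True \<open>0 \<le> G\<close> by (simp add: ennreal_mult)
      qed (simp add: W_def)
    qed
  qed measurable
  also have "\<dots> \<le> ennreal ((2 * a) powr (p - 1) * G) * ennreal (primitive (t - 0))"
    by (rule nn_integral_kernel_step)
  also have "\<dots> = ennreal (primitive t * (2 * a) powr (p - 1) * G)"
    using \<open>0 \<le> G\<close> primitive_nonneg by (simp add: ennreal_mult[symmetric] mult_ac)
  also have "\<dots> \<le> ennreal (G / 2)"
  proof (rule ennreal_leI)
    have "primitive t * (2 * a) powr (p - 1) \<le> primitive T * (2 * a) powr (p - 1)"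
      using tT by (intro mult_right_mono primitive_mono) auto
    then have "primitive t * (2 * a) powr (p - 1) * G \<le> 1 / 2 * G"
      using half \<open>0 \<le> G\<close> by (intro mult_right_mono) auto
    then show "primitive t * (2 * a) powr (p - 1) * G \<le> G / 2" by simp
  qed
  finally have duh_le: "(\<integral>\<^sup>+x. duh W t x \<partial>leb n) \<le> ennreal (G / 2)" .
  interpret Zt: leb_measure n "Z t" by (rule leb_measure_Z[OF t(1)])
  have [measurable]: "conv n (Z t) u0 \<in> borel_measurable (leb n)"
    using Zt.integrable_conv[OF u0_int] by auto
  note [measurable] = measurable_duh[OF measurable_W]
  have "(\<integral>\<^sup>+x. ennreal \<bar>u t x\<bar> \<partial>leb n) \<le> (\<integral>\<^sup>+x. ennreal \<bar>conv n (Z t) u0 x\<bar> + duh W t x \<partial>leb n)"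
    using u_eq[OF t(1) tT] duh_AE_finite[OF duh_finite[OF t(1) tT]]
  proof (intro nn_integral_mono_AE, eventually_elim)
    case (elim x)
    have "ennreal \<bar>u t x\<bar> \<le> ennreal (\<bar>conv n (Z t) u0 x\<bar> + enn2real (duh W t x))"
      using elim enn2real_nonneg[of "duh W t x"] by (intro ennreal_leI) linarith
    also have "\<dots> = ennreal \<bar>conv n (Z t) u0 x\<bar> + duh W t x"
      using elim by (simp add: less_top)
    finally show ?case .
  qed
  also have "\<dots> = (\<integral>\<^sup>+x. ennreal \<bar>conv n (Z t) u0 x\<bar> \<partial>leb n) + (\<integral>\<^sup>+x. duh W t x \<partial>leb n)"
    by (rule nn_integral_add) measurable
  also have "\<dots> \<le> ennreal N + ennreal (G / 2)"
    unfolding ennreal_N using nn_integral_conv_Z_le[OF t(1)] duh_le by (rule add_mono)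
  also have "\<dots> = ennreal (N + G / 2)" using N_nonneg \<open>0 \<le> G\<close> by simp
  finally show ?thesis .
qed

text \<open>With S the supremum of the norms over [0,t], \<open>u_L1_step\<close> gives S <= N +
  S/2. Absorbing S/2 requires S to be finite, which \<open>L1_bounded\<close> provides with a
  constant depending on t; the resulting 2N does not depend on it.\<close>

lemma u_L1_bound:
  assumes t: "0 \<le> t" "t < T"
  shows "(\<integral>\<^sup>+x. ennreal \<bar>u t x\<bar> \<partial>leb n) \<le> ennreal (2 * N)"
proof -
  have u0_eq: "(\<integral>\<^sup>+x. ennreal \<bar>u 0 x\<bar> \<partial>leb n) = ennreal N"
    unfolding ennreal_N using u_0 by (intro nn_integral_cong_AE) auto
  show ?thesis
  proof (cases "t = 0")
    case True
    then show ?thesis using u0_eq N_nonneg by (simp add: ennreal_leI)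
  next
    case False
    then have "0 < t" using t by simp
    define S where "S = (SUP s\<in>{0..t}. \<integral>\<^sup>+x. ennreal \<bar>u s x\<bar> \<partial>leb n)"
    obtain G where "0 \<le> G" "\<And>s. 0 \<le> s \<Longrightarrow> s \<le> t \<Longrightarrow> (\<integral>\<^sup>+x. ennreal \<bar>u s x\<bar> \<partial>leb n) \<le> ennreal G"
      using L1_bounded[OF \<open>0 < t\<close> t(2)] by blast
    then have "S \<le> ennreal G" unfolding S_def by (intro SUP_least) auto
    then have S: "S = ennreal (enn2real S)" by (simp add: le_less_trans[of S "ennreal G" \<top>])
    have "S \<le> ennreal (N + enn2real S / 2)"
      unfolding S_def
    proof (rule SUP_least, unfold S_def[symmetric])
      fix s assume s: "s \<in> {0..t}"
      show "(\<integral>\<^sup>+x. ennreal \<bar>u s x\<bar> \<partial>leb n) \<le> ennreal (N + enn2real S / 2)"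
      proof (cases "s = 0")
        case True
        then show ?thesis using u0_eq by (auto intro!: ennreal_leI)
      next
        case False
        have "(\<integral>\<^sup>+x. ennreal \<bar>u r x\<bar> \<partial>leb n) \<le> ennreal (enn2real S)" if "0 < r" "r < s" for r
          unfolding S[symmetric] unfolding S_def using that s by (intro SUP_upper) auto
        then show ?thesis using False s t by (intro u_L1_step[of s t]) auto
      qed
    qed
    then have "enn2real S \<le> N + enn2real S / 2"
      using N_nonneg by (subst (asm) S) (subst (asm) ennreal_le_iff, auto)
    then have "enn2real S \<le> 2 * N" by simp
    then have "S \<le> ennreal (2 * N)" by (subst S) (rule ennreal_leI)
    moreover have "(\<integral>\<^sup>+x. ennreal \<bar>u t x\<bar> \<partial>leb n) \<le> S"
      unfolding S_def using t by (intro SUP_upper) auto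
    ultimately show ?thesis by (rule order_trans[rotated])
  qed
qed

end

section \<open>Extension to the closed interval\<close>

text \<open>The mean value theorem on the open interval between the points avoids 0, where the power
  is covered only by continuity; the derivative is monotone because p > 1.\<close>

lemma powr_lipschitz:
  fixes x y b p :: real
  assumes p: "1 < p" and x: "0 \<le> x" "x \<le> b" and y: "0 \<le> y" "y \<le> b"
  shows "\<bar>x powr p - y powr p\<bar> \<le> p * b powr (p - 1) * \<bar>x - y\<bar>"
proof -
  have *: "\<bar>x powr p - y powr p\<bar> \<le> p * b powr (p - 1) * \<bar>x - y\<bar>" if xy: "0 \<le> x" "x < y" "y \<le> b" for x y
  proof -
    have "\<exists>l z. x < z \<and> z < y \<and> DERIV (\<lambda>t. t powr p) z :> l \<and> y powr p - x powr p = (y - x) * l"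
    proof (rule MVT[OF xy(2)])
      show "continuous_on {x..y} (\<lambda>t. t powr p)"
        using xy p by (intro continuous_on_powr' continuous_intros) auto
      show "(\<lambda>t. t powr p) differentiable (at z)" if "x < z" for z
        using xy that has_real_derivative_powr[of z p] by (auto simp: real_differentiable_def)
    qed
    then obtain l z where z: "x < z" "z < y" "DERIV (\<lambda>t. t powr p) z :> l" "y powr p - x powr p = (y - x) * l"
      by blast
    have "l = p * z powr (p - 1)"
      using DERIV_unique[OF z(3) has_real_derivative_powr] xy z(1) by simp
    moreover have "p * z powr (p - 1) \<le> p * b powr (p - 1)"
      using xy z p by (intro mult_left_mono powr_mono2) auto
    ultimately have "(y - x) * l \<le> (y - x) * (p * b powr (p - 1))"
      using xy by (intro mult_left_mono) auto
    moreover have "0 \<le> (y - x) * l" using \<open>l = p * z powr (p - 1)\<close> xy p by simp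
    ultimately show ?thesis using z(4) xy by (simp add: algebra_simps)
  qed
  consider "x < y" | "y < x" | "x = y" by linarith
  then show ?thesis
    using *[of x y] *[of y x] x y by cases (auto simp: abs_minus_commute)
qed

text \<open>Two additive inequalities stand in for a subtraction in ennreal. If e3 is finite and one
  of the values is \<open>\<top>\<close>, so is the other, and \<open>enn2real\<close> sends both to
  0.\<close>

lemma ennreal_abs_diff_le:
  assumes "e1 \<le> e2 + e3" "e2 \<le> e1 + e3"
  shows "ennreal \<bar>enn2real e1 - enn2real e2\<bar> \<le> e3"
proof (cases "e3 = \<top>")
  case False
  then obtain c where c: "0 \<le> c" "e3 = ennreal c" by (cases e3) auto
  show ?thesis
  proof (cases "e1 = \<top> \<or> e2 = \<top>")
    case True
    then have "e1 = \<top>" "e2 = \<top>" using assms c by (auto simp: top_unique)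
    then show ?thesis by simp
  next
    case fin: False
    then obtain x y where xy: "0 \<le> x" "e1 = ennreal x" "0 \<le> y" "e2 = ennreal y"
      by (cases e1; cases e2) auto
    then have "x \<le> y + c" "y \<le> x + c"
      using assms c by (auto simp: ennreal_plus[symmetric] simp del: ennreal_plus)
    then show ?thesis using xy c by (auto intro!: ennreal_leI)
  qed
qed simp

context subcritical
begin

section \<open>Convergence of the Duhamel integral at the final time\<close>

definition C :: real where "C = (2 * a) powr (p - 1) * (2 * N)"

lemma C_nonneg: "0 \<le> C" using N_nonneg by (simp add: C_def)

lemma nn_integral_W_le_C: "(\<integral>\<^sup>+x. W s x \<partial>leb n) \<le> ennreal C"
proof (cases "0 < s \<and> s < T")
  case True
  then have "(\<integral>\<^sup>+x. W s x \<partial>leb n) \<le> ennreal ((2 * a) powr (p - 1)) * (\<integral>\<^sup>+x. ennreal \<bar>u s x\<bar> \<partial>leb n)"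
    using u_bound[of s] a by (intro nn_integral_W_le) auto
  also have "\<dots> \<le> ennreal ((2 * a) powr (p - 1)) * ennreal (2 * N)"
    using True by (intro mult_left_mono u_L1_bound) auto
  also have "\<dots> = ennreal C" using N_nonneg by (simp add: C_def ennreal_mult)
  finally show ?thesis .
next
  case False
  then have "W s x = 0" for x by (auto simp: W_def)
  then show ?thesis by simp
qed

text \<open>The constant C is uniform on (0,T), unlike the ones behind \<open>duh_finite\<close>, so
  the estimate reaches t = T.\<close>

lemma duh_finite_T: "(\<integral>\<^sup>+x. duh W T x \<partial>leb n) < \<infinity>"
proof -
  have "(\<integral>\<^sup>+x. duh W T x \<partial>leb n) \<le> (\<integral>\<^sup>+r. ennreal (indicator {0<..} r * \<kappa> r)
      * (if 0 < T - r then ennreal C else 0) \<partial>lborel)"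
  proof (rule nn_integral_duh_le_past[OF measurable_W])
    show "AE s in lborel. s < T \<longrightarrow> (\<integral>\<^sup>+x. W s x \<partial>leb n) \<le> (if 0 < s then ennreal C else 0)"
    proof (intro AE_I2 impI)
      fix s
      show "(\<integral>\<^sup>+x. W s x \<partial>leb n) \<le> (if 0 < s then ennreal C else 0)"
        using nn_integral_W_le_C[of s] by (cases "0 < s") (simp, simp add: W_def)
    qed
  qed measurable
  also have "\<dots> \<le> ennreal C * ennreal (primitive (T - 0))" by (rule nn_integral_kernel_step)
  also have "\<dots> < \<infinity>" by (simp add: ennreal_mult_less_top)
  finally show ?thesis .
qed

text \<open>Both \<open>duh W t\<close> and \<open>duh W T\<close> are read as values at time \<open>T\<close>, of the shifted and of the original
  function; \<open>V t\<close> is their distance.\<close>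

definition V :: "real \<Rightarrow> real \<Rightarrow> (nat \<Rightarrow> real) \<Rightarrow> ennreal" where
  "V t s x = ennreal \<bar>enn2real (W (s + t - T) x) - enn2real (W s x)\<bar>"

lemma measurable_W_shift: "(\<lambda>(s, x). W (s + t - T) x) \<in> borel_measurable (borel \<Otimes>\<^sub>M leb n)"
proof -
  have "(\<lambda>z. (fst z + t - T, snd z)) \<in> borel \<Otimes>\<^sub>M leb n \<rightarrow>\<^sub>M borel \<Otimes>\<^sub>M leb n" by measurable
  from measurable_compose[OF this measurable_W] show ?thesis by (simp add: split_beta')
qed

lemma measurable_V: "(\<lambda>(s, x). V t s x) \<in> borel_measurable (borel \<Otimes>\<^sub>M leb n)"
  using measurable_W measurable_W_shift[of t] by (simp add: V_def split_beta')

lemma W_finite: "W s x < \<top>" by (simp add: W_def)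

lemma W_shift_le: "W (s + t - T) x \<le> W s x + V t s x" "W s x \<le> W (s + t - T) x + V t s x"
proof -
  obtain b c where "0 \<le> b" "W (s + t - T) x = ennreal b" "0 \<le> c" "W s x = ennreal c"
    using W_finite[of s x] W_finite[of "s + t - T" x]
    by (cases "W (s + t - T) x"; cases "W s x") auto
  then show "W (s + t - T) x \<le> W s x + V t s x" "W s x \<le> W (s + t - T) x + V t s x"
    by (auto simp: V_def ennreal_plus[symmetric] simp del: ennreal_plus intro!: ennreal_leI)
qed

lemma duh_W_shift: "duh W t x = duh (\<lambda>s. W (s + t - T)) T x"
  unfolding duh_def by (intro nn_integral_cong) (auto simp: algebra_simps)

text \<open>Each of the two functions is at most the other plus \<open>V t\<close>, so monotonicity
  and additivity of \<open>duh\<close> give the two inequalities required by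
  \<open>ennreal_abs_diff_le\<close>.\<close>

lemma duh_diff_le:
  assumes x: "x \<in> space (leb n)"
  shows "ennreal \<bar>enn2real (duh W t x) - enn2real (duh W T x)\<bar> \<le> duh (V t) T x"
proof (rule ennreal_abs_diff_le)
  have "duh W t x \<le> duh (\<lambda>s x. W s x + V t s x) T x"
    unfolding duh_W_shift[of t] using W_shift_le by (intro duh_mono)
  also have "\<dots> = duh W T x + duh (V t) T x"
    by (rule duh_add[OF measurable_W measurable_V x])
  finally show "duh W t x \<le> duh W T x + duh (V t) T x" .
  have "duh W T x \<le> duh (\<lambda>s x. W (s + t - T) x + V t s x) T x"
    using W_shift_le by (intro duh_mono)
  also have "\<dots> = duh W t x + duh (V t) T x"
    unfolding duh_W_shift[of t] by (rule duh_add[OF measurable_W_shift measurable_V x])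
  finally show "duh W T x \<le> duh W t x + duh (V t) T x" .
qed

text \<open>The domination for the limit at T. For s <= 0 the shifted time s + t - T is nonpositive
  as well, because t <= T, and both values of W are 0.\<close>

lemma nn_integral_V_le:
  assumes "t \<le> T"
  shows "(\<integral>\<^sup>+x. V t s x \<partial>leb n) \<le> (if 0 < s then ennreal (2 * C) else 0)"
proof (cases "0 < s")
  case True
  note [measurable] = measurable_section[OF measurable_W]
  have "(\<integral>\<^sup>+x. V t s x \<partial>leb n) \<le> (\<integral>\<^sup>+x. W (s + t - T) x + W s x \<partial>leb n)"
  proof (rule nn_integral_mono)
    fix x
    obtain b c where "0 \<le> b" "W (s + t - T) x = ennreal b" "0 \<le> c" "W s x = ennreal c"
      using W_finite[of s x] W_finite[of "s + t - T" x]
      by (cases "W (s + t - T) x"; cases "W s x") auto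
    then show "V t s x \<le> W (s + t - T) x + W s x"
      by (auto simp: V_def ennreal_plus[symmetric] simp del: ennreal_plus intro!: ennreal_leI)
  qed
  also have "\<dots> = (\<integral>\<^sup>+x. W (s + t - T) x \<partial>leb n) + (\<integral>\<^sup>+x. W s x \<partial>leb n)"
    by (rule nn_integral_add) measurable
  also have "\<dots> \<le> ennreal C + ennreal C" by (intro add_mono nn_integral_W_le_C)
  also have "\<dots> = ennreal (2 * C)" using C_nonneg by (simp add: ennreal_plus[symmetric] del: ennreal_plus)
  finally show ?thesis using True by simp
next
  case False
  then have "V t s x = 0" for x using assms by (simp add: V_def W_def)
  then show ?thesis using False by simp
qed

text \<open>Both solution values lie in [0,2a], where the power is Lipschitz; this transfers L^1
  continuity of u to the nonlinearity.\<close>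

lemma nn_integral_V_lipschitz:
  assumes s: "0 < s" "s < T" "0 < s + t - T" "t \<le> T"
  shows "(\<integral>\<^sup>+x. V t s x \<partial>leb n)
      \<le> ennreal (p * (2 * a) powr (p - 1)) * ennreal (L1_norm n (\<lambda>x. u (s + t - T) x - u s x))"
proof -
  have int: "integrable (leb n) (u (s + t - T))" "integrable (leb n) (u s)"
    using s by (auto intro!: integrable_u)
  have [measurable]: "u (s + t - T) \<in> borel_measurable (leb n)" "u s \<in> borel_measurable (leb n)"
    using int by auto
  have "AE x in leb n. 0 \<le> u (s + t - T) x \<and> u (s + t - T) x \<le> 2 * a"
    by (rule u_AE_bounds) (use s in auto)
  moreover have "AE x in leb n. 0 \<le> u s x \<and> u s x \<le> 2 * a"
    by (rule u_AE_bounds) (use s in auto)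
  ultimately have "(\<integral>\<^sup>+x. V t s x \<partial>leb n)
      \<le> (\<integral>\<^sup>+x. ennreal (p * (2 * a) powr (p - 1)) * ennreal \<bar>u (s + t - T) x - u s x\<bar> \<partial>leb n)"
  proof (intro nn_integral_mono_AE, eventually_elim)
    case (elim x)
    then have "\<bar>u (s + t - T) x powr p - u s x powr p\<bar> \<le> p * (2 * a) powr (p - 1) * \<bar>u (s + t - T) x - u s x\<bar>"
      using p by (intro powr_lipschitz) auto
    then show ?case
      using s elim p by (simp add: V_def W_def max_def ennreal_mult[symmetric] ennreal_leI)
  qed
  also have "\<dots> = ennreal (p * (2 * a) powr (p - 1)) * ennreal (L1_norm n (\<lambda>x. u (s + t - T) x - u s x))"
    using int by (simp add: nn_integral_cmult L1_norm_eq_nn_integral)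
  finally show ?thesis .
qed

text \<open>Dominated convergence in r, with 2C times the kernel on (0,T) as dominating function.
  For fixed r in (0,T) the time T - r lies strictly before T, where u is already known to be
  continuous in L^1.\<close>

lemma duh_V_tendsto:
  assumes S: "\<And>j. 0 < S j" "\<And>j. S j < T" "S \<longlonglongrightarrow> T"
  shows "(\<lambda>j::nat. \<integral>\<^sup>+x. duh (V (S j)) T x \<partial>leb n) \<longlonglongrightarrow> 0"
proof -
  let ?k = "\<lambda>r. ennreal (indicator {0<..} r * \<kappa> r)"
  have "(\<lambda>j. \<integral>\<^sup>+r. ?k r * (\<integral>\<^sup>+x. V (S j) (T - r) x \<partial>leb n) \<partial>lborel) \<longlonglongrightarrow> (\<integral>\<^sup>+r. 0 \<partial>(lborel :: real measure))"
  proof (rule nn_integral_dominated_convergence[where w = "\<lambda>r. ?k r * (if 0 < T - r then ennreal (2 * C) else 0)"])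
    show "(\<lambda>r. ?k r * (\<integral>\<^sup>+x. V (S j) (T - r) x \<partial>leb n)) \<in> borel_measurable lborel" for j
    proof -
      have "(\<lambda>r. T - r) \<in> borel \<rightarrow>\<^sub>M borel" by simp
      from measurable_compose[OF this measurable_mass_L1[OF measurable_V]]
      have "(\<lambda>r. \<integral>\<^sup>+x. V (S j) (T - r) x \<partial>leb n) \<in> borel_measurable lborel" by simp
      moreover have "?k \<in> borel_measurable lborel" by simp
      ultimately show ?thesis by (intro borel_measurable_times_ennreal)
    qed
    show "AE r in lborel. ?k r * (\<integral>\<^sup>+x. V (S j) (T - r) x \<partial>leb n) \<le> ?k r * (if 0 < T - r then ennreal (2 * C) else 0)" for j
    proof (intro AE_I2 mult_left_mono)
      fix r
      show "(\<integral>\<^sup>+x. V (S j) (T - r) x \<partial>leb n) \<le> (if 0 < T - r then ennreal (2 * C) else 0)"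
        using S(2)[of j] by (intro nn_integral_V_le) simp
    qed simp
    have "(\<integral>\<^sup>+r. ?k r * (if 0 < T - r then ennreal (2 * C) else 0) \<partial>lborel) \<le> ennreal (2 * C) * ennreal (primitive (T - 0))"
      by (rule nn_integral_kernel_step)
    also have "\<dots> < \<infinity>" by (simp add: ennreal_mult_less_top)
    finally show "(\<integral>\<^sup>+r. ?k r * (if 0 < T - r then ennreal (2 * C) else 0) \<partial>lborel) < \<infinity>" .
    show "AE r in lborel. (\<lambda>j. ?k r * (\<integral>\<^sup>+x. V (S j) (T - r) x \<partial>leb n)) \<longlonglongrightarrow> 0"
    proof (intro AE_I2)
      fix r :: real
      consider "r \<le> 0" | "T \<le> r" | "0 < r" "r < T" by linarith
      then show "(\<lambda>j. ?k r * (\<integral>\<^sup>+x. V (S j) (T - r) x \<partial>leb n)) \<longlonglongrightarrow> 0"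
      proof cases
        case 1 then show ?thesis by simp
      next
        case 2
        have "(\<integral>\<^sup>+x. V (S j) (T - r) x \<partial>leb n) = 0" for j
          using nn_integral_V_le[of "S j" "T - r"] S(2)[of j] 2 by simp
        then show ?thesis by simp
      next
        case 3
        define s where "s = T - r"
        have s: "0 < s" "s < T" using 3 by (auto simp: s_def)
        let ?f = "\<lambda>q. L1_norm n (\<lambda>x. u q x - u s x)"
        have "?f s = 0" by (simp add: L1_norm_def)
        then have cont: "continuous (at s within {0..<T}) ?f"
          using u_L1_continuous[of s] s by (simp add: continuous_within)
        have lim: "(\<lambda>j. s + S j - T) \<longlonglongrightarrow> s"
          using tendsto_diff[OF tendsto_add[OF tendsto_const[of s] S(3)] tendsto_const[of T]] by simp
        \<comment> \<open>For small j the shifted time may be nonpositive, so the Lipschitz estimate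
          holds only eventually.\<close>
        have ev: "\<forall>\<^sub>F j in sequentially. 0 < s + S j - T"
          using order_tendstoD(1)[OF lim s(1)] .
        then have mem: "\<forall>\<^sub>F j in sequentially. s + S j - T \<in> {0..<T}"
        proof eventually_elim
          case (elim j)
          then show ?case using S(2)[of j] s by auto
        qed
        have "(\<lambda>j. ?f (s + S j - T)) \<longlonglongrightarrow> ?f s"
          by (rule continuous_within_tendsto_compose[OF cont mem lim])
        then have "(\<lambda>j. ennreal (?f (s + S j - T))) \<longlonglongrightarrow> ennreal 0"
          unfolding \<open>?f s = 0\<close> by (rule tendsto_ennrealI)
        then have "(\<lambda>j. ?k r * (ennreal (p * (2 * a) powr (p - 1)) * ennreal (?f (s + S j - T))))
            \<longlonglongrightarrow> ?k r * (ennreal (p * (2 * a) powr (p - 1)) * ennreal 0)"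
          by (intro ennreal_tendsto_cmult) auto
        then have "(\<lambda>j. ?k r * (ennreal (p * (2 * a) powr (p - 1)) * ennreal (?f (s + S j - T)))) \<longlonglongrightarrow> 0"
          by simp
        then show ?thesis
        proof (rule tendsto_sandwich[OF _ _ tendsto_const, rotated 2])
          show "\<forall>\<^sub>F j in sequentially. ?k r * (\<integral>\<^sup>+x. V (S j) (T - r) x \<partial>leb n)
              \<le> ?k r * (ennreal (p * (2 * a) powr (p - 1)) * ennreal (?f (s + S j - T)))"
            using ev
          proof eventually_elim
            case (elim j)
            show ?case
              unfolding s_def[symmetric] using S(2)[of j] s elim
              by (intro mult_left_mono nn_integral_V_lipschitz) auto
          qed
        qed simp
      qed
    qed
    show "(\<lambda>r. ?k r * (if 0 < T - r then ennreal (2 * C) else 0)) \<in> borel_measurable lborel"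
      by measurable
  qed simp
  then show ?thesis by (simp add: nn_integral_duh[OF measurable_V])
qed

section \<open>The solution extended to [0,T]\<close>

definition v :: "real \<Rightarrow> (nat \<Rightarrow> real) \<Rightarrow> real" where
  "v t x = (if t < T then u t x else S_op n Z T u0 x +
     (LBINT s:{0<..<T}. P_op n Y (T - s) (\<lambda>y. max 0 (u s y) powr p) x))"

lemma integrable_Duhamel_T:
  "integrable (restrict_space lborel {0<..<T} \<Otimes>\<^sub>M leb n)
    (\<lambda>(s, x). P_op n Y (T - s) (\<lambda>y. max 0 (u s y) powr p) x)"
  by (rule integrable_Duhamel[OF _ W_eq measurable_W duh_finite_T]) simp

lemma integrable_v_T: "integrable (leb n) (v T)"
proof -
  interpret ZT: leb_measure n "Z T" by (rule leb_measure_Z[OF T])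
  interpret R: finite_measure "restrict_space (lborel :: real measure) {0<..<T}"
    using T by (intro finite_measureI) (simp add: emeasure_restrict_space space_restrict_space)
  interpret pair_sigma_finite "restrict_space (lborel :: real measure) {0<..<T}" "leb n"
    using sigma_finite_leb by (simp add: pair_sigma_finite_def R.sigma_finite_measure_axioms)
  have "integrable (leb n) (\<lambda>x. LINT s|restrict_space lborel {0<..<T}.
      P_op n Y (T - s) (\<lambda>y. max 0 (u s y) powr p) x)"
    using integrable_Duhamel_T by (rule integrable_snd)
  then have "integrable (leb n) (\<lambda>x. LBINT s:{0<..<T}. P_op n Y (T - s) (\<lambda>y. max 0 (u s y) powr p) x)"
    by (subst (asm) integral_restrict_space) (auto simp: set_lebesgue_integral_def)
  moreover have "integrable (leb n) (S_op n Z T u0)"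
    using ZT.integrable_conv[OF u0_int] T by (simp add: S_op_def)
  ultimately show ?thesis unfolding v_def by simp
qed

lemma integrable_v: "0 \<le> t \<Longrightarrow> t \<le> T \<Longrightarrow> integrable (leb n) (v t)"
  using integrable_v_T integrable_u[of t] by (cases "t = T") (auto simp: v_def[abs_def])

lemma v_T_eq: "AE x in leb n. v T x = conv n (Z T) u0 x + enn2real (duh W T x)"
  using Duhamel_term[OF duh_finite_T] T by (auto elim!: eventually_mono simp: v_def S_op_def)

text \<open>Sequences suffice for a left limit, and both ingredients are sequential:
  \<open>conv_weak_L1\<close> for the part with Z and \<open>duh_V_tendsto\<close> for the Duhamel
  part.\<close>

lemma v_L1_at_T:
  "((\<lambda>s. L1_norm n (\<lambda>x. v s x - v T x)) \<longlongrightarrow> 0) (at T within {0..T})"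
proof -
  have "((\<lambda>s. L1_norm n (\<lambda>x. v s x - v T x)) \<longlongrightarrow> 0) (at_left T)"
  proof (rule tendsto_at_left_sequentially[OF T])
    fix S :: "nat \<Rightarrow> real"
    assume S: "\<And>j. S j < T" "\<And>j. 0 < S j" "S \<longlonglongrightarrow> T"
    have conv_lim: "(\<lambda>j. \<integral>\<^sup>+x. ennreal \<bar>conv n (Z (S j)) u0 x - conv n (Z T) u0 x\<bar> \<partial>leb n) \<longlonglongrightarrow> 0"
    proof (rule conv_weak_L1[OF _ _ _ _ _ u0_int])
      fix f :: "(nat \<Rightarrow> real) \<Rightarrow> real"
      assume "continuous_on (space (leb n)) f" "bounded (f ` space (leb n))"
      then have "continuous_on {0<..} (\<lambda>t. LINT x|Z t. f x)" by (rule Z_weak)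
      then show "(\<lambda>j. LINT x|Z (S j). f x) \<longlonglongrightarrow> (LINT x|Z T. f x)"
        by (rule continuous_on_tendsto_compose) (use S T in auto)
    qed (use Z_prob Z_sets S T in auto)
    interpret ZT: leb_measure n "Z T" by (rule leb_measure_Z[OF T])
    note [measurable] = borel_measurable_integrable[OF ZT.integrable_conv[OF u0_int]]
    have le: "ennreal (L1_norm n (\<lambda>x. v (S j) x - v T x))
        \<le> (\<integral>\<^sup>+x. ennreal \<bar>conv n (Z (S j)) u0 x - conv n (Z T) u0 x\<bar> \<partial>leb n)
          + (\<integral>\<^sup>+x. duh (V (S j)) T x \<partial>leb n)" for j
    proof -
      interpret Zj: leb_measure n "Z (S j)" by (rule leb_measure_Z[OF S(2)])
      note [measurable] = borel_measurable_integrable[OF Zj.integrable_conv[OF u0_int]]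
        measurable_duh[OF measurable_V]
      have "integrable (leb n) (\<lambda>x. v (S j) x - v T x)"
        using S(1,2)[of j] T by (intro Bochner_Integration.integrable_diff integrable_v) auto
      then have "ennreal (L1_norm n (\<lambda>x. v (S j) x - v T x)) = (\<integral>\<^sup>+x. ennreal \<bar>v (S j) x - v T x\<bar> \<partial>leb n)"
        by (rule L1_norm_eq_nn_integral)
      also have "\<dots> \<le> (\<integral>\<^sup>+x. ennreal \<bar>conv n (Z (S j)) u0 x - conv n (Z T) u0 x\<bar> + duh (V (S j)) T x \<partial>leb n)"
        using u_eq[OF S(2,1)[of j]] v_T_eq AE_space[of "leb n"]
      proof (intro nn_integral_mono_AE, eventually_elim)
        case (elim x)
        have "ennreal \<bar>v (S j) x - v T x\<bar> \<le> ennreal (\<bar>conv n (Z (S j)) u0 x - conv n (Z T) u0 x\<bar>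
            + \<bar>enn2real (duh W (S j) x) - enn2real (duh W T x)\<bar>)"
        proof (rule ennreal_leI)
          have "v (S j) x = u (S j) x" using S(1)[of j] by (simp add: v_def)
          then show "\<bar>v (S j) x - v T x\<bar> \<le> \<bar>conv n (Z (S j)) u0 x - conv n (Z T) u0 x\<bar>
            + \<bar>enn2real (duh W (S j) x) - enn2real (duh W T x)\<bar>"
            using elim by linarith
        qed
        also have "\<dots> \<le> ennreal \<bar>conv n (Z (S j)) u0 x - conv n (Z T) u0 x\<bar> + duh (V (S j)) T x"
          using elim by (simp add: add_left_mono duh_diff_le)
        finally show ?case .
      qed
      also have "\<dots> = (\<integral>\<^sup>+x. ennreal \<bar>conv n (Z (S j)) u0 x - conv n (Z T) u0 x\<bar> \<partial>leb n)
          + (\<integral>\<^sup>+x. duh (V (S j)) T x \<partial>leb n)"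
        by (rule nn_integral_add) measurable
      finally show ?thesis .
    qed
    have "(\<lambda>j. (\<integral>\<^sup>+x. ennreal \<bar>conv n (Z (S j)) u0 x - conv n (Z T) u0 x\<bar> \<partial>leb n)
        + (\<integral>\<^sup>+x. duh (V (S j)) T x \<partial>leb n)) \<longlonglongrightarrow> 0"
      using tendsto_add[OF conv_lim duh_V_tendsto[OF S(2,1,3)]] by simp
    then have "(\<lambda>j. ennreal (L1_norm n (\<lambda>x. v (S j) x - v T x))) \<longlonglongrightarrow> 0"
      by (rule tendsto_sandwich[OF _ _ tendsto_const, rotated 2]) (auto simp: le)
    then show "(\<lambda>j. L1_norm n (\<lambda>x. v (S j) x - v T x)) \<longlonglongrightarrow> 0"
      by (subst (asm) ennreal_tendsto_0_iff) (auto simp: L1_norm_def)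
  qed
  then show ?thesis using T by (simp add: at_within_Icc_at_left)
qed

text \<open>Only time T is new. The Duhamel integrals run over s < t <= T, where v agrees with u, so
  the equation before T is inherited and the one at T is the definition of v. The sup bound on all
  of (0,T) is the uniform 2a.\<close>

lemma mild_solution_v: "mild_solution n Z Y p u0 T v"
  unfolding mild_solution_def
proof (intro conjI ballI)
  have "(\<lambda>z. U (fst z) (snd z)) \<in> borel_measurable (restrict_space borel {0..T} \<Otimes>\<^sub>M leb n)"
  proof -
    have "(\<lambda>z. (fst z, snd z)) \<in> restrict_space borel {0..T} \<Otimes>\<^sub>M leb n \<rightarrow>\<^sub>M borel \<Otimes>\<^sub>M leb n"
      by (intro measurable_Pair measurable_compose[OF measurable_fst] measurable_snd)
         (auto intro: measurable_restrict_space1)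
    from measurable_compose[OF this measurable_U] show ?thesis by (simp add: split_beta')
  qed
  moreover have "(\<lambda>z. fst z :: real) \<in> borel_measurable (restrict_space borel {0..T} \<Otimes>\<^sub>M leb n)"
    by (intro measurable_compose[OF measurable_fst] measurable_restrict_space1) auto
  moreover have "v T \<in> borel_measurable (leb n)" using integrable_v_T by auto
  ultimately have "(\<lambda>z. if fst z < T then U (fst z) (snd z) else v T (snd z))
      \<in> borel_measurable (restrict_space borel {0..T} \<Otimes>\<^sub>M leb n)"
    by measurable
  then show "(\<lambda>(t, x). v t x) \<in> borel_measurable (restrict_space borel {0..T} \<Otimes>\<^sub>M leb n)"
    by (rule measurable_cong[THEN iffD1, rotated])
       (auto simp: space_pair_measure space_restrict_space U_def v_def)
next
  fix t assume "t \<in> {0..T}"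
  then show "integrable (leb n) (v t)" by (intro integrable_v) auto
next
  fix t assume t: "t \<in> {0..T}"
  show "((\<lambda>s. L1_norm n (\<lambda>x. v s x - v t x)) \<longlongrightarrow> 0) (at t within {0..T})"
  proof (cases "t = T")
    case True
    then show ?thesis using v_L1_at_T by simp
  next
    case False
    then have tT: "0 \<le> t" "t < T" using t by auto
    have "\<forall>\<^sub>F s in at t within {0..<T}. s < T"
      by (auto simp: eventually_at_filter)
    then have "\<forall>\<^sub>F s in at t within {0..<T}. L1_norm n (\<lambda>x. u s x - u t x) = L1_norm n (\<lambda>x. v s x - v t x)"
      by eventually_elim (use tT in \<open>simp add: v_def\<close>)
    then have "((\<lambda>s. L1_norm n (\<lambda>x. v s x - v t x)) \<longlongrightarrow> 0) (at t within {0..<T})"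
      by (rule Lim_transform_eventually[OF u_L1_continuous[OF tT]])
    moreover have "at t within {0..<T} = at t within {0..T}"
      using tT by (intro at_within_nhd[of _ "{..<T}"]) auto
    ultimately show ?thesis by simp
  qed
next
  show "\<exists>R. AE t in lborel. t \<in> {0<..<T} \<longrightarrow> Linf_norm n (v t) \<le> ereal R"
  proof (intro exI[of _ "2 * a"] AE_I2 impI)
    fix t assume t: "t \<in> {0<..<T}"
    then have "u t \<in> borel_measurable (leb n)" using integrable_u[of t] by auto
    moreover have "AE x in leb n. 0 \<le> u t x \<and> u t x \<le> 2 * a"
      using t by (intro u_AE_bounds) auto
    then have "AE x in leb n. \<bar>u t x\<bar> \<le> 2 * a" by eventually_elim auto
    ultimately have "Linf_norm n (u t) \<le> ereal (2 * a)" by (simp only: Linf_norm_le_iff)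
    then show "Linf_norm n (v t) \<le> ereal (2 * a)" using t by (simp add: v_def[abs_def])
  qed
next
  have cong: "(\<lambda>y. max 0 (v s y) powr p) = (\<lambda>y. max 0 (u s y) powr p)" if "s < T" for s
    using that by (simp add: v_def)
  fix t assume t: "t \<in> {0..T}"
  have facts: "integrable (restrict_space lborel {0<..<t} \<Otimes>\<^sub>M leb n)
        (\<lambda>(s, x). P_op n Y (t - s) (\<lambda>y. max 0 (u s y) powr p) x) \<and>
      (AE x in leb n. v t x = S_op n Z t u0 x +
        (LBINT s:{0<..<t}. P_op n Y (t - s) (\<lambda>y. max 0 (u s y) powr p) x))"
  proof (cases "t = T")
    case True
    then show ?thesis using integrable_Duhamel_T by (simp add: v_def)
  next
    case False
    define \<tau> where "\<tau> = (t + T) / 2"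
    have \<tau>: "0 < \<tau>" "\<tau> < T" "t \<le> \<tau>" using t False T by (auto simp: \<tau>_def)
    have "v t x = u t x" for x using t False by (simp add: v_def)
    then show ?thesis using mild[OF \<tau>(1,2)] t \<tau>(3) unfolding mild_solution_def by simp
  qed
  show "integrable (restrict_space lborel {0<..<t} \<Otimes>\<^sub>M leb n)
      (\<lambda>(s, x). P_op n Y (t - s) (\<lambda>y. max 0 (v s y) powr p) x)"
    using conjunct1[OF facts] t
    by (subst Bochner_Integration.integrable_cong[OF refl,
          where g = "\<lambda>(s, x). P_op n Y (t - s) (\<lambda>y. max 0 (u s y) powr p) x"])
       (auto simp: space_pair_measure space_restrict_space cong)
  have "(LBINT s:{0<..<t}. P_op n Y (t - s) (\<lambda>y. max 0 (v s y) powr p) x)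
      = (LBINT s:{0<..<t}. P_op n Y (t - s) (\<lambda>y. max 0 (u s y) powr p) x)" for x
    using t by (intro set_lebesgue_integral_cong) (auto simp: cong)
  then show "AE x in leb n. v t x = S_op n Z t u0 x +
      (LBINT s:{0<..<t}. P_op n Y (t - s) (\<lambda>y. max 0 (v s y) powr p) x)"
    using conjunct2[OF facts] by simp
qed

end

section \<open>The lower bound for the existence time\<close>

text \<open>This rests on the space having nonzero measure: over a null space the essential supremum
  would be -\<infinity>.\<close>

lemma Linf_norm_nonneg: "0 \<le> Linf_norm n g"
proof -
  have "(0::ereal) = esssup (leb n) (\<lambda>_. 0)"
    using emeasure_leb_space by (simp add: esssup_const)
  also have "\<dots> \<le> Linf_norm n g"
    unfolding Linf_norm_def by (intro esssup_mono) auto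
  finally show ?thesis .
qed

lemma X_norm_facts:
  assumes \<phi>: "\<phi> \<in> X_space n"
  shows "integrable (leb n) \<phi>" "AE x in leb n. \<bar>\<phi> x\<bar> \<le> X_norm n \<phi>"
    and "\<not> (AE x in leb n. \<phi> x = 0) \<Longrightarrow> 0 < X_norm n \<phi>"
proof -
  show int: "integrable (leb n) \<phi>" using \<phi> by (simp add: X_space_def)
  obtain r where r: "0 \<le> r" "Linf_norm n \<phi> = ereal r"
    using \<phi> Linf_norm_nonneg[of n \<phi>] by (cases "Linf_norm n \<phi>") (auto simp: X_space_def)
  have L1: "0 \<le> L1_norm n \<phi>" by (simp add: L1_norm_def)
  have "AE x in leb n. \<bar>\<phi> x\<bar> \<le> r"
    using int r Linf_norm_le_iff[of \<phi> n r] by simp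
  then show "AE x in leb n. \<bar>\<phi> x\<bar> \<le> X_norm n \<phi>"
    by eventually_elim (use L1 r in \<open>simp add: X_norm_def\<close>)
  assume "\<not> (AE x in leb n. \<phi> x = 0)"
  then have "L1_norm n \<phi> \<noteq> 0"
    unfolding L1_norm_def using int by (subst integral_nonneg_eq_0_iff_AE) auto
  then show "0 < X_norm n \<phi>" using L1 r by (simp add: X_norm_def)
qed

lemma Y_family_duhamel:
  assumes Y: "Y_family \<alpha>1 \<alpha>2 c n Y"
  shows "duhamel Y (Psi \<alpha>1 \<alpha>2 c) n"
  using Y_family_laplace_kernel[OF Y] Y
  by (auto simp: duhamel_def duhamel_axioms_def Y_family_def)

text \<open>The origin of the constant: the powers of A and of M each combine to exponent 1, and
  2^(-p-2) 2^p = 1/4 leaves a strict inequality. Any factor below 2^(-p) would serve in its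
  place.\<close>

lemma scaled_data_bound:
  fixes p M A :: real
  assumes "0 < M" "0 < A"
  shows "(2 powr (- p - 2) * M powr (1 - p) * A powr (1 - p)) * (2 * (A * M)) powr p < A * M"
proof -
  have "(2 powr (- p - 2) * M powr (1 - p) * A powr (1 - p)) * (2 * (A * M)) powr p
      = (2 powr (- p - 2) * 2 powr p) * (M powr (1 - p) * M powr p) * (A powr (1 - p) * A powr p)"
    using assms by (simp add: powr_mult mult_ac)
  also have "\<dots> = 2 powr (- 2) * M * A"
    using assms by (simp add: powr_add[symmetric])
  also have "\<dots> = A * M / 4" using powr_realpow[of 2 2] by (simp add: powr_minus)
  finally have eq: "(2 powr (- p - 2) * M powr (1 - p) * A powr (1 - p)) * (2 * (A * M)) powr p = A * M / 4" .
  show ?thesis unfolding eq using assms by simp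
qed

text \<open>\<open>inv_into\<close> is a right inverse on the range of \<open>K_int \<psi>\<close>,
  and this range contains every y >= 0 because the transform blows up at 0.\<close>

lemma K_inv_facts:
  assumes "\<alpha>2 > 0" "c > 0" and \<psi>: "psi_kernel \<alpha>1 \<alpha>2 c \<psi>" and Y: "Y_family \<alpha>1 \<alpha>2 c n Y" and y: "0 \<le> y"
  shows "K_int \<psi> (K_inv \<psi> y) = y" "0 \<le> K_inv \<psi> y"
proof -
  interpret laplace_kernel "\<lambda>t. measure (Y t) (space (Y t))" "Psi \<alpha>1 \<alpha>2 c"
    by (rule Y_family_laplace_kernel[OF Y])
  have "\<exists>t\<ge>0. primitive t = y"
    using primitive_surj[OF Psi_at_0[OF assms(1,2)] y] .
  then have "y \<in> K_int \<psi> ` {0..}" using K_int_eq_primitive[OF \<psi> Y] by auto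
  then show "K_int \<psi> (K_inv \<psi> y) = y" "0 \<le> K_inv \<psi> y"
    unfolding K_inv_def using f_inv_into_f[of y "K_int \<psi>" "{0..}"] inv_into_into[of y "K_int \<psi>" "{0..}"]
    by auto
qed

lemma existence_time_ge_K_inv:
  fixes p M A :: real
  assumes p: "1 < p" and \<alpha>2: "0 < \<alpha>2" and c: "0 < c"
    and \<psi>: "psi_kernel \<alpha>1 \<alpha>2 c \<psi>" and Z: "Z_family \<alpha>1 \<alpha>2 c n Z" and Y: "Y_family \<alpha>1 \<alpha>2 c n Y"
    and \<phi>: "\<phi> \<in> X_space n" "AE x in leb n. 0 \<le> \<phi> x" and M: "X_norm n \<phi> = M" "0 < M"
    and A: "0 < A" and sol: "nonneg_maximal_mild_solution n Z Y p (\<lambda>x. A * \<phi> x) T u"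
  shows "ereal (K_inv \<psi> (2 powr (- p - 2) * M powr (1 - p) * A powr (1 - p))) \<le> T"
proof (rule ccontr)
  define y where "y = 2 powr (- p - 2) * M powr (1 - p) * A powr (1 - p)"
  assume "\<not> ereal (K_inv \<psi> (2 powr (- p - 2) * M powr (1 - p) * A powr (1 - p))) \<le> T"
  then have less: "T < ereal (K_inv \<psi> y)" by (simp add: y_def)
  have T_pos: "0 < T" using sol by (simp add: nonneg_maximal_mild_solution_def)
  obtain t where t: "T = ereal t" "0 < t" "t < K_inv \<psi> y"
    using T_pos less by (cases T) auto
  interpret duhamel Y "Psi \<alpha>1 \<alpha>2 c" n by (rule Y_family_duhamel[OF Y])
  have y: "0 \<le> y" by (simp add: y_def)
  have "primitive t \<le> primitive (K_inv \<psi> y)" using t by (intro primitive_mono) simp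
  also have "\<dots> = y"
    using K_inv_facts(1)[OF \<alpha>2 c \<psi> Y y] by (simp add: K_int_eq_primitive[OF \<psi> Y])
  finally have "primitive t \<le> y" .
  then have "primitive t * (2 * (A * M)) powr p \<le> y * (2 * (A * M)) powr p"
    by (intro mult_right_mono) auto
  also have "\<dots> < A * M" unfolding y_def by (rule scaled_data_bound[OF M(2) A])
  finally have small: "primitive t * (2 * (A * M)) powr p < A * M" .
  \<comment> \<open>The bound a is A * M: the norm M dominates the essential supremum of
    \<open>\<phi>\<close>, so A * M bounds the datum.\<close>
  interpret subcritical Y "Psi \<alpha>1 \<alpha>2 c" n Z p "A * M" t "\<lambda>x. A * \<phi> x" u
  proof (intro subcritical.intro subcritical_axioms.intro Y_family_duhamel[OF Y])
    show "1 < p" by (rule p)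
    show "0 < A * M" "0 < t" using A M t by auto
    show "prob_space (Z s)" if "0 < s" for s using Z that by (auto simp: Z_family_def)
    show "sets (Z s) = sets (leb n)" if "0 < s" for s using Z that by (auto simp: Z_family_def)
    show "continuous_on {0<..} (\<lambda>s. LINT x|Z s. f x)"
      if "continuous_on (space (leb n)) f" "bounded (f ` space (leb n))" for f :: "(nat \<Rightarrow> real) \<Rightarrow> real"
      using Z that by (simp add: Z_family_def)
    show "integrable (leb n) (\<lambda>x. A * \<phi> x)" using X_norm_facts(1)[OF \<phi>(1)] by simp
    show "AE x in leb n. 0 \<le> A * \<phi> x \<and> A * \<phi> x \<le> A * M"
      using X_norm_facts(2)[OF \<phi>(1)] \<phi>(2) by eventually_elim (use A M in auto)
    show "primitive t * (2 * (A * M)) powr p < A * M" by (rule small)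
    show "AE x in leb n. 0 \<le> u s x" if "0 \<le> s" "s < t" for s
      using sol that t(1) by (simp add: nonneg_maximal_mild_solution_def)
    show "mild_solution n Z Y p (\<lambda>x. A * \<phi> x) \<tau> u" if "0 < \<tau>" "\<tau> < t" for \<tau>
      using sol that t(1) by (simp add: nonneg_maximal_mild_solution_def)
  qed
  \<comment> \<open>The closed interval [0,T] itself, with \<open>v\<close> as extension, already
    contradicts maximality.\<close>
  have "T \<le> ereal t \<and> mild_solution n Z Y p (\<lambda>x. A * \<phi> x) t v \<and>
      (\<forall>s\<ge>0. ereal s < T \<longrightarrow> (AE x in leb n. v s x = u s x))"
    using mild_solution_v by (simp add: t(1) v_def)
  then have "\<exists>\<tau> w. T \<le> ereal \<tau> \<and> mild_solution n Z Y p (\<lambda>x. A * \<phi> x) \<tau> w \<and>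
      (\<forall>s\<ge>0. ereal s < T \<longrightarrow> (AE x in leb n. w s x = u s x))"
    by (intro exI)
  then show False
    using sol unfolding nonneg_maximal_mild_solution_def by (elim conjE) (rule notE)
qed

section \<open>Asymptotic lower bounds for \<open>K_inv\<close>\<close>

lemma primitive_power_bound_imp_ge:
  fixes y C \<tau> \<alpha> :: real
  assumes "0 \<le> y" "0 < \<alpha>" "0 < \<tau>" "0 < C" and le: "y \<le> C * \<tau> powr \<alpha>"
  shows "(y / C) powr (1 / \<alpha>) \<le> \<tau>"
proof -
  have "y / C \<le> \<tau> powr \<alpha>" using le assms by (simp add: divide_le_eq mult.commute)
  then have "(y / C) powr (1 / \<alpha>) \<le> (\<tau> powr \<alpha>) powr (1 / \<alpha>)"
    using assms by (intro powr_mono2) auto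
  then show ?thesis using assms by (simp add: powr_powr)
qed

lemma scaled_powr_eq:
  fixes k A p \<alpha> :: real
  assumes "0 < k" "0 < A"
  shows "(k * A powr (1 - p)) powr (1 / \<alpha>) = k powr (1 / \<alpha>) * A powr (- (p - 1) / \<alpha>)"
  using assms by (simp add: powr_mult powr_powr)

text \<open>The rate comes from solving c0 A^(1-p) = K(\<tau>) <= e Psi(1/\<tau>) <= 2 e
  \<tau>^\<alpha> for \<tau>. The last inequality is available only for small times with \<alpha>1
  and for large times with \<alpha>2, so each limit has to deal with the position of
  \<open>\<tau> A\<close>.\<close>

lemma K_inv_lower_bounds:
  fixes p c0 :: real
  assumes p: "1 < p" and \<alpha>: "0 < \<alpha>1" "0 < \<alpha>2" and c: "0 < c" and c0: "0 < c0"
    and \<psi>: "psi_kernel \<alpha>1 \<alpha>2 c \<psi>" and Y: "Y_family \<alpha>1 \<alpha>2 c n Y"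
  shows "\<exists>C>0. \<forall>\<^sub>F A in at_top. C * A powr (- (p - 1) / \<alpha>1) \<le> K_inv \<psi> (c0 * A powr (1 - p))"
    and "\<exists>C>0. \<forall>\<^sub>F A in at_right 0. C * A powr (- (p - 1) / \<alpha>2) \<le> K_inv \<psi> (c0 * A powr (1 - p))"
proof -
  interpret laplace_kernel "\<lambda>t. measure (Y t) (space (Y t))" "Psi \<alpha>1 \<alpha>2 c"
    by (rule Y_family_laplace_kernel[OF Y])
  \<comment> \<open>The factor e of \<open>primitive_le_laplace\<close> times the 2 of the bounds on
    \<open>Psi\<close>.\<close>
  define E where "E = exp (1::real) * 2"
  have E: "0 < E" by (simp add: E_def)
  define \<tau> where "\<tau> A = K_inv \<psi> (c0 * A powr (1 - p))" for A
  have \<tau>: "primitive (\<tau> A) = c0 * A powr (1 - p)" "0 \<le> \<tau> A" for A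
    using K_inv_facts[OF \<alpha>(2) c \<psi> Y, of "c0 * A powr (1 - p)"] c0
    by (auto simp: \<tau>_def K_int_eq_primitive[OF \<psi> Y])
  have \<tau>_pos: "0 < \<tau> A" if "0 < A" for A
  proof -
    have "primitive (\<tau> A) \<noteq> 0" using \<tau>(1)[of A] c0 that by simp
    then have "\<tau> A \<noteq> 0" using primitive_0 by metis
    then show ?thesis using \<tau>(2)[of A] by simp
  qed
  have bound: "(c0 / E) powr (1 / \<alpha>) * A powr (- (p - 1) / \<alpha>) \<le> \<tau> A"
    if "0 < A" "0 < \<alpha>" and le: "Psi \<alpha>1 \<alpha>2 c (1 / \<tau> A) \<le> 2 * \<tau> A powr \<alpha>" for A \<alpha>
  proof -
    have "c0 * A powr (1 - p) \<le> exp 1 * Psi \<alpha>1 \<alpha>2 c (1 / \<tau> A)"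
      using primitive_le_laplace[OF \<tau>_pos[OF that(1)]] unfolding \<tau>(1) .
    also have "\<dots> \<le> exp 1 * (2 * \<tau> A powr \<alpha>)" by (rule mult_left_mono[OF le]) simp
    finally have le': "c0 * A powr (1 - p) \<le> E * \<tau> A powr \<alpha>" by (simp add: E_def)
    have "0 \<le> c0 * A powr (1 - p)" using c0 by simp
    from primitive_power_bound_imp_ge[OF this that(2) \<tau>_pos[OF that(1)] E le']
    have "(c0 / E * A powr (1 - p)) powr (1 / \<alpha>) \<le> \<tau> A" by simp
    moreover have "0 < c0 / E" using c0 E by simp
    ultimately show ?thesis unfolding scaled_powr_eq[OF \<open>0 < c0 / E\<close> that(1)] by simp
  qed
  obtain d where d: "0 < d" "\<And>t. 0 < t \<Longrightarrow> t < d \<Longrightarrow> Psi \<alpha>1 \<alpha>2 c (1 / t) \<le> 2 * t powr \<alpha>1"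
    using Psi_inverse_small[OF \<alpha>(1) c, of \<alpha>2] unfolding eventually_at_right_field by blast
  define C1 where "C1 = (c0 / E) powr (1 / \<alpha>1)"
  have "((\<lambda>A. C1 * A powr (- (p - 1) / \<alpha>1)) \<longlongrightarrow> 0) at_top"
    using p \<alpha> by (intro tendsto_mult_right_zero[OF tendsto_neg_powr[OF _ filterlim_ident]]) (auto simp: divide_neg_pos)
  then have "\<forall>\<^sub>F A in at_top. C1 * A powr (- (p - 1) / \<alpha>1) < d"
    using d(1) by (rule order_tendstoD)
  then have "\<forall>\<^sub>F A in at_top. C1 * A powr (- (p - 1) / \<alpha>1) \<le> \<tau> A"
    using eventually_gt_at_top[of 0]
  proof eventually_elim
    case (elim A)
    \<comment> \<open>If \<open>\<tau> A\<close> is at least d, the claim is immediate, since its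
      left-hand side is eventually below d.\<close>
    show ?case
    proof (cases "\<tau> A < d")
      case True
      then show ?thesis
        unfolding C1_def using elim \<alpha> \<tau>_pos by (intro bound d(2)) auto
    qed (use elim in simp)
  qed
  then show "\<exists>C>0. \<forall>\<^sub>F A in at_top. C * A powr (- (p - 1) / \<alpha>1) \<le> K_inv \<psi> (c0 * A powr (1 - p))"
    unfolding \<tau>_def[symmetric] using c0 E by (intro exI[of _ C1]) (simp add: C1_def)
  obtain D where D: "\<And>t. D \<le> t \<Longrightarrow> Psi \<alpha>1 \<alpha>2 c (1 / t) \<le> 2 * t powr \<alpha>2"
    using Psi_inverse_large[OF \<alpha>(2) c, of \<alpha>1] unfolding eventually_at_top_linorder by blast
  define C2 where "C2 = (c0 / E) powr (1 / \<alpha>2)"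
  \<comment> \<open>As A tends to 0 the value of the primitive at \<open>\<tau> A\<close> exceeds
    its value at D, and monotonicity then forces \<open>\<tau> A\<close> beyond D.\<close>
  have "filterlim (\<lambda>A::real. c0 * A powr (1 - p)) at_top (at_right 0)"
    using p c0 by real_asymp
  then have "\<forall>\<^sub>F A in at_right 0. primitive D < c0 * A powr (1 - p)"
    by (simp add: filterlim_at_top_dense)
  moreover have "\<forall>\<^sub>F A::real in at_right 0. 0 < A" by (simp add: eventually_at_filter)
  ultimately have "\<forall>\<^sub>F A in at_right 0. C2 * A powr (- (p - 1) / \<alpha>2) \<le> \<tau> A"
  proof eventually_elim
    case (elim A)
    then have "D \<le> \<tau> A" using primitive_mono[of "\<tau> A" D] \<tau>(1)[of A] by (cases "D \<le> \<tau> A") auto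
    then show ?case unfolding C2_def using elim \<alpha> by (intro bound D) auto
  qed
  then show "\<exists>C>0. \<forall>\<^sub>F A in at_right 0. C * A powr (- (p - 1) / \<alpha>2) \<le> K_inv \<psi> (c0 * A powr (1 - p))"
    unfolding \<tau>_def[symmetric] using c0 E by (intro exI[of _ C2]) (simp add: C2_def)
qed

theorem proposition5p1:
  fixes p M :: real
  assumes "p > 1"
  shows "\<exists>c0>0. \<forall>(\<alpha>1::real) (\<alpha>2::real) (c::real) (n::nat) (\<phi> :: (nat \<Rightarrow> real) \<Rightarrow> real)
            (\<psi> :: real \<Rightarrow> real) (Z :: real \<Rightarrow> (nat \<Rightarrow> real) measure)
            (Y :: real \<Rightarrow> (nat \<Rightarrow> real) measure)
            (T :: real \<Rightarrow> ereal) (u :: real \<Rightarrow> real \<Rightarrow> (nat \<Rightarrow> real) \<Rightarrow> real).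
     \<alpha>1 \<in> {0<..<1} \<and> \<alpha>2 \<in> {0<..<1} \<and> c > 0 \<and> n \<ge> 1 \<and>
     bernstein (\<lambda>s. inverse (Psi \<alpha>1 \<alpha>2 c s)) \<and>
     psi_kernel \<alpha>1 \<alpha>2 c \<psi> \<and> Z_family \<alpha>1 \<alpha>2 c n Z \<and> Y_family \<alpha>1 \<alpha>2 c n Y \<and>
     \<phi> \<in> X_space n \<and> (AE x in leb n. 0 \<le> \<phi> x) \<and> \<not> (AE x in leb n. \<phi> x = 0) \<and>
     X_norm n \<phi> = M \<and>
     (\<forall>A>0. nonneg_maximal_mild_solution n Z Y p (\<lambda>x. A * \<phi> x) (T A) (u A))
     \<longrightarrow>
     (\<forall>A>0. T A \<ge> ereal (K_inv \<psi> (c0 * A powr (1 - p)))) \<and>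
     (\<exists>C>0. \<forall>\<^sub>F A in at_top. T A \<ge> ereal (C * A powr (- (p - 1) / \<alpha>1))) \<and>
     (\<exists>C>0. \<forall>\<^sub>F A in at_right 0. T A \<ge> ereal (C * A powr (- (p - 1) / \<alpha>2)))"
proof -
  \<comment> \<open>If \<^term>\<open>M \<le> 0\<close> the hypotheses are contradictory, but \<open>c0\<close> still has to be positive.\<close>
  define c0 where "c0 = (if 0 < M then 2 powr (- p - 2) * M powr (1 - p) else 1)"
  have c0: "0 < c0" by (simp add: c0_def)
  show ?thesis
  proof (rule exI[of _ c0], intro conjI c0 allI impI; elim conjE)
    fix \<alpha>1 \<alpha>2 c :: real and n :: nat and \<phi> :: "(nat \<Rightarrow> real) \<Rightarrow> real" and \<psi> :: "real \<Rightarrow> real"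
      and Z Y :: "real \<Rightarrow> (nat \<Rightarrow> real) measure" and T :: "real \<Rightarrow> ereal"
      and u :: "real \<Rightarrow> real \<Rightarrow> (nat \<Rightarrow> real) \<Rightarrow> real"
    assume \<alpha>: "\<alpha>1 \<in> {0<..<1}" "\<alpha>2 \<in> {0<..<1}" and c: "0 < c"
      and \<psi>: "psi_kernel \<alpha>1 \<alpha>2 c \<psi>" and Z: "Z_family \<alpha>1 \<alpha>2 c n Z" and Y: "Y_family \<alpha>1 \<alpha>2 c n Y"
      and \<phi>: "\<phi> \<in> X_space n" "AE x in leb n. 0 \<le> \<phi> x" "\<not> (AE x in leb n. \<phi> x = 0)"
      and M: "X_norm n \<phi> = M"
      and sol: "\<forall>A>0. nonneg_maximal_mild_solution n Z Y p (\<lambda>x. A * \<phi> x) (T A) (u A)"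
    have "0 < M" using X_norm_facts(3)[OF \<phi>(1,3)] M by simp
    have \<alpha>': "0 < \<alpha>1" "0 < \<alpha>2" using \<alpha> by auto
    have ge: "ereal (K_inv \<psi> (c0 * A powr (1 - p))) \<le> T A" if "0 < A" for A
    proof -
      have "nonneg_maximal_mild_solution n Z Y p (\<lambda>x. A * \<phi> x) (T A) (u A)" using sol that by blast
      from existence_time_ge_K_inv[OF assms \<alpha>'(2) c \<psi> Z Y \<phi>(1,2) M \<open>0 < M\<close> that this]
      show ?thesis using \<open>0 < M\<close> by (simp add: c0_def)
    qed
    then show "ereal (K_inv \<psi> (c0 * A powr (1 - p))) \<le> T A" if "0 < A" for A using that .
    note lower = K_inv_lower_bounds[OF assms \<alpha>' c c0 \<psi> Y]
    obtain C1 where C1: "0 < C1" "\<forall>\<^sub>F A in at_top. C1 * A powr (- (p - 1) / \<alpha>1) \<le> K_inv \<psi> (c0 * A powr (1 - p))"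
      using lower(1) by blast
    have "\<forall>\<^sub>F A in at_top. ereal (C1 * A powr (- (p - 1) / \<alpha>1)) \<le> T A"
      using C1(2) eventually_gt_at_top[of 0]
      by eventually_elim (use ge order_trans ereal_less_eq(3) in blast)
    then show "\<exists>C>0. \<forall>\<^sub>F A in at_top. ereal (C * A powr (- (p - 1) / \<alpha>1)) \<le> T A"
      using C1(1) by blast
    obtain C2 where C2: "0 < C2" "\<forall>\<^sub>F A in at_right 0. C2 * A powr (- (p - 1) / \<alpha>2) \<le> K_inv \<psi> (c0 * A powr (1 - p))"
      using lower(2) by blast
    have "\<forall>\<^sub>F A::real in at_right 0. 0 < A" by (simp add: eventually_at_filter)
    with C2(2) have "\<forall>\<^sub>F A in at_right 0. ereal (C2 * A powr (- (p - 1) / \<alpha>2)) \<le> T A"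
      by eventually_elim (use ge order_trans ereal_less_eq(3) in blast)
    then show "\<exists>C>0. \<forall>\<^sub>F A in at_right 0. ereal (C * A powr (- (p - 1) / \<alpha>2)) \<le> T A"
      using C2(1) by blast
  qed
qed

end
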